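(* Let $\mathcal{A}$ be a simple, pairwise intersecting arrangement of $n$ pseudocircles on the sphere. Suppose there is a further pseudocircle $C$ such that $\mathcal{A}\cup\{C\}$ is a simple arrangement of pseudocircles and, for any two pseudocircles $C',C''\in\mathcal{A}$, the two intersection points of $C'\cap C''$ lie in different components of the complement of $C$. Then $\mathcal{A}$ has at least $2n-4$ triangles.
   Context: A pseudocircle is a simple closed curve on the sphere. An arrangement of pseudocircles is a finite collection of pseudocircles such that any two are either disjoint or intersect in exactly two points, at which they cross; it is simple if no three pseudocircles share a point, and pairwise intersecting if every two pseudocircles intersect. A triangle is a cell of the induced decomposition of the sphere with exactly $3$ crossings on its boundary. *)

theory Defs
  imports "HOL-Analysis.Analysis"
begin

abbreviation S2 :: "(real^3) set" where
  "S2 \<equiv> sphere 0 1"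

definition pseudocircle :: "(real^3) set \<Rightarrow> bool" where
  "pseudocircle P \<longleftrightarrow> P \<subseteq> S2 \<and> P homeomorphic (sphere (0::real^2) 1)"

text \<open>Two pseudocircles meeting in exactly two points cross there iff each of them
  meets every component of the complement of the other (a touching point would
  keep one curve within the closure of one side of the other).\<close>

definition crossing :: "(real^3) set \<Rightarrow> (real^3) set \<Rightarrow> bool" where
  "crossing P Q \<longleftrightarrow>
     (\<forall>K \<in> components (S2 - P). Q \<inter> K \<noteq> {}) \<and>
     (\<forall>K \<in> components (S2 - Q). P \<inter> K \<noteq> {})"

definition arrangement :: "(real^3) set set \<Rightarrow> bool" where
  "arrangement \<A> \<longleftrightarrow> finite \<A> \<and> (\<forall>P\<in>\<A>. pseudocircle P) \<and>
     (\<forall>P\<in>\<A>. \<forall>Q\<in>\<A>. P \<noteq> Q \<longrightarrow>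
        P \<inter> Q = {} \<or> (finite (P \<inter> Q) \<and> card (P \<inter> Q) = 2 \<and> crossing P Q))"

definition simple_arrangement :: "(real^3) set set \<Rightarrow> bool" where
  "simple_arrangement \<A> \<longleftrightarrow> arrangement \<A> \<and>
     (\<forall>P\<in>\<A>. \<forall>Q\<in>\<A>. \<forall>R\<in>\<A>. P \<noteq> Q \<and> Q \<noteq> R \<and> P \<noteq> R \<longrightarrow> P \<inter> Q \<inter> R = {})"

definition pairwise_intersecting :: "(real^3) set set \<Rightarrow> bool" where
  "pairwise_intersecting \<A> \<longleftrightarrow> (\<forall>P\<in>\<A>. \<forall>Q\<in>\<A>. P \<noteq> Q \<longrightarrow> P \<inter> Q \<noteq> {})"

definition crossings :: "(real^3) set set \<Rightarrow> (real^3) set" where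
  "crossings \<A> = {x. \<exists>P\<in>\<A>. \<exists>Q\<in>\<A>. P \<noteq> Q \<and> x \<in> P \<and> x \<in> Q}"

definition triangles :: "(real^3) set set \<Rightarrow> (real^3) set set" where
  "triangles \<A> = {F \<in> components (S2 - \<Union>\<A>). card (closure F \<inter> crossings \<A>) = 3}"

end

theory Submission
  imports Defs
begin

text \<open>
  The curve \<open>C\<close> cuts every pseudocircle into one chord of each of the two sides \<open>K\<close>, \<open>K'\<close> of \<open>C\<close>,
  and on each side any two chords cross exactly once, as pseudolines do. It suffices to find
  \<open>n - 2\<close> triangles on each side.

  Number the chords along \<open>C\<close>. The order of the crossings along the chords can be read off from the
  sides of the Jordan curves; it is consistent on triples, and hence the chords can be swept,
  which turns the side \<open>K\<close> into a sequence of adjacent transpositions from the identity to the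
  reversal. Bounded faces correspond to consecutive transpositions at the same height. Following
  Felsner and Kriegel, each of the \<open>n (n - 2)\<close> bounded edges points to the face on the side where
  the two lines through its end points meet. That face is bounded, and a bounded face
  receives at most two edges, or three if it is a triangle. As there are \<open>(n - 1) (n - 2) / 2\<close>
  bounded faces, at least \<open>n - 2\<close> of them are triangles.
\<close>

section \<open>Triangles in a sweep of pseudolines\<close>

text \<open>Only triangles pass between topology and combinatorics. A triple of chords is empty if
  on each of them no further crossing lies between the other two; the three segments of such a
  triple bound a face, so no general dictionary between faces on the sphere and faces of the sweep
  is needed. In the count, \<open>N\<close> crossings on one side give at least
  \<open>2 * N - n\<close> bounded edges and at most \<open>N - (n - 1)\<close> bounded faces; edges
  therefore exceed twice the faces by at least \<open>n - 2\<close>, whatever \<open>N\<close> is.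

  The separation hypothesis makes each pseudocircle cut every other one once on each side of
  \<open>C\<close>. The two resulting arcs then contain one end of its chord each, so the ends of
  any two chords alternate along \<open>C\<close>. Of three chords, the first and the last along
  \<open>C\<close> each have the starts of the other two on one side, and this yields the
  consistency on triples.

  A lower bound on \<open>card\<close> presupposes finitely many triangles, which has to be proved
  for curves that are merely continuous. The triangles of the two sides are told apart by where
  their vertices lie.\<close>

text \<open>\<open>\<pi> T p\<close> is the line in position \<open>p\<close>, counted from below, before step \<open>T\<close>, which swaps the lines
  in positions \<open>\<kappa> T\<close> and \<open>\<kappa> T + 1\<close>.\<close>

locale sweep =
  fixes n N :: nat and \<pi> :: "nat \<Rightarrow> nat \<Rightarrow> nat" and \<kappa> :: "nat \<Rightarrow> nat"
  assumes init: "p < n \<Longrightarrow> \<pi> 0 p = p"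
    and level: "T < N \<Longrightarrow> Suc (\<kappa> T) < n"
    and step: "T < N \<Longrightarrow> \<pi> (Suc T) = (\<pi> T)(\<kappa> T := \<pi> T (Suc (\<kappa> T)), Suc (\<kappa> T) := \<pi> T (\<kappa> T))"
    and asc: "T < N \<Longrightarrow> \<pi> T (\<kappa> T) < \<pi> T (Suc (\<kappa> T))"
    and final: "p < n \<Longrightarrow> \<pi> N p = n - 1 - p"
begin

definition lo :: "nat \<Rightarrow> nat" where "lo T = \<pi> T (\<kappa> T)"
definition hi :: "nat \<Rightarrow> nat" where "hi T = \<pi> T (Suc (\<kappa> T))"

definition moves :: "nat \<Rightarrow> nat \<Rightarrow> bool" where
  "moves T x \<longleftrightarrow> x = lo T \<or> x = hi T"

definition edge :: "nat \<Rightarrow> nat \<Rightarrow> nat \<Rightarrow> bool" where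
  "edge x s t \<longleftrightarrow> s < t \<and> t < N \<and> moves s x \<and> moves t x \<and> (\<forall>r. s < r \<and> r < t \<longrightarrow> \<not> moves r x)"

definition face :: "nat \<Rightarrow> nat \<Rightarrow> bool" where
  "face s t \<longleftrightarrow> s < t \<and> t < N \<and> \<kappa> s = \<kappa> t \<and> (\<forall>r. s < r \<and> r < t \<longrightarrow> \<kappa> r \<noteq> \<kappa> t)"

definition meet :: "nat \<Rightarrow> nat \<Rightarrow> nat \<Rightarrow> bool" where
  "meet T x y \<longleftrightarrow> T < N \<and> {x, y} = {lo T, hi T}"

text \<open>One definition for both kinds of triangle: the middle crossing \<open>r\<close> lies
  above or below the edge of \<open>q\<close> that joins the first crossing to the last.\<close>

definition tri :: "nat \<Rightarrow> nat \<Rightarrow> bool" where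
  "tri s t \<longleftrightarrow> (\<exists>r p q w. edge p s r \<and> edge q s t \<and> edge w r t \<and>
     meet s p q \<and> meet r p w \<and> meet t q w)"

lemma lo_less_hi: "T < N \<Longrightarrow> lo T < hi T"
  using asc by (simp add: lo_def hi_def)

lemma step_simps:
  assumes "T < N"
  shows "\<pi> (Suc T) (\<kappa> T) = hi T" "\<pi> (Suc T) (Suc (\<kappa> T)) = lo T"
    "p \<noteq> \<kappa> T \<Longrightarrow> p \<noteq> Suc (\<kappa> T) \<Longrightarrow> \<pi> (Suc T) p = \<pi> T p"
  using step[OF assms] by (auto simp: lo_def hi_def)

lemma image_swap:
  assumes "T < N" "\<kappa> T \<in> A \<longleftrightarrow> Suc (\<kappa> T) \<in> A"
  shows "\<pi> (Suc T) ` A = \<pi> T ` A"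
proof -
  have *: "\<pi> (Suc T) = \<pi> T \<circ> (id(\<kappa> T := Suc (\<kappa> T), Suc (\<kappa> T) := \<kappa> T))"
    using step[OF assms(1)] by auto
  have "(id(\<kappa> T := Suc (\<kappa> T), Suc (\<kappa> T) := \<kappa> T)) ` A = A"
  proof (intro equalityI subsetI)
    fix z assume "z \<in> A"
    let ?f = "id(\<kappa> T := Suc (\<kappa> T), Suc (\<kappa> T) := \<kappa> T)"
    have "?f z \<in> A" "?f (?f z) = z" using \<open>z \<in> A\<close> assms(2) by auto
    then show "z \<in> ?f ` A" by (metis image_eqI)
  qed (use assms(2) in \<open>auto split: if_splits\<close>)
  then show ?thesis unfolding * image_comp[symmetric] by simp
qed

lemma image_lines: "T \<le> N \<Longrightarrow> \<pi> T ` {..<n} = {..<n}"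
proof (induction T)
  case 0 then show ?case using init by (auto simp: image_def)
next
  case (Suc T)
  then show ?case using image_swap[of T "{..<n}"] level[of T] by auto
qed

lemma inj_lines: "T \<le> N \<Longrightarrow> inj_on (\<pi> T) {..<n}"
  using image_lines[of T] by (intro eq_card_imp_inj_on) auto

lemma pi_inj: "T \<le> N \<Longrightarrow> p < n \<Longrightarrow> q < n \<Longrightarrow> \<pi> T p = \<pi> T q \<longleftrightarrow> p = q"
  using inj_lines[of T] by (auto simp: inj_on_def)

lemma pi_less: "T \<le> N \<Longrightarrow> p < n \<Longrightarrow> \<pi> T p < n"
  using image_lines[of T] by auto

lemma lo_hi_less: "T < N \<Longrightarrow> lo T < n" "T < N \<Longrightarrow> hi T < n"
  using pi_less[of T] level[of T] by (auto simp: lo_def hi_def)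

lemma moves_less: "moves T x \<Longrightarrow> T < N \<Longrightarrow> x < n"
  using lo_hi_less by (auto simp: moves_def)

text \<open>A set of bottom positions gains or loses a line only through a swap across its upper
  boundary. The existence proofs below rest on this: if a height stayed idle too long, the initial
  or the final order would have the wrong lines at the bottom.\<close>

lemma image_atMost_const:
  assumes "T \<le> T'" "T' \<le> N" "\<And>r. T \<le> r \<Longrightarrow> r < T' \<Longrightarrow> \<kappa> r \<noteq> k"
  shows "\<pi> T' ` {..k} = \<pi> T ` {..k}"
  using assms
proof (induction T' rule: dec_induct)
  case (step m)
  have "\<pi> (Suc m) ` {..k} = \<pi> m ` {..k}"
    using step by (intro image_swap) (auto simp: order_le_less Suc_le_eq)
  then show ?case using step by simp
qed simp

text \<open>Line \<open>n - 1\<close> ends in position 0, so it has to come down through every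
  gap.\<close>

lemma level_occurs:
  assumes "Suc k < n" shows "\<exists>T<N. \<kappa> T = k"
proof (rule ccontr)
  assume "\<not> ?thesis"
  then have "\<pi> N ` {..k} = \<pi> 0 ` {..k}" by (intro image_atMost_const) auto
  moreover have "\<pi> 0 ` {..k} = {..k}" using init assms by (auto simp: image_def)
  moreover have "\<pi> N 0 = n - 1" using final assms by auto
  ultimately have "n - 1 \<in> {..k}" by (metis atMost_iff image_eqI zero_le)
  then show False using assms by auto
qed

lemma line_stays:
  assumes "\<pi> (Suc s) q = x" "s < t" "t < N" "q < n" "\<And>r. s < r \<Longrightarrow> r < t \<Longrightarrow> \<not> moves r x"
  shows "s < r \<Longrightarrow> r \<le> t \<Longrightarrow> \<pi> r q = x \<and> (r < t \<longrightarrow> \<kappa> r \<noteq> q \<and> Suc (\<kappa> r) \<noteq> q)"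
proof (induction r)
  case (Suc r)
  have *: "\<pi> (Suc r) q = x"
  proof (cases "r = s")
    case False
    then have "\<pi> r q = x" "\<kappa> r \<noteq> q" "Suc (\<kappa> r) \<noteq> q" using Suc by auto
    then show ?thesis using step_simps(3)[of r q] Suc assms by auto
  qed (use assms in simp)
  then show ?case using assms(5)[of "Suc r"] Suc by (auto simp: moves_def lo_def hi_def)
qed simp

text \<open>After crossing upwards at \<open>s\<close> the line rests in position
  \<open>\<kappa> s + 1\<close>. Its next swap takes place with one of the two neighbours of that
  position, which leaves two heights for \<open>t\<close>.\<close>

lemma edge_lo:
  assumes "edge x s t" "x = lo s"
  shows "s < r \<Longrightarrow> r < t \<Longrightarrow> \<kappa> r \<noteq> \<kappa> s \<and> \<kappa> r \<noteq> Suc (\<kappa> s)"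
    and "x = lo t \<Longrightarrow> \<kappa> t = Suc (\<kappa> s)" and "x = hi t \<Longrightarrow> \<kappa> t = \<kappa> s"
proof -
  have e: "s < t" "t < N" "\<And>r. s < r \<Longrightarrow> r < t \<Longrightarrow> \<not> moves r x"
    using assms by (auto simp: edge_def)
  have q: "\<pi> (Suc s) (Suc (\<kappa> s)) = x" "Suc (\<kappa> s) < n" using step_simps(2)[of s] level[of s] e assms by auto
  note st = line_stays[OF q(1) e(1,2) q(2) e(3)]
  show "s < r \<Longrightarrow> r < t \<Longrightarrow> \<kappa> r \<noteq> \<kappa> s \<and> \<kappa> r \<noteq> Suc (\<kappa> s)" using st[of r] by auto
  have "\<pi> t (Suc (\<kappa> s)) = x" using st[of t] e by auto
  then show "x = lo t \<Longrightarrow> \<kappa> t = Suc (\<kappa> s)" "x = hi t \<Longrightarrow> \<kappa> t = \<kappa> s"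
    using pi_inj[of t "Suc (\<kappa> s)" "\<kappa> t"] pi_inj[of t "Suc (\<kappa> s)" "Suc (\<kappa> t)"] e q(2) level[of t]
    by (auto simp: lo_def hi_def)
qed

lemma edge_hi:
  assumes "edge x s t" "x = hi s"
  shows "s < r \<Longrightarrow> r < t \<Longrightarrow> \<kappa> r \<noteq> \<kappa> s \<and> Suc (\<kappa> r) \<noteq> \<kappa> s"
    and "x = lo t \<Longrightarrow> \<kappa> t = \<kappa> s" and "x = hi t \<Longrightarrow> Suc (\<kappa> t) = \<kappa> s"
proof -
  have e: "s < t" "t < N" "\<And>r. s < r \<Longrightarrow> r < t \<Longrightarrow> \<not> moves r x"
    using assms by (auto simp: edge_def)
  have q: "\<pi> (Suc s) (\<kappa> s) = x" "\<kappa> s < n" using step_simps(1)[of s] level[of s] e assms by auto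
  note st = line_stays[OF q(1) e(1,2) q(2) e(3)]
  show "s < r \<Longrightarrow> r < t \<Longrightarrow> \<kappa> r \<noteq> \<kappa> s \<and> Suc (\<kappa> r) \<noteq> \<kappa> s" using st[of r] by auto
  have "\<pi> t (\<kappa> s) = x" using st[of t] e by auto
  then show "x = lo t \<Longrightarrow> \<kappa> t = \<kappa> s" "x = hi t \<Longrightarrow> Suc (\<kappa> t) = \<kappa> s"
    using pi_inj[of t "\<kappa> s" "\<kappa> t"] pi_inj[of t "\<kappa> s" "Suc (\<kappa> t)"] e q(2) level[of t]
    by (auto simp: lo_def hi_def)
qed

text \<open>Position \<open>k + 1\<close> is the upper side of the face in gap \<open>k\<close>.
  Until that face is closed, its occupant changes only by swaps at height \<open>k + 1\<close>, and
  each of them brings down the larger label. So labels grow along the upper side of a face;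
  \<open>bot_mono\<close> is the mirror image for the lower side.\<close>

lemma top_mono:
  assumes "T \<le> T'" "T' \<le> N" "\<And>r. T \<le> r \<Longrightarrow> r < T' \<Longrightarrow> \<kappa> r \<noteq> k"
  shows "\<pi> T (Suc k) \<le> \<pi> T' (Suc k)"
  using assms
proof (induction T' rule: dec_induct)
  case (step m)
  have "\<pi> m (Suc k) \<le> \<pi> (Suc m) (Suc k)"
    using step.prems(1) step.prems(2)[of m] step.hyps step_simps[of m] lo_less_hi[of m]
    by (cases "\<kappa> m = Suc k") (auto simp: lo_def)
  then show ?case using step by auto
qed simp

lemma bot_mono:
  assumes "T \<le> T'" "T' \<le> N" "\<And>r. T \<le> r \<Longrightarrow> r < T' \<Longrightarrow> \<kappa> r \<noteq> k"
  shows "\<pi> T' k \<le> \<pi> T k"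
  using assms
proof (induction T' rule: dec_induct)
  case (step m)
  have "\<pi> (Suc m) k \<le> \<pi> m k"
    using step.prems(1) step.prems(2)[of m] step.hyps step_simps[of m] lo_less_hi[of m]
    by (cases "Suc (\<kappa> m) = k") (auto simp: hi_def)
  then show ?case using step by auto
qed simp

text \<open>An edge points to the face on the side where the two lines through its end points meet.
  Of a face only the edges at its first and at its last crossing can point to it.\<close>

definition points :: "nat \<Rightarrow> nat \<Rightarrow> nat \<Rightarrow> nat \<Rightarrow> nat \<Rightarrow> bool" where
  "points x s t s' t' \<longleftrightarrow>
     (s = s' \<and> x = lo s \<and> x = lo t \<and> hi s < hi t) \<or>
     (s = s' \<and> x = hi s \<and> x = hi t \<and> lo t < lo s) \<or>
     (t = t' \<and> x = lo s \<and> x = lo t \<and> hi t < hi s) \<or>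
     (t = t' \<and> x = hi s \<and> x = hi t \<and> lo s < lo t) \<or>
     (s = s' \<and> t = t' \<and> x = lo s \<and> x = hi t) \<or>
     (s = s' \<and> t = t' \<and> x = hi s \<and> x = lo t)"

lemma face_from:
  assumes "s < t" "t < N" "\<kappa> s = \<kappa> t" shows "\<exists>t'. face s t'"
proof -
  define t' where "t' = (LEAST r. s < r \<and> \<kappa> r = \<kappa> s)"
  have "s < t' \<and> \<kappa> t' = \<kappa> s" unfolding t'_def by (rule LeastI[of _ t]) (use assms in auto)
  moreover have "t' \<le> t" unfolding t'_def by (rule Least_le) (use assms in auto)
  moreover have "\<And>r. r < t' \<Longrightarrow> \<not> (s < r \<and> \<kappa> r = \<kappa> s)" unfolding t'_def by (rule not_less_Least)
  ultimately show ?thesis using assms unfolding face_def by (intro exI[of _ t']) auto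
qed

lemma face_to:
  assumes "s < t" "t < N" "\<kappa> s = \<kappa> t" shows "\<exists>s'. face s' t"
proof -
  define s' where "s' = (GREATEST r. r < t \<and> \<kappa> r = \<kappa> t)"
  have "s' < t \<and> \<kappa> s' = \<kappa> t" unfolding s'_def
    by (rule GreatestI_nat[of _ s t]) (use assms in auto)
  moreover have "\<And>r. r < t \<and> \<kappa> r = \<kappa> t \<Longrightarrow> r \<le> s'" unfolding s'_def
    by (rule Greatest_le_nat[of _ _ t]) auto
  ultimately show ?thesis using assms unfolding face_def by (intro exI[of _ s']) force
qed

text \<open>If the line turns back at \<open>t\<close>, the edge is a whole side of the face between
  \<open>s\<close> and \<open>t\<close>. If it climbs or descends twice, its two partners lie on
  different sides of it in between, and comparing their labels tells whether they cross later or
  have crossed before. That crossing forces the face on its side to be bounded.\<close>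

lemma edge_points:
  assumes "edge x s t" shows "\<exists>s' t'. face s' t' \<and> points x s t s' t'"
proof -
  have e: "s < t" "t < N" using assms by (auto simp: edge_def)
  consider (UU) "x = lo s" "x = lo t" | (UD) "x = lo s" "x = hi t"
    | (DU) "x = hi s" "x = lo t" | (DD) "x = hi s" "x = hi t"
    using assms by (auto simp: edge_def moves_def)
  then show ?thesis
  proof cases
    case UD
    then have "face s t" using edge_lo[OF assms] e by (auto simp: face_def)
    then show ?thesis using UD by (auto simp: points_def)
  next
    case DU
    then have "face s t" using edge_hi[OF assms] e by (auto simp: face_def)
    then show ?thesis using DU by (auto simp: points_def)
  next
    case UU
    note l = edge_lo[OF assms UU(1)]
    define k where "k = \<kappa> s"
    have k: "\<kappa> t = Suc k" "Suc (Suc k) < n" using l(2) UU level[of t] e by (auto simp: k_def)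
    have im: "\<pi> t ` {..k} = \<pi> (Suc s) ` {..k}"
      using l(1) e by (intro image_atMost_const) (auto simp: k_def)
    have hs: "hi s \<in> \<pi> (Suc s) ` {..k}"
      using step_simps(1)[of s] e by (intro image_eqI[of _ _ k]) (auto simp: k_def)
    then obtain p where p: "p \<le> k" "hi s = \<pi> t p" using im by auto
    then have ne: "hi s \<noteq> hi t" using pi_inj[of t p "Suc (Suc k)"] k e by (auto simp: hi_def)
    show ?thesis
    proof (cases "hi s < hi t")
      case True
      \<comment> \<open>After \<open>s\<close> the line \<open>hi s\<close> is at most in position
        \<open>k\<close>, after \<open>t\<close> the line \<open>hi t\<close> is above it. With no
        further swap at height \<open>k\<close> this would last to the end, although the final order
        puts the larger label \<open>hi t\<close> lower.\<close>
      have "\<exists>t'>s. t' < N \<and> \<kappa> t' = k"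
      proof (rule ccontr)
        assume "\<not> ?thesis"
        then have im2: "\<pi> N ` {..k} = \<pi> (Suc s) ` {..k}" "\<pi> N ` {..k} = \<pi> (Suc t) ` {..k}"
          using e by - (rule image_atMost_const; force)+
        obtain a where a: "a \<le> k" "hi s = \<pi> N a" using hs unfolding im2(1)[symmetric] by auto
        obtain b where b: "b < n" "hi t = \<pi> N b"
          using lo_hi_less(2)[of t] e image_lines[of N] by (metis imageE lessThan_iff order_refl)
        have "b > k"
        proof (rule ccontr)
          assume "\<not> k < b"
          then have "hi t \<in> \<pi> (Suc t) ` {..k}" using b im2 by auto
          then obtain c where "c \<le> k" "hi t = \<pi> (Suc t) c" by auto
          then show False using step_simps(1)[of t] pi_inj[of "Suc t" c "Suc k"] e k by auto
        qed
        then show False using a b final[of a] final[of b] True k by auto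
      qed
      then obtain t' where "face s t'" using face_from[of s] unfolding k_def by metis
      then show ?thesis using UU True by (auto simp: points_def)
    next
      case False
      \<comment> \<open>Now the partners have crossed already. With no swap at height
        \<open>k + 1\<close> before \<open>t\<close>, the bottom \<open>k + 2\<close> positions
        would still hold the initial labels, which puts \<open>hi s\<close> among the small labels
        and \<open>hi t\<close> among the large ones.\<close>
      have "\<exists>s'<t. \<kappa> s' = Suc k"
      proof (rule ccontr)
        assume "\<not> ?thesis"
        then have im2: "\<pi> t ` {..Suc k} = \<pi> 0 ` {..Suc k}"
          using e by (intro image_atMost_const) auto
        also have "\<dots> = {..Suc k}" using init k by (auto simp: image_def)
        finally have im3: "\<pi> t ` {..Suc k} = {..Suc k}" .
        have "hi s \<le> Suc k" using p im3 by auto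
        moreover have "hi t > Suc k"
        proof (rule ccontr)
          assume "\<not> Suc k < hi t"
          then have "hi t \<in> \<pi> t ` {..Suc k}" using im3 by simp
          then obtain c where "c \<le> Suc k" "hi t = \<pi> t c" by auto
          then show False using pi_inj[of t c "Suc (Suc k)"] e k by (auto simp: hi_def)
        qed
        ultimately show False using False by simp
      qed
      then obtain s' where "face s' t" using face_to[of _ t] e k by metis
      then show ?thesis using UU False ne by (auto simp: points_def)
    qed
  next
    case DD
    note l = edge_hi[OF assms DD(1)]
    define k where "k = \<kappa> t"
    have k: "\<kappa> s = Suc k" "Suc (Suc k) < n" using l(3) DD level[of s] e by (auto simp: k_def)
    have im: "\<pi> t ` {..Suc k} = \<pi> (Suc s) ` {..Suc k}"
      using l(1) e k by (intro image_atMost_const) (auto simp: k_def)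
    have hs: "lo s \<notin> \<pi> (Suc s) ` {..Suc k}"
    proof
      assume "lo s \<in> \<pi> (Suc s) ` {..Suc k}"
      then obtain c where "c \<le> Suc k" "\<pi> (Suc s) c = lo s" by auto
      then show False using step_simps(2)[of s] e k pi_inj[of "Suc s" c "Suc (Suc k)"] by auto
    qed
    obtain p where p: "p < n" "lo s = \<pi> t p"
      using lo_hi_less(1)[of s] e image_lines[of t] by (metis imageE lessThan_iff less_imp_le order_less_trans)
    have pk: "p > Suc k" using hs im p by (metis atMost_iff imageI not_le)
    then have ne: "lo s \<noteq> lo t" using pi_inj[of t p k] k e p by (auto simp: lo_def k_def)
    show ?thesis
    proof (cases "lo t < lo s")
      case True
      have "\<exists>t'>s. t' < N \<and> \<kappa> t' = Suc k"
      proof (rule ccontr)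
        assume "\<not> ?thesis"
        then have im2: "\<pi> N ` {..Suc k} = \<pi> (Suc s) ` {..Suc k}" "\<pi> N ` {..Suc k} = \<pi> (Suc t) ` {..Suc k}"
          using e by - (rule image_atMost_const; force)+
        obtain b where b: "b < n" "lo s = \<pi> N b"
          using lo_hi_less(1)[of s] e image_lines[of N] by (metis imageE lessThan_iff less_trans order_refl)
        have bk: "b > Suc k" using hs im2(1) b by (metis atMost_iff imageI not_le)
        have "lo t \<in> \<pi> (Suc t) ` {..Suc k}"
          using step_simps(2)[of t] e by (intro image_eqI[of _ _ "Suc k"]) (auto simp: k_def)
        then obtain a where a: "a \<le> Suc k" "lo t = \<pi> N a" unfolding im2(2)[symmetric] by auto
        then show False using a b bk final[of a] final[of b] True k by auto
      qed
      then obtain t' where "face s t'" using face_from[of s] k by metis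
      then show ?thesis using DD True by (auto simp: points_def)
    next
      case False
      have "\<exists>s'<t. \<kappa> s' = k"
      proof (rule ccontr)
        assume "\<not> ?thesis"
        then have im2: "\<pi> t ` {..k} = \<pi> 0 ` {..k}"
          using e by (intro image_atMost_const) auto
        also have "\<dots> = {..k}" using init k by (auto simp: image_def)
        finally have im3: "\<pi> t ` {..k} = {..k}" .
        have "lo t \<le> k" using im3 by (auto simp: lo_def k_def)
        moreover have "lo s > k"
        proof (rule ccontr)
          assume "\<not> k < lo s"
          then have "lo s \<in> \<pi> t ` {..k}" using im3 by simp
          then obtain c where "c \<le> k" "lo s = \<pi> t c" by auto
          then show False using pi_inj[of t c p] e k p pk by auto
        qed
        ultimately show False using False by simp
      qed
      then obtain s' where "face s' t" using face_to[of _ t] e unfolding k_def by metis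
      then show ?thesis using DD False ne by (auto simp: points_def)
    qed
  qed
qed

lemma edge_start_unique: "edge x s t \<Longrightarrow> edge x s t' \<Longrightarrow> t = t'"
  by (cases t t' rule: linorder_cases) (auto simp: edge_def)

lemma edge_end_unique: "edge x s t \<Longrightarrow> edge x s' t \<Longrightarrow> s = s'"
  by (cases s s' rule: linorder_cases) (auto simp: edge_def)

lemma face_end_unique: "face s t \<Longrightarrow> face s' t \<Longrightarrow> s = s'"
  by (cases s s' rule: linorder_cases) (auto simp: face_def)

section \<open>The edges that point to one face\<close>

context
  fixes s t assumes F: "face s t"
begin

lemma face_rules:
  "s < t" "t < N" "\<kappa> t = \<kappa> s" "\<And>r. s < r \<Longrightarrow> r < t \<Longrightarrow> \<kappa> r \<noteq> \<kappa> s"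
  using F by (auto simp: face_def)

text \<open>By \<open>top_mono\<close> labels grow from \<open>hi r\<close> to \<open>hi t\<close>
  along the upper side, so this edge forces \<open>hi s < hi t\<close>. A lower right edge forces
  the opposite, see \<open>lower_right\<close>; hence the two never point to the same face.
  \<open>lower_left\<close> and \<open>upper_right\<close> exclude each other in the same way
  through \<open>lo\<close>.\<close>

lemma upper_left:
  assumes "edge x s r" "x = lo s" "x = lo r" "hi s < hi r"
  shows "r < t" "\<kappa> r = Suc (\<kappa> s)" "\<pi> (Suc r) (Suc (\<kappa> s)) = hi r" "hi s < hi t"
proof -
  note l = edge_lo[OF assms(1,2)]
  show k: "\<kappa> r = Suc (\<kappa> s)" using l(2) assms by auto
  have "s < r" "r < N" using assms(1) by (auto simp: edge_def)
  have "r \<noteq> t" using k face_rules by auto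
  moreover have "\<not> t < r" using l(1)[of t] face_rules by auto
  ultimately show rt: "r < t" by auto
  show e: "\<pi> (Suc r) (Suc (\<kappa> s)) = hi r" using step_simps(1)[of r] \<open>r < N\<close> k by auto
  have "\<pi> (Suc r) (Suc (\<kappa> s)) \<le> \<pi> t (Suc (\<kappa> s))"
    using rt face_rules \<open>s < r\<close> by (intro top_mono) auto
  then show "hi s < hi t" using e assms(4) face_rules(3) by (simp add: hi_def)
qed

lemma lower_left:
  assumes "edge x s r" "x = hi s" "x = hi r" "lo r < lo s"
  shows "r < t" "Suc (\<kappa> r) = \<kappa> s" "\<pi> (Suc r) (\<kappa> s) = lo r" "lo t < lo s"
proof -
  note l = edge_hi[OF assms(1,2)]
  show k: "Suc (\<kappa> r) = \<kappa> s" using l(3) assms by auto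
  have "s < r" "r < N" using assms(1) by (auto simp: edge_def)
  have "r \<noteq> t" using k face_rules by auto
  moreover have "\<not> t < r" using l(1)[of t] face_rules by auto
  ultimately show rt: "r < t" by auto
  show e: "\<pi> (Suc r) (\<kappa> s) = lo r" using step_simps(2)[of r] \<open>r < N\<close> k by auto
  have "\<pi> t (\<kappa> s) \<le> \<pi> (Suc r) (\<kappa> s)"
    using rt face_rules \<open>s < r\<close> by (intro bot_mono) auto
  then show "lo t < lo s" using e assms(4) face_rules(3) by (simp add: lo_def)
qed

lemma lower_right:
  assumes "edge x r t" "x = lo r" "x = lo t" "hi t < hi r"
  shows "s < r" "Suc (\<kappa> r) = \<kappa> s" "\<pi> r (\<kappa> s) = hi r" "hi t < hi s"
proof -
  note l = edge_lo[OF assms(1,2)]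
  show k: "Suc (\<kappa> r) = \<kappa> s" using l(2) assms face_rules by auto
  have "r < t" "r < N" using assms(1) by (auto simp: edge_def)
  have "r \<noteq> s" using k by auto
  moreover have "\<not> r < s" using l(1)[of s] face_rules k by auto
  ultimately show rt: "s < r" by auto
  show e: "\<pi> r (\<kappa> s) = hi r" using k by (simp add: hi_def)
  have "\<pi> r (\<kappa> s) \<le> \<pi> (Suc s) (\<kappa> s)"
    using rt face_rules \<open>r < t\<close> by (intro bot_mono) auto
  then show "hi t < hi s" using e assms(4) face_rules step_simps(1)[of s] by simp
qed

lemma upper_right:
  assumes "edge x r t" "x = hi r" "x = hi t" "lo r < lo t"
  shows "s < r" "\<kappa> r = Suc (\<kappa> s)" "\<pi> r (Suc (\<kappa> s)) = lo r" "lo s < lo t"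
proof -
  note l = edge_hi[OF assms(1,2)]
  show k: "\<kappa> r = Suc (\<kappa> s)" using l(3) assms face_rules by auto
  have "r < t" "r < N" using assms(1) by (auto simp: edge_def)
  have "r \<noteq> s" using k by auto
  moreover have "\<not> r < s" using l(1)[of s] face_rules k by auto
  ultimately show rt: "s < r" by auto
  show e: "\<pi> r (Suc (\<kappa> s)) = lo r" using k by (simp add: lo_def)
  have "\<pi> (Suc s) (Suc (\<kappa> s)) \<le> \<pi> r (Suc (\<kappa> s))"
    using rt face_rules \<open>r < t\<close> by (intro top_mono) auto
  then show "lo s < lo t" using e assms(4) face_rules step_simps(2)[of s] by simp
qed

text \<open>The lower side is the single edge \<open>y\<close>. If the upper left edge ended
  strictly before the start of the upper right one, monotone labels would give
  \<open>hi s < hi r \<le> lo r' < lo t = hi s\<close>. So both edges share a crossing and the face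
  has three edges.\<close>

lemma upper_triangle:
  assumes low: "edge y s t" "y = hi s" "y = lo t"
    and ul: "edge x s r" "x = lo s" "x = lo r" "hi s < hi r"
    and ur: "edge z r' t" "z = hi r'" "z = hi t" "lo r' < lo t"
  shows "tri s t"
proof -
  note U = upper_left[OF ul] and V = upper_right[OF ur]
  have o: "s < r" "r' < t" using ul ur by (auto simp: edge_def)
  have "r = r'"
  proof (rule ccontr)
    assume "r \<noteq> r'"
    then consider "r < r'" | "r' < r" by linarith
    then show False
    proof cases
      case 1
      then have "hi r \<le> lo r'"
        using top_mono[of "Suc r" r' "\<kappa> s"] U V face_rules o by auto
      then show False using ul ur low by simp
    next
      case 2
      then show False using edge_lo(1)[OF ul(1,2), of r'] V by auto
    qed
  qed
  then show ?thesis unfolding tri_def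
    using assms face_rules o by (intro exI[of _ r] exI[of _ x] exI[of _ y] exI[of _ z])
      (auto simp: meet_def)
qed

lemma lower_triangle:
  assumes up: "edge y s t" "y = lo s" "y = hi t"
    and ll: "edge x s r" "x = hi s" "x = hi r" "lo r < lo s"
    and lr: "edge z r' t" "z = lo r'" "z = lo t" "hi t < hi r'"
  shows "tri s t"
proof -
  note U = lower_left[OF ll] and V = lower_right[OF lr]
  have o: "s < r" "r' < t" using ll lr by (auto simp: edge_def)
  have "r = r'"
  proof (rule ccontr)
    assume "r \<noteq> r'"
    then consider "r < r'" | "r' < r" by linarith
    then show False
    proof cases
      case 1
      then have "hi r' \<le> lo r"
        using bot_mono[of "Suc r" r' "\<kappa> s"] U V face_rules o by auto
      then show False using ll lr up by simp
    next
      case 2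
      then show False using edge_hi(1)[OF ll(1,2), of r'] V by auto
    qed
  qed
  then show ?thesis unfolding tri_def
    using assms face_rules o by (intro exI[of _ r] exI[of _ x] exI[of _ y] exI[of _ z])
      (auto simp: meet_def)
qed

text \<open>The six clauses of \<open>points\<close>, named by the place of the edge on the face:
  upper or lower, at the left end \<open>s\<close> or the right end \<open>t\<close>;
  \<open>U1\<close> and \<open>L1\<close> are edges that form a whole side. An edge is coded by its
  line and its right end, from which \<open>edge_end_unique\<close> recovers the left end.\<close>

definition "UL = {(x, r). edge x s r \<and> x = lo s \<and> x = lo r \<and> hi s < hi r}"
definition "LL = {(x, r). edge x s r \<and> x = hi s \<and> x = hi r \<and> lo r < lo s}"
definition "LR = {(x, r). r = t \<and> (\<exists>r'. edge x r' t \<and> x = lo r' \<and> x = lo t \<and> hi t < hi r')}"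
definition "UR = {(x, r). r = t \<and> (\<exists>r'. edge x r' t \<and> x = hi r' \<and> x = hi t \<and> lo r' < lo t)}"
definition "U1 = {(x, r). r = t \<and> edge x s t \<and> x = lo s \<and> x = hi t}"
definition "L1 = {(x, r). r = t \<and> edge x s t \<and> x = hi s \<and> x = lo t}"

lemma small_or_empty:
  "UL = {} \<or> (\<exists>e. UL = {e})" "LL = {} \<or> (\<exists>e. LL = {e})" "LR = {} \<or> (\<exists>e. LR = {e})"
  "UR = {} \<or> (\<exists>e. UR = {e})" "U1 = {} \<or> (\<exists>e. U1 = {e})" "L1 = {} \<or> (\<exists>e. L1 = {e})"
proof -
  have *: "X = {} \<or> (\<exists>e. X = {e})" if "\<And>e e'. e \<in> X \<Longrightarrow> e' \<in> X \<Longrightarrow> e = e'" for X :: "(nat \<times> nat) set"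
    using that by blast
  show "UL = {} \<or> (\<exists>e. UL = {e})" "LL = {} \<or> (\<exists>e. LL = {e})" "LR = {} \<or> (\<exists>e. LR = {e})"
    "UR = {} \<or> (\<exists>e. UR = {e})" "U1 = {} \<or> (\<exists>e. U1 = {e})" "L1 = {} \<or> (\<exists>e. L1 = {e})"
    by (rule *; auto simp: UL_def LL_def LR_def UR_def U1_def L1_def dest: edge_start_unique)+
qed

text \<open>Diagonally opposite edges exclude each other, which leaves at most two if no side is a
  single edge. If one side is a single edge that points, only the two end edges of the other side
  can join it, and all three together occur only in a triangle.\<close>

lemma pointing_count:
  shows "finite {(x, r). \<exists>q. edge x q r \<and> points x q r s t}"
    "card {(x, r). \<exists>q. edge x q r \<and> points x q r s t} \<le> 2 + (if tri s t then 1 else 0)"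
proof -
  let ?G = "{(x, r). \<exists>q. edge x q r \<and> points x q r s t}"
  have G: "?G = UL \<union> LL \<union> LR \<union> UR \<union> U1 \<union> L1"
    unfolding UL_def LL_def LR_def UR_def U1_def L1_def points_def by auto
  show "finite ?G" unfolding G using small_or_empty by (auto elim!: disjE)
  have ls: "lo s < hi s" "lo t < hi t" using lo_less_hi face_rules by auto
  have L1: "edge (hi s) s t" "hi s = lo t" if "L1 \<noteq> {}" using that by (auto simp: L1_def)
  have U1: "edge (lo s) s t" "lo s = hi t" if "U1 \<noteq> {}" using that by (auto simp: U1_def)
  have UL: "\<exists>r. edge (lo s) s r \<and> lo s = lo r \<and> hi s < hi r" if "UL \<noteq> {}"
    using that by (auto simp: UL_def)
  have LL: "\<exists>r. edge (hi s) s r \<and> hi s = hi r \<and> lo r < lo s" if "LL \<noteq> {}"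
    using that by (auto simp: LL_def)
  have LR: "\<exists>r. edge (lo t) r t \<and> lo t = lo r \<and> hi t < hi r" if "LR \<noteq> {}"
    using that by (auto simp: LR_def)
  have UR: "\<exists>r. edge (hi t) r t \<and> hi t = hi r \<and> lo r < lo t" if "UR \<noteq> {}"
    using that by (auto simp: UR_def)
  have 1: "UL = {} \<or> LR = {}"
    using UL LR upper_left(4) lower_right(4) by (metis order_less_asym)
  have 2: "LL = {} \<or> UR = {}"
    using LL UR lower_left(4) upper_right(4) by (metis order_less_asym)
  have 3: "U1 = {} \<or> L1 = {}"
    using U1 L1 ls by (metis order_less_asym)
  have 4: "U1 = {} \<or> UL = {} \<and> UR = {}"
    using U1 UL UR ls edge_start_unique edge_end_unique by (metis order_less_irrefl)
  have 5: "L1 = {} \<or> LL = {} \<and> LR = {}"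
    using L1 LL LR ls edge_start_unique edge_end_unique by (metis order_less_irrefl)
  have 6: "L1 = {} \<or> UL = {} \<or> UR = {} \<or> tri s t"
    using L1 UL UR upper_triangle by metis
  have 7: "U1 = {} \<or> LL = {} \<or> LR = {} \<or> tri s t"
    using U1 LL LR lower_triangle by metis
  have c: "card X \<le> 1" if "X = {} \<or> (\<exists>e. X = {e})" for X :: "(nat \<times> nat) set"
    using that by auto
  have c2: "card (X \<union> Y) \<le> 2" if "X = {} \<or> (\<exists>e. X = {e})" "Y = {} \<or> (\<exists>e. Y = {e})" for X Y :: "(nat \<times> nat) set"
    using card_Un_le[of X Y] c[OF that(1)] c[OF that(2)] by simp
  have c3: "card (X \<union> Y \<union> Z) \<le> 3" if "X = {} \<or> (\<exists>e. X = {e})" "Y = {} \<or> (\<exists>e. Y = {e})"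
    "Z = {} \<or> (\<exists>e. Z = {e})" for X Y Z :: "(nat \<times> nat) set"
    using card_Un_le[of "X \<union> Y" Z] c2[OF that(1,2)] c[OF that(3)] by simp
  note so = small_or_empty
  consider (n) "U1 = {}" "L1 = {}" | (u) "U1 \<noteq> {}" | (l) "L1 \<noteq> {}" by blast
  then show "card ?G \<le> 2 + (if tri s t then 1 else 0)"
  proof cases
    case n
    have "card ?G \<le> 2" unfolding G n using 1 2 c2[OF so(1,2)] c2[OF so(1,4)] c2[OF so(3,2)] c2[OF so(3,4)]
      by (elim disjE) (simp_all add: Un_commute)
    then show ?thesis by simp
  next
    case u
    then have g: "?G = U1 \<union> LL \<union> LR" unfolding G using 3 4 by auto
    show ?thesis
    proof (cases "tri s t")
      case False
      then show ?thesis unfolding g using 7 u c2[OF so(5,2)] c2[OF so(5,3)] by auto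
    qed (use c3[OF so(5,2,3)] g in simp)
  next
    case l
    then have g: "?G = L1 \<union> UL \<union> UR" unfolding G using 3 5 by auto
    show ?thesis
    proof (cases "tri s t")
      case False
      then show ?thesis unfolding g using 6 l c2[OF so(6,1)] c2[OF so(6,4)] by auto
    qed (use c3[OF so(6,1,4)] g in simp)
  qed
qed

end

section \<open>Counting faces and edges\<close>

lemma finite_faces: "finite {(s, t). face s t}"
  by (rule finite_subset[of _ "{..<N} \<times> {..<N}"]) (auto simp: face_def)

text \<open>A face is charged to its last crossing. The first crossing at each of the
  \<open>n - 1\<close> heights is the last crossing of no face.\<close>

lemma card_faces: "card {(s, t). face s t} + (n - 1) \<le> N"
proof -
  define first where "first k = (LEAST T. T < N \<and> \<kappa> T = k)" for k
  have first: "first k < N \<and> \<kappa> (first k) = k" if kn: "k < n - 1" for k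
  proof -
    obtain T where "T < N \<and> \<kappa> T = k" using level_occurs[of k] kn by (auto simp: less_diff_conv)
    then show ?thesis unfolding first_def by (rule LeastI)
  qed
  have inj: "inj_on first {..<n - 1}"
    by (rule inj_on_inverseI[of _ \<kappa>]) (use first in auto)
  have injs: "inj_on snd {(s, t). face s t}"
    using face_end_unique by (auto simp: inj_on_def)
  have sub: "first ` {..<n - 1} \<union> snd ` {(s, t). face s t} \<subseteq> {..<N}"
    using first by (auto simp: face_def)
  have dis: "first ` {..<n - 1} \<inter> snd ` {(s, t). face s t} = {}"
  proof -
    have False if "face s (first k)" "k < n - 1" for s k
    proof -
      have "s < first k" "s < N \<and> \<kappa> s = k" using that first[of k] by (auto simp: face_def)
      then show False using not_less_Least[of s "\<lambda>T. T < N \<and> \<kappa> T = k"] by (simp add: first_def)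
    qed
    then show ?thesis by auto
  qed
  have "card (first ` {..<n - 1} \<union> snd ` {(s, t). face s t}) \<le> N"
    using card_mono[OF _ sub] by simp
  moreover have "card (first ` {..<n - 1} \<union> snd ` {(s, t). face s t})
      = card (first ` {..<n - 1}) + card (snd ` {(s, t). face s t})"
    using dis finite_faces by (intro card_Un_disjoint) auto
  ultimately show ?thesis using card_image[OF inj] card_image[OF injs] by simp
qed

text \<open>Each crossing lies on two lines, and such an incidence ends an edge unless it is the
  first one on its line.\<close>

lemma card_edges: "2 * N \<le> card {(x, t). \<exists>s. edge x s t} + n"
proof -
  let ?M = "{(x, t). t < N \<and> moves t x}"
  let ?E = "{(x, t). \<exists>s. edge x s t}"
  have M: "?M = (\<lambda>t. (lo t, t)) ` {..<N} \<union> (\<lambda>t. (hi t, t)) ` {..<N}"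
    by (auto simp: moves_def)
  have "card ?M = card ((\<lambda>t. (lo t, t)) ` {..<N}) + card ((\<lambda>t. (hi t, t)) ` {..<N})"
    unfolding M using lo_less_hi by (intro card_Un_disjoint) fastforce+
  also have "\<dots> = 2 * N" by (simp add: card_image inj_on_def)
  finally have cM: "card ?M = 2 * N" .
  have fin: "finite ?M" unfolding M by simp
  have sub: "?E \<subseteq> ?M" by (auto simp: edge_def)
  have first: "\<not> moves s x" if t: "(x, t) \<in> ?M - ?E" and "s < t" for x s t
  proof
    assume s: "moves s x"
    define s' where "s' = (GREATEST r. r < t \<and> moves r x)"
    have "s' < t \<and> moves s' x" unfolding s'_def
      by (rule GreatestI_nat[of _ s t]) (use that s in auto)
    moreover have "\<And>r. r < t \<and> moves r x \<Longrightarrow> r \<le> s'" unfolding s'_def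
      by (rule Greatest_le_nat[of _ _ t]) auto
    ultimately have "edge x s' t" using t unfolding edge_def by force
    then show False using t by auto
  qed
  have "inj_on fst (?M - ?E)"
  proof (rule inj_onI)
    fix a b assume ab: "a \<in> ?M - ?E" "b \<in> ?M - ?E" "fst a = fst b"
    obtain x t x' t' where [simp]: "a = (x, t)" "b = (x', t')" by (cases a, cases b) auto
    have "\<not> t < t'" using first[of x' t' t] ab by auto
    moreover have "\<not> t' < t" using first[of x t t'] ab by auto
    ultimately show "a = b" using ab by auto
  qed
  moreover have "fst ` (?M - ?E) \<subseteq> {..<n}" using moves_less by auto
  ultimately have "card (?M - ?E) \<le> n" using card_inj_on_le[of fst "?M - ?E" "{..<n}"] by simp
  then show ?thesis using cM card_Diff_subset[OF finite_subset[OF sub fin] sub] by simp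
qed

text \<open>Double counting of pointing edges: \<open>2 * N - n\<close> is at most the number of
  edges, hence at most twice the number of faces plus the number of triangles. The bound
  \<open>N - (n - 1)\<close> on the faces cancels \<open>N\<close>.\<close>

theorem card_tri: "n - 2 \<le> card {(s, t). face s t \<and> tri s t}"
proof (cases "n \<ge> 2")
  case True
  let ?F = "{(s, t). face s t}"
  have sumif: "(\<Sum>x\<in>A. if x \<in> B then 1 else 0) = card (A \<inter> B)" if "finite A"
    for A B :: "(nat \<times> nat) set"
    using that by (simp add: sum.If_cases Int_def)
  let ?g = "\<lambda>(s, t). {(x, r). \<exists>q. edge x q r \<and> points x q r s t}"
  let ?T = "{(s, t). face s t \<and> tri s t}"
  have fin: "finite (?g F)" "card (?g F) \<le> 2 + (if F \<in> ?T then 1 else 0)" if "F \<in> ?F" for F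
    using that pointing_count[of "fst F" "snd F"] by (auto simp: case_prod_unfold)
  have sub: "{(x, t). \<exists>s. edge x s t} \<subseteq> (\<Union>F\<in>?F. ?g F)"
    using edge_points by fastforce
  have "card {(x, t). \<exists>s. edge x s t} \<le> card (\<Union>F\<in>?F. ?g F)"
    using fin(1) finite_faces by (intro card_mono[OF _ sub]) auto
  also have "\<dots> \<le> (\<Sum>F\<in>?F. card (?g F))"
    by (rule card_UN_le[OF finite_faces])
  also have "\<dots> \<le> (\<Sum>F\<in>?F. 2 + (if F \<in> ?T then 1 else 0))"
    using fin(2) by (intro sum_mono) auto
  also have "\<dots> = 2 * card ?F + card (?F \<inter> ?T)"
    using sumif[OF finite_faces, of ?T] by (simp only: sum.distrib sum_constant of_nat_id mult.commute[of _ 2])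
  also have "?F \<inter> ?T = ?T" by auto
  finally have "card {(x, t). \<exists>s. edge x s t} \<le> 2 * card ?F + card ?T" .
  then show ?thesis using card_edges card_faces True by linarith
qed simp

end

section \<open>Sweeping a consistent system of crossing orders\<close>

definition pos :: "nat \<Rightarrow> (nat \<Rightarrow> nat) \<Rightarrow> nat \<Rightarrow> nat" where
  "pos n \<pi> i = inv_into {..<n} \<pi> i"

definition crossed :: "nat \<Rightarrow> (nat \<Rightarrow> nat) \<Rightarrow> nat \<Rightarrow> nat \<Rightarrow> bool" where
  "crossed n \<pi> i j \<longleftrightarrow> (i < j) \<noteq> (pos n \<pi> i < pos n \<pi> j)"

definition swap_adj :: "(nat \<Rightarrow> nat) \<Rightarrow> nat \<Rightarrow> nat \<Rightarrow> nat" where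
  "swap_adj \<pi> k = \<pi>(k := \<pi> (Suc k), Suc k := \<pi> k)"

context
  fixes n :: nat and \<pi> :: "nat \<Rightarrow> nat"
  assumes bij: "bij_betw \<pi> {..<n} {..<n}"
begin

lemma pos_less: "i < n \<Longrightarrow> pos n \<pi> i < n"
  using bij unfolding pos_def by (metis bij_betw_def inv_into_into lessThan_iff)

lemma pi_pos: "i < n \<Longrightarrow> \<pi> (pos n \<pi> i) = i"
  using bij unfolding pos_def by (metis bij_betw_inv_into_right lessThan_iff)

lemma pos_pi: "p < n \<Longrightarrow> pos n \<pi> (\<pi> p) = p"
  using bij unfolding pos_def by (metis bij_betw_inv_into_left lessThan_iff)

lemma line_less: "p < n \<Longrightarrow> \<pi> p < n"
  using bij by (auto dest: bij_betwE)

lemma pos_eq_iff: "i < n \<Longrightarrow> j < n \<Longrightarrow> pos n \<pi> i = pos n \<pi> j \<longleftrightarrow> i = j"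
  using pi_pos by metis

lemma crossed_sym: "i < n \<Longrightarrow> j < n \<Longrightarrow> i \<noteq> j \<Longrightarrow> crossed n \<pi> i j \<longleftrightarrow> crossed n \<pi> j i"
  using pos_eq_iff[of i j] unfolding crossed_def by auto

lemma bij_swap:
  assumes "Suc k < n" shows "bij_betw (swap_adj \<pi> k) {..<n} {..<n}"
proof -
  have *: "swap_adj \<pi> k = \<pi> \<circ> (id(k := Suc k, Suc k := k))" by (auto simp: swap_adj_def)
  have "bij_betw (id(k := Suc k, Suc k := k)) {..<n} {..<n}"
    by (rule bij_betw_byWitness[where f' = "id(k := Suc k, Suc k := k)"]) (use assms in auto)
  then show ?thesis unfolding * using bij by (rule bij_betw_trans)
qed

lemma pos_swap:
  assumes "Suc k < n" "i < n"
  shows "pos n (swap_adj \<pi> k) i = (if i = \<pi> k then Suc k else if i = \<pi> (Suc k) then k else pos n \<pi> i)"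
proof -
  have *: "pos n (swap_adj \<pi> k) i = p" if "p < n" "swap_adj \<pi> k p = i" for p
    using bij_swap[OF assms(1)] that unfolding pos_def by (metis bij_betw_inv_into_left lessThan_iff)
  show ?thesis
    using assms pos_less[of i] pi_pos[of i]
    by (intro *) (auto simp: swap_adj_def)
qed

lemma below_swap:
  assumes "Suc k < n" "i < n" "j < n" "i \<noteq> j"
  shows "pos n (swap_adj \<pi> k) i < pos n (swap_adj \<pi> k) j \<longleftrightarrow>
    (if {i, j} = {\<pi> k, \<pi> (Suc k)} then pos n \<pi> j < pos n \<pi> i else pos n \<pi> i < pos n \<pi> j)"
proof -
  have k: "pos n \<pi> (\<pi> k) = k" "pos n \<pi> (\<pi> (Suc k)) = Suc k" using assms pos_pi by auto
  have "pos n \<pi> i \<noteq> pos n \<pi> j" using pos_eq_iff assms by auto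
  moreover have "i = \<pi> k \<longleftrightarrow> pos n \<pi> i = k" "i = \<pi> (Suc k) \<longleftrightarrow> pos n \<pi> i = Suc k"
    "j = \<pi> k \<longleftrightarrow> pos n \<pi> j = k" "j = \<pi> (Suc k) \<longleftrightarrow> pos n \<pi> j = Suc k"
    using k pi_pos assms by metis+
  ultimately show ?thesis
    using assms pos_swap[of k i] pos_swap[of k j] by (auto simp: doubleton_eq_iff)
qed

lemma crossed_swap:
  assumes "Suc k < n" "i < n" "j < n" "i \<noteq> j" "\<pi> k < \<pi> (Suc k)"
  shows "crossed n (swap_adj \<pi> k) i j \<longleftrightarrow> crossed n \<pi> i j \<or> {i, j} = {\<pi> k, \<pi> (Suc k)}"
  using below_swap[OF assms(1-4)] pos_pi[of k] pos_pi[of "Suc k"] assms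
  unfolding crossed_def by (auto simp: doubleton_eq_iff)

lemma uncrossed_start: "Suc k < n \<Longrightarrow> \<pi> k < \<pi> (Suc k) \<Longrightarrow> \<not> crossed n \<pi> (\<pi> k) (\<pi> (Suc k))"
  using pos_pi[of k] pos_pi[of "Suc k"] by (simp add: crossed_def)

text \<open>If every pair is inverted, the positions above \<open>p\<close> hold exactly the lines
  with labels below \<open>\<pi> p\<close>; comparing cardinalities gives the value.\<close>

lemma all_crossed_reverse:
  assumes "\<And>i j. i < n \<Longrightarrow> j < n \<Longrightarrow> i \<noteq> j \<Longrightarrow> crossed n \<pi> i j" "p < n"
  shows "\<pi> p = n - 1 - p"
proof -
  have anti: "p < q \<longleftrightarrow> \<pi> q < \<pi> p" if "p < n" "q < n" "p \<noteq> q" for p q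
  proof -
    have "\<pi> p \<noteq> \<pi> q" using pos_pi that by metis
    then show ?thesis using assms(1)[of "\<pi> p" "\<pi> q"] that pos_pi line_less by (auto simp: crossed_def)
  qed
  have "\<pi> ` {p<..<n} = {..<\<pi> p}"
  proof (intro equalityI subsetI)
    fix i assume i: "i \<in> {..<\<pi> p}"
    then have "i < n" using line_less[OF assms(2)] by auto
    then show "i \<in> \<pi> ` {p<..<n}"
      using anti[of p "pos n \<pi> i"] assms(2) i pi_pos[of i] pos_less[of i]
      by (intro image_eqI[of _ _ "pos n \<pi> i"]) (auto simp: order_less_le)
  next
    fix i assume "i \<in> \<pi> ` {p<..<n}"
    then obtain q where "p < q" "q < n" "i = \<pi> q" by auto
    then show "i \<in> {..<\<pi> p}" using anti[of p q] assms(2) by auto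
  qed
  moreover have "inj_on \<pi> {p<..<n}" using bij by (auto simp: bij_betw_def inj_on_def)
  ultimately have "card {p<..<n} = card {..<\<pi> p}" by (metis card_image)
  then show ?thesis by simp
qed

end

text \<open>\<open>\<tau> i j\<close> stands for the parameter at which chord \<open>i\<close> meets
  chord \<open>j\<close>. \<open>consistent\<close> says that three chords form a triangle of one of
  two orientations: each of them meets the other two in increasing order of index, or each in
  decreasing order.\<close>

locale chords =
  fixes n :: nat and \<tau> :: "nat \<Rightarrow> nat \<Rightarrow> real"
  assumes tau_inj: "i < n \<Longrightarrow> j < n \<Longrightarrow> k < n \<Longrightarrow> i \<noteq> j \<Longrightarrow> i \<noteq> k \<Longrightarrow> j \<noteq> k \<Longrightarrow> \<tau> i j \<noteq> \<tau> i k"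
    and consistent: "i < j \<Longrightarrow> j < k \<Longrightarrow> k < n \<Longrightarrow>
      (\<tau> i j < \<tau> i k \<longleftrightarrow> \<tau> j i < \<tau> j k) \<and> (\<tau> j i < \<tau> j k \<longleftrightarrow> \<tau> k i < \<tau> k j)"
begin

lemma triple:
  assumes "i < j" "j < k" "k < n"
  shows "(\<tau> i j < \<tau> i k \<and> \<tau> j i < \<tau> j k \<and> \<tau> k i < \<tau> k j) \<or>
    (\<tau> i k < \<tau> i j \<and> \<tau> j k < \<tau> j i \<and> \<tau> k j < \<tau> k i)"
  using consistent[OF assms] tau_inj[of i j k] tau_inj[of j i k] tau_inj[of k i j] assms by auto

text \<open>The crossings already passed form an initial segment of every chord, as for a curve that
  cuts across all chords at once.\<close>

definition swept :: "(nat \<Rightarrow> nat) \<Rightarrow> bool" where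
  "swept \<pi> \<longleftrightarrow> bij_betw \<pi> {..<n} {..<n} \<and>
     (\<forall>i<n. \<forall>j<n. \<forall>k<n. i \<noteq> j \<and> i \<noteq> k \<and> j \<noteq> k \<and> crossed n \<pi> i j \<and> \<not> crossed n \<pi> i k \<longrightarrow> \<tau> i j < \<tau> i k)"

definition ready :: "(nat \<Rightarrow> nat) \<Rightarrow> nat \<Rightarrow> bool" where
  "ready \<pi> p \<longleftrightarrow> Suc p < n \<and> \<pi> p < \<pi> (Suc p) \<and>
     (\<forall>z<n. z \<noteq> \<pi> p \<and> z \<noteq> \<pi> (Suc p) \<longrightarrow>
       (\<not> crossed n \<pi> (\<pi> p) z \<longrightarrow> \<tau> (\<pi> p) (\<pi> (Suc p)) < \<tau> (\<pi> p) z) \<and>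
       (\<not> crossed n \<pi> (\<pi> (Suc p)) z \<longrightarrow> \<tau> (\<pi> (Suc p)) (\<pi> p) < \<tau> (\<pi> (Suc p)) z))"

lemma swept_swap:
  assumes "swept \<pi>" "ready \<pi> k"
  shows "swept (swap_adj \<pi> k)"
proof -
  have b: "bij_betw \<pi> {..<n} {..<n}" using assms by (simp add: swept_def)
  have k: "Suc k < n" "\<pi> k < \<pi> (Suc k)" using assms by (auto simp: ready_def)
  note cs = crossed_swap[OF b k(1) _ _ _ k(2)]
  have cl: "\<tau> i j < \<tau> i l" if "i < n" "j < n" "l < n" "i \<noteq> j" "i \<noteq> l" "j \<noteq> l"
    "crossed n (swap_adj \<pi> k) i j" "\<not> crossed n (swap_adj \<pi> k) i l" for i j l
  proof -
    have nl: "\<not> crossed n \<pi> i l" using that cs by auto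
    show ?thesis
    proof (cases "crossed n \<pi> i j")
      case True
      then show ?thesis using nl that assms by (auto simp: swept_def)
    next
      case False
      then have "{i, j} = {\<pi> k, \<pi> (Suc k)}" using that cs by auto
      then show ?thesis using nl that assms(2) unfolding ready_def by (auto simp: doubleton_eq_iff)
    qed
  qed
  then show ?thesis using bij_swap[OF b k(1)] unfolding swept_def by blast
qed

text \<open>Consider the next crossing on each line that has not yet crossed all others. The highest
  line \<open>x\<close> that next crosses a line above it lies directly below a line \<open>y\<close> that next crosses a
  line below it, and consistency forces \<open>x\<close> and \<open>y\<close> to cross each other next.\<close>

lemma ex_ready:
  assumes sw: "swept \<pi>" and unc: "i0 < n" "j0 < n" "i0 \<noteq> j0" "\<not> crossed n \<pi> i0 j0"
  shows "\<exists>p. ready \<pi> p"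
proof -
  have b: "bij_betw \<pi> {..<n} {..<n}" using sw by (simp add: swept_def)
  define P where "P = pos n \<pi>"
  note pp = pos_pi[OF b, folded P_def] and pl = pos_less[OF b, folded P_def]
    and pip = pi_pos[OF b, folded P_def] and peq = pos_eq_iff[OF b, folded P_def]
    and ll = line_less[OF b]
  have closed: "\<tau> i j < \<tau> i k" if "crossed n \<pi> i j" "\<not> crossed n \<pi> i k" "i < n" "j < n" "k < n"
    "i \<noteq> j" "i \<noteq> k" for i j k
    using sw that unfolding swept_def by blast
  have cr: "crossed n \<pi> i j \<longleftrightarrow> (i < j) \<noteq> (P i < P j)" for i j by (simp add: crossed_def P_def)
  define un where "un i = {j. j < n \<and> j \<noteq> i \<and> \<not> crossed n \<pi> i j}" for i
  have fin: "finite (un i)" for i unfolding un_def by simp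
  have unsym: "j \<in> un i \<longleftrightarrow> i \<in> un j" if "i < n" "j < n" for i j
    using crossed_sym[OF b, of i j] that unfolding un_def by auto
  define nx where "nx i = arg_min_on (\<tau> i) (un i)" for i
  have nx: "nx i \<in> un i" "j \<in> un i \<Longrightarrow> \<tau> i (nx i) \<le> \<tau> i j" if "un i \<noteq> {}" for i j
    unfolding nx_def using arg_min_if_finite(1)[OF fin that] arg_min_least[OF fin that] by auto
  have nxs: "\<tau> i (nx i) < \<tau> i j" if "j \<in> un i" "j \<noteq> nx i" "i < n" for i j
  proof -
    have "un i \<noteq> {}" using that by auto
    note n2 = nx(1)[OF this] nx(2)[OF this that(1)]
    have "\<tau> i (nx i) \<noteq> \<tau> i j" using tau_inj[of i "nx i" j] n2 that by (auto simp: un_def)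
    then show ?thesis using n2 by auto
  qed
  define U where "U = {p. p < n \<and> un (\<pi> p) \<noteq> {} \<and> P (nx (\<pi> p)) > p}"
  \<comment> \<open>Take the lowest line with a pending crossing. Its next partner has a pending
    crossing too and therefore lies above it.\<close>
  have "U \<noteq> {}"
  proof -
    define p where "p = (LEAST p. p < n \<and> un (\<pi> p) \<noteq> {})"
    have "P i0 < n \<and> un (\<pi> (P i0)) \<noteq> {}" using pl pip unc by (auto simp: un_def)
    then have p: "p < n" "un (\<pi> p) \<noteq> {}" unfolding p_def by (metis (mono_tags, lifting) LeastI)+
    let ?z = "nx (\<pi> p)"
    have z: "?z < n" "?z \<noteq> \<pi> p" "?z \<in> un (\<pi> p)" using nx(1)[OF p(2)] by (auto simp: un_def)
    have "P ?z < n \<and> un (\<pi> (P ?z)) \<noteq> {}" using z pl pip unsym[of ?z "\<pi> p"] ll p by auto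
    then have "p \<le> P ?z" unfolding p_def by (rule Least_le)
    moreover have "p \<noteq> P ?z" using z pip by metis
    ultimately show ?thesis using p unfolding U_def by auto
  qed
  define p where "p = Max U"
  have finU: "finite U" unfolding U_def by auto
  have pU: "p \<in> U" using Max_in[OF finU \<open>U \<noteq> {}\<close>] by (simp add: p_def)
  have pmax: "q \<notin> U" if "q > p" for q using Max_ge[OF finU, of q] that unfolding p_def by auto
  define x where "x = \<pi> p"
  define z where "z = nx x"
  have p: "p < n" "un x \<noteq> {}" "P z > p" using pU by (auto simp: U_def x_def z_def)
  have Px: "P x = p" "x < n" using pp ll p by (auto simp: x_def)
  have zu: "z \<in> un x" "z < n" "z \<noteq> x" using nx(1)[OF p(2)] by (auto simp: z_def un_def)
  then have xz: "x < z" using p Px cr by (auto simp: un_def)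
  have Sp: "Suc p < n" using p pl[OF zu(2)] by auto
  define y where "y = \<pi> (Suc p)"
  have Py: "P y = Suc p" "y < n" using pp ll Sp by (auto simp: y_def)
  \<comment> \<open>A finished \<open>y\<close>, lying above \<open>x\<close> and below
    \<open>z\<close>, would satisfy \<open>z < y\<close> and \<open>y < x\<close>, against
    \<open>x < z\<close>.\<close>
  have yne: "un y \<noteq> {}"
  proof
    assume e: "un y = {}"
    have "y \<noteq> z" using e unsym[of x y] zu(1) Px Py by auto
    then have "crossed n \<pi> y x" "crossed n \<pi> y z" using e Px Py zu unfolding un_def by auto
    moreover have "P z \<noteq> P y" using peq[of z y] \<open>y \<noteq> z\<close> zu Py by auto
    ultimately show False using cr Px Py p xz by auto
  qed
  define w where "w = nx y"
  have wu: "w \<in> un y" "w < n" "w \<noteq> y" using nx(1)[OF yne] by (auto simp: w_def un_def)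
  have "Suc p \<notin> U" using pmax by auto
  then have "P w \<le> Suc p" using yne Sp unfolding U_def w_def y_def by auto
  moreover have "P w \<noteq> Suc p" using peq[of w y] wu Py by auto
  ultimately have Pw: "P w \<le> p" by auto
  have wy: "w < y" using wu Pw Py cr by (auto simp: un_def)
  have Pwx: "w \<noteq> x \<Longrightarrow> P w < P x" using peq[of w x] wu Px Pw by auto
  have Pzy: "z \<noteq> y \<Longrightarrow> P y < P z" using peq[of z y] zu Px Py p by auto
  have nz: "\<tau> x z < \<tau> x v" if "v \<in> un x" "v \<noteq> z" for v using nxs[of v x] that Px by (simp add: z_def)
  have nw: "\<tau> y w < \<tau> y v" if "v \<in> un y" "v \<noteq> w" for v using nxs[of v y] that Py by (simp add: w_def)
  have xy: "x \<noteq> y" using Px Py by auto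
  have un: "j \<in> un i \<longleftrightarrow> j < n \<and> j \<noteq> i \<and> (i < j \<longleftrightarrow> P i < P j)" for i j by (auto simp: un_def cr)
  \<comment> \<open>If \<open>z\<close> differs from \<open>y\<close>, then for either order of
    \<open>x\<close> and \<open>y\<close> the case ends with a cycle on chord \<open>z\<close>: its
    crossing with \<open>x\<close> precedes that with \<open>w\<close>, this precedes that with
    \<open>y\<close>, and this precedes that with \<open>x\<close>.\<close>
  have zy: "z = y"
  proof (rule ccontr)
    assume ne: "z \<noteq> y"
    show False
    proof (cases "y < x")
      case True
      have wx: "w \<noteq> x" using True wy by auto
      have 1: "\<tau> y w < \<tau> y z" using nw[of z] un[of z y] zu Pzy ne True xz wy by auto
      have 2: "\<tau> x z < \<tau> x w" using nz[of w] un[of w x] wu Pwx wx True xz wy by auto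
      have 3: "\<tau> y x < \<tau> y z" using closed[of y x z] cr Px Py Pzy ne True zu xz by auto
      show False using triple[of w x z] triple[of w y z] triple[of y x z] 1 2 3 True xz wy zu by auto
    next
      case False
      then have xly: "x < y" using xy by auto
      have 1: "\<tau> x z < \<tau> x y" using nz[of y] un[of y x] Px Py xly ne by auto
      have yz: "y < z"
      proof (rule ccontr)
        assume "\<not> y < z"
        then have zy: "z < y" using ne by auto
        have "\<tau> y z < \<tau> y x" using closed[of y z x] cr Pzy ne zy Px Py xly zu xz by auto
        then show False using triple[of x z y] 1 xz zy Py by auto
      qed
      have 2: "\<tau> y z < \<tau> y x" "\<tau> z y < \<tau> z x" using triple[of x y z] 1 xly yz zu by auto
      have zuy: "z \<in> un y" using un[of z y] Pzy ne yz zu by auto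
      have "w \<noteq> x" using nw[OF zuy] 2(1) by (metis order_less_asym order_less_irrefl)
      then have Pwx': "P w < P x" using Pwx by auto
      have 3: "\<tau> y w < \<tau> y x" using nw[of x] un[of x y] Px Py xly \<open>w \<noteq> x\<close> by auto
      have wx: "w < x"
      proof (rule ccontr)
        assume "\<not> w < x"
        then have xw: "x < w" using \<open>w \<noteq> x\<close> by auto
        have "\<tau> x w < \<tau> x y" using closed[of x w y] cr Pwx' xw Px Py xly wu by auto
        then show False using triple[of x w y] 3 xw wy Py by auto
      qed
      have 4: "\<tau> x z < \<tau> x w" using nz[of w] un[of w x] wu Pwx' wx xz by auto
      have 5: "\<tau> y w < \<tau> y z" using nw[OF zuy] wy yz by auto
      show False using triple[of w x z] triple[of w y z] 2 4 5 wx xz wy yz zu by auto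
    qed
  qed
  have wx: "w = x"
  proof (rule ccontr)
    assume ne: "w \<noteq> x"
    have xly: "x < y" using xz zy by auto
    have 3: "\<tau> y w < \<tau> y x" using nw[of x] un[of x y] Px Py xly ne by auto
    show False
    proof (cases "w < x")
      case False
      then have xw: "x < w" using ne by auto
      have "\<tau> x w < \<tau> x y" using closed[of x w y] cr Pwx ne xw Px Py xly wu by auto
      then show False using triple[of x w y] 3 xw wy Py by auto
    next
      case True
      have "\<tau> x z < \<tau> x w" using nz[of w] un[of w x] wu Pwx ne True xz by auto
      then show False using triple[of w x y] 3 True xly Py zy by auto
    qed
  qed
  have "ready \<pi> p" unfolding ready_def x_def[symmetric] y_def[symmetric]
    using Sp xz zy nz nw wx by (auto simp: un_def)
  then show ?thesis by blast
qed

text \<open>The choice of \<open>SOME\<close> is under control as long as some pair is uncrossed,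
  hence for all steps before \<open>duration\<close>; see \<open>ready_upto\<close>.\<close>

primrec state :: "nat \<Rightarrow> nat \<Rightarrow> nat" where
  "state 0 = (\<lambda>p. p)"
| "state (Suc T) = swap_adj (state T) (SOME p. ready (state T) p)"

definition all_crossed :: "nat \<Rightarrow> bool" where
  "all_crossed T \<longleftrightarrow> (\<forall>i<n. \<forall>j<n. i \<noteq> j \<longrightarrow> crossed n (state T) i j)"

definition duration :: nat where "duration = (LEAST T. all_crossed T)"

definition height :: "nat \<Rightarrow> nat" where "height T = (SOME p. ready (state T) p)"

lemma state_swept:
  "(\<And>S. S < T \<Longrightarrow> \<not> all_crossed S) \<Longrightarrow> swept (state T)"
proof (induction T)
  case 0
  have b: "bij_betw (\<lambda>p. p) {..<n} {..<n}" by (simp add: bij_betw_def)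
  have "pos n (\<lambda>p. p) i = i" if "i < n" for i
    using pos_pi[OF b that] by simp
  then have "\<not> crossed n (\<lambda>p. p) i j" if "i < n" "j < n" for i j using that by (simp add: crossed_def)
  then show ?case using b by (auto simp: swept_def)
next
  case (Suc T)
  have sw: "swept (state T)" using Suc by simp
  have "\<not> all_crossed T" using Suc by simp
  then have "\<exists>p. ready (state T) p" using ex_ready[OF sw] unfolding all_crossed_def by blast
  then have "ready (state T) (SOME p. ready (state T) p)" by (rule someI_ex)
  then show ?case using swept_swap[OF sw] by simp
qed

lemma state_ready:
  assumes "\<And>S. S \<le> T \<Longrightarrow> \<not> all_crossed S" shows "ready (state T) (height T)"
proof -
  have sw: "swept (state T)" using assms by (intro state_swept) auto
  have "\<not> all_crossed T" using assms by simp
  then have "\<exists>p. ready (state T) p" using ex_ready[OF sw] unfolding all_crossed_def by blast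
  then show ?thesis unfolding height_def by (rule someI_ex)
qed

text \<open>Every step adds a pair to the set of crossed pairs, which has at most
  \<open>n * n\<close> elements.\<close>

lemma ex_all_crossed: "\<exists>T. all_crossed T"
proof (rule ccontr)
  assume nd: "\<nexists>T. all_crossed T"
  define X where "X T = {(i, j). i < n \<and> j < n \<and> i \<noteq> j \<and> crossed n (state T) i j}" for T
  have sub: "X T \<subseteq> {..<n} \<times> {..<n}" for T unfolding X_def by auto
  have fin: "finite (X T)" for T using finite_subset[OF sub] by simp
  have less: "X T \<subset> X (Suc T)" for T
  proof -
    have r: "ready (state T) (height T)" using nd by (intro state_ready) auto
    have b: "bij_betw (state T) {..<n} {..<n}" using nd state_swept[of T] by (auto simp: swept_def)
    let ?k = "height T"
    let ?a = "state T ?k" and ?b = "state T (Suc ?k)"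
    have k: "Suc ?k < n" "?a < ?b" using r by (auto simp: ready_def)
    have s: "state (Suc T) = swap_adj (state T) ?k" by (simp add: height_def)
    have "X T \<subseteq> X (Suc T)" unfolding X_def s using crossed_swap[OF b k(1) _ _ _ k(2)] by auto
    moreover have "(?a, ?b) \<in> X (Suc T)"
      unfolding X_def s using crossed_swap[OF b k(1) _ _ _ k(2), of ?a ?b] line_less[OF b] k by auto
    moreover have "(?a, ?b) \<notin> X T" unfolding X_def using uncrossed_start[OF b k] by auto
    ultimately show ?thesis by blast
  qed
  have "T \<le> card (X T)" for T
  proof (induction T)
    case (Suc T)
    then show ?case using psubset_card_mono[OF fin less[of T]] by simp
  qed simp
  moreover have "card (X T) \<le> n * n" for T using card_mono[OF _ sub[of T]] by (simp add: card_cartesian_product)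
  ultimately have "Suc (n * n) \<le> n * n" by (metis order_trans)
  then show False by simp
qed

lemma not_all_crossed: "T < duration \<Longrightarrow> \<not> all_crossed T"
  unfolding duration_def by (rule not_less_Least)

lemma all_crossed_duration: "all_crossed duration"
  unfolding duration_def using ex_all_crossed by (rule LeastI_ex)

lemma swept_upto: "T \<le> duration \<Longrightarrow> swept (state T)"
  using state_swept not_all_crossed by auto

lemma ready_upto: "T < duration \<Longrightarrow> ready (state T) (height T)"
  using state_ready not_all_crossed by auto

section \<open>From the times of the sweep back to the order along the chords\<close>

sublocale sweep n duration state height
proof
  show "state 0 p = p" for p by simp
  show "state (Suc T) = (state T)(height T := state T (Suc (height T)), Suc (height T) := state T (height T))" for T
    by (simp add: swap_adj_def height_def)
  show "Suc (height T) < n" "state T (height T) < state T (Suc (height T))" if "T < duration" for T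
    using ready_upto[OF that] by (auto simp: ready_def)
  show "state duration p = n - 1 - p" if "p < n" for p
    using all_crossed_reverse[of "state duration" n p] swept_upto[of duration] all_crossed_duration that
    by (auto simp: swept_def all_crossed_def)
qed

lemma crossed_Suc:
  assumes "T < duration" "i < n" "j < n" "i \<noteq> j"
  shows "crossed n (state (Suc T)) i j \<longleftrightarrow> crossed n (state T) i j \<or> meet T i j"
proof -
  have b: "bij_betw (state T) {..<n} {..<n}" using swept_upto[of T] assms by (auto simp: swept_def)
  have k: "Suc (height T) < n" "state T (height T) < state T (Suc (height T))"
    using ready_upto[OF assms(1)] by (auto simp: ready_def)
  show ?thesis using crossed_swap[OF b k(1) assms(2-4) k(2)] assms(1)
    by (simp add: height_def meet_def lo_def hi_def)
qed

lemma crossed_meet_False: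
  assumes "meet T i j" shows "\<not> crossed n (state T) i j"
proof -
  have T: "T < duration" "{i, j} = {state T (height T), state T (Suc (height T))}"
    using assms by (auto simp: meet_def lo_def hi_def)
  have b: "bij_betw (state T) {..<n} {..<n}" using swept_upto[of T] T by (auto simp: swept_def)
  have k: "Suc (height T) < n" "state T (height T) < state T (Suc (height T))"
    using ready_upto[OF T(1)] by (auto simp: ready_def)
  show ?thesis using uncrossed_start[OF b k] crossed_sym[OF b] T k line_less[OF b]
    by (auto simp: doubleton_eq_iff)
qed

lemma meet_rules:
  assumes "meet T i j" shows "T < duration" "i < n" "j < n" "i \<noteq> j"
  using assms lo_hi_less[of T] lo_less_hi[of T] by (auto simp: meet_def doubleton_eq_iff)

lemma crossed_mono:
  assumes "crossed n (state T) i j" "T \<le> T'" "T' \<le> duration" "i < n" "j < n" "i \<noteq> j"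
  shows "crossed n (state T') i j"
  using assms(2,3)
proof (induction T' rule: dec_induct)
  case (step m) then show ?case using crossed_Suc[of m i j] assms by auto
qed (use assms in simp)

lemma meet_less_crossed:
  assumes "meet T i j" "T < T'" "T' \<le> duration" shows "crossed n (state T') i j"
  using crossed_mono[of "Suc T" i j T'] crossed_Suc[of T i j] meet_rules[OF assms(1)] assms by auto

lemma meet_unique: "meet T i j \<Longrightarrow> meet T' i j \<Longrightarrow> T = T'"
  using meet_less_crossed crossed_meet_False meet_rules(1)
  by (metis less_imp_le linorder_neqE_nat)

lemma meet_sym: "meet T i j \<longleftrightarrow> meet T j i"
  by (simp add: meet_def insert_commute)

lemma ex_meet:
  assumes "i < n" "j < n" "i \<noteq> j" shows "\<exists>T. meet T i j"
proof (rule ccontr)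
  assume "\<not> ?thesis"
  then have *: "\<not> crossed n (state T) i j" if "T \<le> duration" for T
    using that
  proof (induction T)
    case 0
    have "bij_betw (\<lambda>p. p) {..<n} {..<n}" by (simp add: bij_betw_def)
    from pos_pi[OF this, of i] pos_pi[OF this, of j] show ?case
      using assms by (simp add: crossed_def)
  next
    case (Suc T) then show ?case using crossed_Suc[of T i j] assms by auto
  qed
  show False using *[of duration] all_crossed_duration assms by (auto simp: all_crossed_def)
qed

text \<open>Just before step \<open>T'\<close> the pair \<open>i\<close>, \<open>j\<close> is
  crossed and the pair \<open>i\<close>, \<open>k\<close> is not, so the invariant
  \<open>swept\<close> compares their parameters.\<close>

lemma meet_order:
  assumes "meet T i j" "meet T' i k" "T < T'" shows "\<tau> i j < \<tau> i k"
proof -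
  note r = meet_rules[OF assms(1)] meet_rules[OF assms(2)]
  have "crossed n (state T') i j" using meet_less_crossed assms r by auto
  moreover have "\<not> crossed n (state T') i k" using crossed_meet_False assms by auto
  ultimately have "j \<noteq> k" by auto
  show ?thesis using \<open>crossed n (state T') i j\<close> \<open>\<not> crossed n (state T') i k\<close> \<open>j \<noteq> k\<close>
      swept_upto[of T'] r unfolding swept_def by (meson less_imp_le)
qed

definition adjacent :: "nat \<Rightarrow> nat \<Rightarrow> nat \<Rightarrow> bool" where
  "adjacent i j k \<longleftrightarrow> (\<forall>m<n. m \<noteq> i \<longrightarrow>
     \<not> (\<tau> i j < \<tau> i m \<and> \<tau> i m < \<tau> i k) \<and> \<not> (\<tau> i k < \<tau> i m \<and> \<tau> i m < \<tau> i j))"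

text \<open>The combinatorial triangles. They are kept as sets, so that \<open>card\<close> counts
  each of them once, in whatever order its chords are listed.\<close>

definition empty_triples :: "nat set set" where
  "empty_triples = {{i, j, k} | i j k. i < n \<and> j < n \<and> k < n \<and> i \<noteq> j \<and> i \<noteq> k \<and> j \<noteq> k \<and>
     adjacent i j k \<and> adjacent j i k \<and> adjacent k i j}"

text \<open>A chord meeting \<open>i\<close> strictly between would move \<open>i\<close> at a time
  strictly between \<open>s\<close> and \<open>t\<close>, by \<open>meet_order\<close>.\<close>

lemma edge_adjacent:
  assumes "edge i s t" "meet s i j" "meet t i k"
  shows "adjacent i j k"
proof -
  have st: "s < t" using assms by (simp add: edge_def)
  have jk: "\<tau> i j < \<tau> i k" using meet_order assms st by auto
  have False if m: "m < n" "m \<noteq> i" "\<tau> i j < \<tau> i m" "\<tau> i m < \<tau> i k" for m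
  proof -
    obtain T where T: "meet T i m" using ex_meet[of i m] m meet_rules[OF assms(2)] by auto
    have mv: "moves T i" using T by (auto simp: meet_def moves_def doubleton_eq_iff)
    have "T \<noteq> s" "T \<noteq> t"
      using m T assms by (auto simp: meet_def doubleton_eq_iff)
    moreover have "\<not> T < s" using meet_order[OF T assms(2)] m by auto
    moreover have "\<not> t < T" using meet_order[OF assms(3) T] m by auto
    ultimately have "s < T" "T < t" by auto
    then show False using assms(1) mv by (auto simp: edge_def)
  qed
  then show ?thesis using jk unfolding adjacent_def by force
qed

theorem card_empty_triples: "n - 2 \<le> card empty_triples"
proof -
  let ?T = "{(s, t). face s t \<and> tri s t}"
  let ?Q = "\<lambda>s t S. \<exists>r p q w. S = {p, q, w} \<and> s < r \<and> r < t \<and> meet s p q \<and> meet r p w \<and> meet t q w"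
  have ex: "\<exists>S \<in> empty_triples. ?Q s t S" if tri: "tri s t" for s t
  proof -
    obtain r p q w where h: "edge p s r" "edge q s t" "edge w r t" "meet s p q" "meet r p w" "meet t q w"
      using tri unfolding tri_def by blast
    have "adjacent p q w" using edge_adjacent[OF h(1,4,5)] .
    moreover have "adjacent q p w" using edge_adjacent[OF h(2)] h meet_sym by blast
    moreover have "adjacent w p q" using edge_adjacent[OF h(3)] h meet_sym by blast
    moreover note meet_rules[OF h(4)] meet_rules[OF h(5)] meet_rules[OF h(6)]
    ultimately have "{p, q, w} \<in> empty_triples" unfolding empty_triples_def by blast
    moreover have "s < r" "r < t" using h by (auto simp: edge_def)
    ultimately show ?thesis using h by blast
  qed
  define f where "f = (\<lambda>(s, t). SOME S. S \<in> empty_triples \<and> ?Q s t S)"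
  have f: "f (s, t) \<in> empty_triples \<and> ?Q s t (f (s, t))" if "tri s t" for s t
    using someI_ex[OF ex[OF that, unfolded Bex_def]] unfolding f_def by simp
  \<comment> \<open>Since two lines meet only once, the set of three lines determines its three
    crossing times. Their minimum and maximum are \<open>s\<close> and \<open>t\<close>, which makes
    \<open>f\<close> injective.\<close>
  have times: "{T. \<exists>i\<in>S. \<exists>j\<in>S. meet T i j} = {s, r, t}"
    if h: "S = {p, q, w}" "meet s p q" "meet r p w" "meet t q w" for S s r t p q w
  proof -
    have "T \<in> {s, r, t}" if "meet T i j" "i \<in> S" "j \<in> S" for T i j
      using that h meet_unique meet_sym meet_rules(4) by (auto; metis)
    then show ?thesis using h by blast
  qed
  have "inj_on f ?T"
  proof (rule inj_onI, clarify)
    fix s t s' t' assume a: "tri s t" "tri s' t'" "f (s, t) = f (s', t')"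
    have ex: "\<exists>r. {T. \<exists>i\<in>f (s, t). \<exists>j\<in>f (s, t). meet T i j} = {s, r, t} \<and> s < r \<and> r < t" if "tri s t" for s t
    proof -
      from f[OF that] obtain r p q w where
        h: "f (s, t) = {p, q, w}" "s < r" "r < t" "meet s p q" "meet r p w" "meet t q w" by blast
      show ?thesis using times[OF h(1,4-6)] h(2,3) by blast
    qed
    obtain r where r: "{T. \<exists>i\<in>f (s, t). \<exists>j\<in>f (s, t). meet T i j} = {s, r, t}" "s < r" "r < t"
      using ex[OF a(1)] by blast
    obtain r' where r': "{T. \<exists>i\<in>f (s', t'). \<exists>j\<in>f (s', t'). meet T i j} = {s', r', t'}" "s' < r'" "r' < t'"
      using ex[OF a(2)] by blast
    have eq: "{s, r, t} = {s', r', t'}" using r r' a(3) by simp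
    then have "Min {s, r, t} = Min {s', r', t'}" "Max {s, r, t} = Max {s', r', t'}" by simp_all
    then show "s = s' \<and> t = t'" using r(2,3) r'(2,3) by simp
  qed
  moreover have "f ` ?T \<subseteq> empty_triples" using f by auto
  moreover have "finite empty_triples"
    by (rule finite_subset[of _ "Pow {..<n}"]) (auto simp: empty_triples_def)
  ultimately have "card ?T \<le> card empty_triples" by (intro card_inj_on_le)
  then show ?thesis using card_tri by simp
qed

end

section \<open>Jordan curves on the sphere\<close>

lemma simple_loop_circle:
  fixes c :: "real \<Rightarrow> complex"
  defines "c \<equiv> \<lambda>t. cis (2 * pi * t)"
  shows "simple_path c" "pathfinish c = pathstart c" "path_image c = sphere 0 1"
proof -
  have "s = t \<or> s = 0 \<and> t = 1 \<or> s = 1 \<and> t = 0" if "s \<in> {0..1}" "t \<in> {0..1}" "c s = c t" for s t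
  proof -
    have "sin (2 * pi * s) = sin (2 * pi * t) \<and> cos (2 * pi * s) = cos (2 * pi * t)"
      using that(3) unfolding c_def by (metis cis.sel)
    then obtain m :: int where "2 * pi * s = 2 * pi * t + 2 * pi * m" by (auto simp: sin_cos_eq_iff)
    then have "pi * s = pi * (t + m)" by (simp add: algebra_simps)
    then have m: "s = t + m" by simp
    have "real_of_int m > - 2" "real_of_int m < 2" using m that by auto
    then have "m = -1 \<or> m = 0 \<or> m = 1" by linarith
    then show ?thesis using m that by auto
  qed
  moreover have "path c" unfolding path_def c_def by (intro continuous_intros)
  ultimately show "simple_path c" unfolding simple_path_def loop_free_def by blast
  show "pathfinish c = pathstart c" by (simp add: c_def pathfinish_def pathstart_def)
  show "path_image c = sphere 0 1"
  proof (intro equalityI subsetI)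
    fix z :: complex assume "z \<in> sphere 0 1"
    then have "norm z = 1" by simp
    then obtain t where "0 \<le> t" "t < 2 * pi" "z = Complex (cos t) (sin t)"
      using complex_unimodular_polar by metis
    then have "z = c (t / (2 * pi))" "t / (2 * pi) \<in> {0..1}" by (auto simp: c_def complex_eq_iff)
    then show "z \<in> path_image c" by (auto simp: path_image_def)
  qed (auto simp: path_image_def c_def)
qed

lemma pseudocircle_imp_loop:
  assumes "pseudocircle P"
  obtains g where "simple_path g" "pathfinish g = pathstart g" "path_image g = P"
proof -
  have "sphere (0::complex) 1 homeomorphic sphere (0::real^2) 1"
    by (rule homeomorphic_spheres_gen) auto
  moreover have "sphere (0::real^2) 1 homeomorphic P"
    using assms homeomorphic_sym unfolding pseudocircle_def by blast
  ultimately obtain f f' where f: "homeomorphism (sphere (0::complex) 1) P f f'"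
    by (meson homeomorphic_trans homeomorphic_def)
  define c :: "real \<Rightarrow> complex" where "c = (\<lambda>t. cis (2 * pi * t))"
  note c = simple_loop_circle[folded c_def]
  have "inj_on f (path_image c)" using f c by (intro inj_on_inverseI[of _ f']) (auto simp: homeomorphism_def)
  then have "simple_path (f \<circ> c)"
    using c f by (intro simple_path_continuous_image) (auto simp: homeomorphism_def)
  moreover have "pathfinish (f \<circ> c) = pathstart (f \<circ> c)" using c by (simp add: pathfinish_compose pathstart_compose)
  moreover have "path_image (f \<circ> c) = P" using c f by (simp add: path_image_compose homeomorphism_def)
  ultimately show ?thesis using that by blast
qed

lemma loop_imp_pseudocircle:
  assumes "simple_path g" "pathfinish g = pathstart g" "path_image g \<subseteq> S2"
  shows "pseudocircle (path_image g)"
proof -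
  have "path_image g homeomorphic sphere (0::complex) 1"
    using homeomorphic_simple_path_image_circle[OF assms(1,2)] by simp
  also have "sphere (0::complex) 1 homeomorphic sphere (0::real^2) 1"
    by (rule homeomorphic_spheres_gen) auto
  finally show ?thesis using assms by (simp add: pseudocircle_def)
qed

text \<open>The 2-sphere is simply connected, the circle is not.\<close>

lemma pseudocircle_not_sphere: "pseudocircle P \<Longrightarrow> P \<noteq> S2"
  using homeomorphic_simply_connected_eq[of S2 "sphere (0::real^2) 1"]
  by (auto simp: pseudocircle_def simply_connected_sphere_eq)

lemma pseudocircle_connected: "pseudocircle P \<Longrightarrow> connected P"
  by (metis connected_simple_path_image pseudocircle_imp_loop)

lemma components_Un_separated:
  fixes I J :: "'a::topological_space set"
  assumes "connected I" "connected J" "I \<noteq> {}" "J \<noteq> {}"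
    "closure I \<inter> J = {}" "closure J \<inter> I = {}"
  shows "components (I \<union> J) = {I, J}"
proof -
  have sep: "I \<inter> X = {} \<or> J \<inter> X = {}" if "connected X" "X \<subseteq> I \<union> J" for X
    using connected_closedD[OF that(1), of "closure I" "closure J"] that(2) assms(5,6)
      closure_subset[of I] closure_subset[of J] by blast
  have "I \<in> components (I \<union> J)"
    unfolding in_components_maximal
  proof (intro conjI allI impI)
    fix d assume "d \<noteq> {} \<and> I \<subseteq> d \<and> d \<subseteq> I \<union> J \<and> connected d"
    then show "d = I" using sep[of d] assms(3) by blast
  qed (use assms in auto)
  moreover have "J \<in> components (I \<union> J)"
    unfolding in_components_maximal
  proof (intro conjI allI impI)
    fix d assume "d \<noteq> {} \<and> J \<subseteq> d \<and> d \<subseteq> I \<union> J \<and> connected d"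
    then show "d = J" using sep[of d] assms(4) by blast
  qed (use assms in auto)
  moreover have "X \<in> {I, J}" if X: "X \<in> components (I \<union> J)" for X
  proof -
    have "X \<noteq> {}" "X \<subseteq> I \<union> J" using in_components_nonempty[OF X] in_components_subset[OF X] by auto
    then have "X \<inter> I \<noteq> {} \<or> X \<inter> J \<noteq> {}" by auto
    then show ?thesis using components_eq[OF X \<open>I \<in> _\<close>] components_eq[OF X \<open>J \<in> _\<close>] by auto
  qed
  ultimately show ?thesis by blast
qed

lemma stereographic:
  assumes "p \<in> S2"
  obtains h k where "homeomorphism (S2 - {p}) (UNIV :: complex set) h k"
proof -
  have "(S2 - {p}) homeomorphic (UNIV :: complex set)"
    by (rule homeomorphic_punctured_sphere_affine) (use assms in \<open>auto simp: aff_dim_UNIV\<close>)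
  then show ?thesis using that by (auto simp: homeomorphic_def)
qed

lemma connected_S2: "connected S2"
  by (rule connected_sphere) simp

lemma S2_limpt:
  assumes "p \<in> S2" shows "p islimpt S2"
proof (rule connected_imp_perfect[OF connected_S2 assms])
  fix x show "S2 \<noteq> {x}"
  proof
    assume "S2 = {x}"
    then have "p = x" "- p = x" using assms by (metis norm_minus_cancel mem_sphere_0 singletonD)+
    then have "p = - p" by simp
    then have "p = 0" by (simp add: vec_eq_iff)
    then show False using assms by simp
  qed
qed

text \<open>Stereographic projection from a point \<open>p\<close> off the curve reduces this to the
  plane. The inside pulls back to \<open>I\<close>; the outside pulls back to \<open>K\<close>
  without the pole \<open>p\<close>, which has to be added.\<close>

theorem Jordan_curve_S2:
  assumes "pseudocircle P"
  obtains I J where "components (S2 - P) = {I, J}" "I \<noteq> J" "closure I = I \<union> P" "closure J = J \<union> P"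
proof -
  obtain g where g: "simple_path g" "pathfinish g = pathstart g" "path_image g = P"
    using pseudocircle_imp_loop[OF assms] by metis
  have PS: "P \<subseteq> S2" using assms by (simp add: pseudocircle_def)
  then obtain p where p: "p \<in> S2" "p \<notin> P" using pseudocircle_not_sphere[OF assms] by blast
  obtain h k where hk: "homeomorphism (S2 - {p}) (UNIV :: complex set) h k"
    using stereographic[OF p(1)] by metis
  have hP: "P \<subseteq> S2 - {p}" using PS p by auto
  have kh: "k (h x) = x" if "x \<in> S2 - {p}" for x using hk that by (rule homeomorphism_apply1)
  have hk': "h (k z) = z" for z using hk by (simp add: homeomorphism_apply2)
  have kim: "k ` UNIV = S2 - {p}" using hk by (simp add: homeomorphism_def)
  have injk: "inj k" using hk' by (metis injI)
  have ck: "continuous_on UNIV k" and ch: "continuous_on (S2 - {p}) h"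
    using hk by (auto simp: homeomorphism_def)
  define c where "c = h \<circ> g"
  have c: "simple_path c" "pathfinish c = pathstart c" "path_image c = h ` P"
  proof -
    have "inj_on h P" using kh hP by (intro inj_on_inverseI[of _ k]) blast
    then show "simple_path c" unfolding c_def
      using g hP ch by (intro simple_path_continuous_image) (auto intro: continuous_on_subset)
    show "pathfinish c = pathstart c" unfolding c_def using g by (simp add: pathfinish_compose pathstart_compose)
    show "path_image c = h ` P" unfolding c_def using g by (simp add: path_image_compose)
  qed
  define A where "A = inside (path_image c)"
  define B where "B = outside (path_image c)"
  note J = Jordan_inside_outside[OF c(1,2), folded A_def B_def]
  have kQ: "k ` path_image c = P" using c(3) kh hP by (force simp: image_iff)
  have clA: "closure A = A \<union> path_image c" and clB: "closure B = B \<union> path_image c"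
    using J by (metis closure_Un_frontier)+
  define I where "I = k ` A"
  define K where "K = insert p (k ` B)"
  have all: "S2 - P = I \<union> K"
  proof -
    have "A \<union> B \<union> path_image c = UNIV" using J by auto
    then have "S2 - {p} = I \<union> k ` B \<union> P" unfolding I_def kQ[symmetric] kim[symmetric] by auto
    moreover have "(I \<union> k ` B) \<inter> P = {}"
      unfolding I_def kQ[symmetric] using J injk by (auto simp: inj_def)
    ultimately show ?thesis unfolding K_def using p by auto
  qed
  have dis: "I \<inter> K = {}"
  proof -
    have "A \<inter> B = {}" using J by blast
    then have "k ` A \<inter> k ` B = {}" using image_Int[OF injk, of A B] by simp
    then show ?thesis unfolding I_def K_def using kim by auto
  qed
  have cpt: "closed (I \<union> P)"
  proof -
    have "compact (closure A)" using J by (simp add: compact_closure)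
    then have "compact (k ` closure A)" using ck by (meson compact_continuous_image continuous_on_subset subset_UNIV)
    then show ?thesis unfolding clA I_def using kQ by (simp add: image_Un compact_imp_closed)
  qed
  have clI: "closure I = I \<union> P"
  proof
    show "closure I \<subseteq> I \<union> P" using cpt by (intro closure_minimal) auto
    have "k ` closure A \<subseteq> closure I" unfolding I_def
      using ck by (rule continuous_image_closure_subset) simp
    then show "I \<union> P \<subseteq> closure I" unfolding clA image_Un kQ I_def by simp
  qed
  have "openin (top_of_set (S2 - {p})) I"
    unfolding I_def using hk J by (intro homeomorphism_imp_open_map[OF homeomorphism_symD]) auto
  moreover have "openin (top_of_set S2) (S2 - {p})" by (simp add: openin_delete)
  ultimately have "openin (top_of_set S2) I" by (rule openin_trans)
  then have "closedin (top_of_set S2) (S2 - I)" by (simp add: closedin_diff)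
  then have "closed (S2 - I)" using closedin_closed_trans closed_sphere by blast
  moreover have "S2 - I = K \<union> P" using all dis PS J unfolding I_def K_def kQ[symmetric] by (auto simp: I_def)
  ultimately have clK1: "closed (K \<union> P)" by simp
  have "k ` closure B \<subseteq> closure (k ` B)"
    using ck by (rule continuous_image_closure_subset) simp
  then have PB: "P \<subseteq> closure (k ` B)" unfolding clB image_Un kQ by simp
  have clK: "closure K = K \<union> P"
  proof
    show "closure K \<subseteq> K \<union> P" using clK1 by (intro closure_minimal) auto
    show "K \<union> P \<subseteq> closure K" using PB closure_mono[of "k ` B" K] closure_subset[of K] unfolding K_def by auto
  qed
  \<comment> \<open>Otherwise the pole would be isolated in the sphere. So adding it keeps the outer
    side connected.\<close>
  have "p \<in> closure (k ` B)"
  proof (rule ccontr)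
    assume np: "p \<notin> closure (k ` B)"
    have "p \<notin> I \<union> P" using p all dis unfolding K_def by auto
    then have "p \<in> - (closure (k ` B) \<union> (I \<union> P))" using np by auto
    moreover have "open (- (closure (k ` B) \<union> (I \<union> P)))" by (intro open_Compl closed_Un cpt closed_closure)
    ultimately obtain y where "y \<in> S2" "y \<noteq> p" "y \<in> - (closure (k ` B) \<union> (I \<union> P))"
      by (rule islimptE[OF S2_limpt[OF p(1)]])
    then show False using all closure_subset[of "k ` B"] unfolding K_def by blast
  qed
  moreover have "connected (k ` B)"
    using J continuous_on_subset[OF ck] by (intro connected_continuous_image) auto
  ultimately have conK: "connected K"
    using closure_subset[of "k ` B"] unfolding K_def
    by (intro connected_intermediate_closure[of "k ` B" "insert p (k ` B)"]) auto
  have conI: "connected I" unfolding I_def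
    using J continuous_on_subset[OF ck] by (intro connected_continuous_image) auto
  have IK: "I \<noteq> {}" "K \<noteq> {}" unfolding I_def K_def using J by auto
  have "I \<inter> P = {}" "K \<inter> P = {}" using all by auto
  then have "components (S2 - P) = {I, K}"
    unfolding all using conI conK IK clI clK dis by (intro components_Un_separated) auto
  moreover have "I \<noteq> K" using dis IK by auto
  ultimately show ?thesis using that clI clK by blast
qed

section \<open>Finiteness of the number of faces\<close>

lemma simple_loop_from_point:
  assumes "simple_path g" "pathfinish g = pathstart g" "x \<in> path_image g"
  obtains h where "simple_path h" "pathfinish h = x" "pathstart h = x" "path_image h = path_image g"
proof -
  obtain t where t: "t \<in> {0..1}" "g t = x" using assms(3) by (auto simp: path_image_def)
  show ?thesis
  proof
    show "simple_path (shiftpath t g)" using assms t by (simp add: simple_path_shiftpath)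
    show "pathfinish (shiftpath t g) = x" "pathstart (shiftpath t g) = x"
      using assms t by (auto simp: pathfinish_shiftpath pathstart_shiftpath)
    show "path_image (shiftpath t g) = path_image g" using assms t by (simp add: path_image_shiftpath)
  qed
qed

text \<open>Let \<open>\<gamma>\<close> be the curve without a short piece around \<open>x\<close>,
  and let \<open>T\<close> be \<open>\<gamma>\<close> together with the outside of the ball. Neither
  the curve nor \<open>T\<close> separates \<open>p\<close> from \<open>q\<close>, and they
  intersect in the connected set \<open>\<gamma>\<close>; by the theorem of Janiszewski their union
  does not separate the two points either.\<close>

lemma Jordan_domain_locally_connected:
  fixes g :: "real \<Rightarrow> complex"
  assumes g: "simple_path g" "pathfinish g = pathstart g" "x \<in> path_image g" and e: "e > 0"
  shows "\<exists>d>0. \<forall>p\<in>ball x d. \<forall>q\<in>ball x d.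
     connected_component (- path_image g) p q \<longrightarrow> connected_component (ball x e - path_image g) p q"
proof -
  obtain h where h: "simple_path h" "pathfinish h = x" "pathstart h = x" "path_image h = path_image g"
    using simple_loop_from_point[OF g] by metis
  have cont: "continuous_on {0..1} h" using h by (simp add: simple_path_def path_def)
  then have "uniformly_continuous_on {0..1} h" by (simp add: compact_uniformly_continuous)
  then obtain r where r: "r > 0" "\<And>s t. s \<in> {0..1} \<Longrightarrow> t \<in> {0..1} \<Longrightarrow> dist s t < r \<Longrightarrow> dist (h s) (h t) < e"
    unfolding uniformly_continuous_on_def using e by metis
  \<comment> \<open>The first bound keeps both removed ends of the parameter interval shorter than
    the modulus \<open>r\<close>; the second keeps \<open>{\<eta>..1 - \<eta>}\<close> a proper
    interval.\<close>
  define \<eta> where "\<eta> = min (r / 2) (1 / 4)"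
  have \<eta>: "0 < \<eta>" "\<eta> < r" "\<eta> \<le> 1 / 4" using r by (auto simp: \<eta>_def min_def)
  have h01: "h 0 = x" "h 1 = x" using h by (auto simp: pathfinish_def pathstart_def)
  define \<gamma> where "\<gamma> = h ` {\<eta>..1 - \<eta>}"
  have c\<gamma>: "continuous_on {\<eta>..1 - \<eta>} h" using cont by (rule continuous_on_subset) (use \<eta> in auto)
  have "compact \<gamma>" unfolding \<gamma>_def using c\<gamma> by (intro compact_continuous_image) auto
  then have cl: "closed \<gamma>" by (rule compact_imp_closed)
  have con: "connected \<gamma>" unfolding \<gamma>_def using c\<gamma> by (intro connected_continuous_image) auto
  have x\<gamma>: "x \<notin> \<gamma>"
  proof
    assume "x \<in> \<gamma>"
    then obtain t where t: "\<eta> \<le> t" "t \<le> 1 - \<eta>" "h t = h 0" using h01 by (auto simp: \<gamma>_def)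
    then have "t \<in> {0..1}" "(0::real) \<in> {0..1}" using \<eta> by auto
    then have "t = 0 \<or> t = 1" using h(1) t(3) unfolding simple_path_def loop_free_def by blast
    then show False using t \<eta> by auto
  qed
  have "\<gamma> \<subseteq> path_image h" unfolding \<gamma>_def path_image_def using \<eta> by (intro image_mono) auto
  then have \<gamma>sub: "\<gamma> \<subseteq> path_image g" using h(4) by simp
  have near: "y \<in> ball x e" if y: "y \<in> path_image g" "y \<notin> \<gamma>" for y
  proof -
    have "y \<in> path_image h" using y h(4) by simp
    then obtain t where t: "t \<in> {0..1}" "y = h t" by (auto simp: path_image_def)
    then have "t < \<eta> \<or> 1 - \<eta> < t" using y by (force simp: \<gamma>_def)
    then show ?thesis using r(2)[of 0 t] r(2)[of 1 t] t h01 \<eta> by (auto simp: dist_real_def)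
  qed
  have "open (- \<gamma>)" using cl by (simp add: open_Compl)
  then obtain d0 where d0: "d0 > 0" "ball x d0 \<subseteq> - \<gamma>" by (rule openE[of _ x]) (use x\<gamma> in auto)
  define T where "T = \<gamma> \<union> - ball x e"
  have "closed T" unfolding T_def using cl by (intro closed_Un) auto
  have "path_image g \<inter> T = \<gamma>" unfolding T_def using \<gamma>sub near by blast
  show ?thesis
  proof (intro exI[of _ "min d0 e"] conjI ballI impI)
    show "min d0 e > 0" using d0 e by simp
    fix p q assume pq: "p \<in> ball x (min d0 e)" "q \<in> ball x (min d0 e)" "connected_component (- path_image g) p q"
    have "ball x (min d0 e) \<subseteq> - T" unfolding T_def using d0 by auto
    then have "connected_component (- T) p q"
      using pq by (meson connected_ball connected_component_def)
    moreover have "compact (path_image g)" using g by (simp add: compact_simple_path_image)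
    ultimately have "connected_component (- (path_image g \<union> T)) p q"
      using \<open>closed T\<close> \<open>path_image g \<inter> T = \<gamma>\<close> con pq by (intro Janiszewski) auto
    moreover have "- (path_image g \<union> T) \<subseteq> ball x e - path_image g" unfolding T_def by auto
    ultimately show "connected_component (ball x e - path_image g) p q"
      by (rule connected_component_of_subset)
  qed
qed

lemma component_closed:
  assumes "V \<in> components S" "p \<in> V" "connected_component S p q" shows "q \<in> V"
proof -
  obtain T where "connected T" "T \<subseteq> S" "p \<in> T" "q \<in> T"
    using assms(3) unfolding connected_component_def by blast
  then show ?thesis using components_maximal[OF assms(1), of T] assms(2) by blast
qed

lemma finite_loop_preimage:
  fixes g :: "real \<Rightarrow> 'a::real_normed_vector"
  assumes "simple_path g" "finite Z"
  shows "finite {t \<in> {0..1}. g t \<in> Z}"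
proof -
  have "finite {t \<in> {0<..<1}. g t \<in> Z}"
  proof (rule finite_imageD)
    show "finite (g ` {t \<in> {0<..<1}. g t \<in> Z})" using assms(2) by (rule finite_subset[rotated]) auto
    show "inj_on g {t \<in> {0<..<1}. g t \<in> Z}"
      using simple_path_inj_on[OF assms(1)] by (rule inj_on_subset) auto
  qed
  then have "finite ({t \<in> {0<..<1}. g t \<in> Z} \<union> {0, 1})" by simp
  then show ?thesis by (rule finite_subset[rotated]) auto
qed

section \<open>Finitely many faces in the plane\<close>

context
  fixes \<P> :: "complex set set" and Z :: "complex set"
  assumes finP: "finite \<P>" and finZ: "finite Z"
    and loop: "\<And>P. P \<in> \<P> \<Longrightarrow> \<exists>g. simple_path g \<and> pathfinish g = pathstart g \<and> path_image g = P"
    and meetZ: "\<And>P Q. P \<in> \<P> \<Longrightarrow> Q \<in> \<P> \<Longrightarrow> P \<noteq> Q \<Longrightarrow> P \<inter> Q \<subseteq> Z"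
begin

lemma closed_curves: "P \<in> \<P> \<Longrightarrow> compact P"
  using loop compact_simple_path_image by metis

lemma closed_union: "closed (\<Union>\<P>)"
  using finP closed_curves by (intro closed_Union) (auto simp: compact_imp_closed)

text \<open>Off \<open>Z\<close> no other curve comes near \<open>x\<close>, so the local
  connectedness of a side of \<open>P\<close> puts all its points near \<open>x\<close> into a
  single face.\<close>

lemma one_face_per_side:
  assumes P: "P \<in> \<P>" and x: "x \<in> P" "x \<notin> Z"
  shows "\<exists>d>0. \<forall>p\<in>ball x d. \<forall>q\<in>ball x d.
     connected_component (- P) p q \<longrightarrow> connected_component (- \<Union>\<P>) p q"
proof -
  obtain g where g: "simple_path g" "pathfinish g = pathstart g" "path_image g = P"
    using loop[OF P] by blast
  have "closed (\<Union>(\<P> - {P}))" using finP closed_curves by (intro closed_Union) (auto simp: compact_imp_closed)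
  moreover have "x \<notin> \<Union>(\<P> - {P})" using meetZ[OF P] x by blast
  ultimately have "open (- \<Union>(\<P> - {P}))" "x \<in> - \<Union>(\<P> - {P})" by (auto simp: open_Compl)
  then obtain e where e: "e > 0" "ball x e \<subseteq> - \<Union>(\<P> - {P})" by (rule openE)
  obtain d where d: "d > 0" "\<forall>p\<in>ball x d. \<forall>q\<in>ball x d.
     connected_component (- P) p q \<longrightarrow> connected_component (ball x e - P) p q"
    using Jordan_domain_locally_connected[OF g(1,2) _ e(1), of x, unfolded g(3), OF x(1)] by blast
  have sub: "ball x e - P \<subseteq> - \<Union>\<P>" using e by auto
  show ?thesis
    using d connected_component_of_subset[OF _ sub] by blast
qed

lemma face_side:
  assumes P: "P \<in> \<P>" and V: "V \<in> components (- \<Union>\<P>)" and D: "D \<in> components (- P)" "V \<inter> D \<noteq> {}"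
  shows "V \<subseteq> D"
proof -
  have "connected V" "V \<subseteq> - P" using V P in_components_connected in_components_subset by blast+
  then show ?thesis using D components_maximal by blast
qed

text \<open>The parameters at which \<open>g\<close> touches the closure of \<open>V\<close> are
  clopen in the segment. They are open because near such a point all of \<open>D\<close> belongs to
  \<open>V\<close> by \<open>one_face_per_side\<close>, and \<open>D\<close> accumulates at every
  point of \<open>P\<close>.\<close>

lemma touching_spreads:
  assumes P: "P \<in> \<P>" "simple_path g" "path_image g = P" "pathfinish g = pathstart g"
    and V: "V \<in> components (- \<Union>\<P>)" and D: "D \<in> components (- P)" "V \<subseteq> D"
    and st: "0 \<le> s" "s \<le> 1" "0 \<le> t" "t \<le> 1" and avoid: "g ` closed_segment s t \<inter> Z = {}"
    and touch: "g s \<in> closure V"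
  shows "g t \<in> closure V"
proof -
  have seg01: "closed_segment s t \<subseteq> {0..1}" using st by (intro closed_segment_subset) auto
  have "continuous_on {0..1} g" using P(2) by (simp add: simple_path_def path_def)
  then have cg: "continuous_on (closed_segment s t) g" using seg01 by (rule continuous_on_subset)
  have segP: "g r \<in> P" if "r \<in> closed_segment s t" for r
    using P(3) that seg01 unfolding path_image_def by blast
  have clD: "P \<subseteq> closure D"
  proof -
    note J = Jordan_inside_outside[OF P(2,4), unfolded P(3)]
    have ne: "inside P \<noteq> {}" "outside P \<noteq> {}" and fr: "frontier (inside P) = P" "frontier (outside P) = P"
      and un: "inside P \<union> outside P = - P" and con: "connected (inside P)" "connected (outside P)"
      using J by auto
    have "D \<noteq> {}" "D \<subseteq> - P" using in_components_nonempty[OF D(1)] in_components_subset[OF D(1)] by auto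
    then have "D \<inter> inside P \<noteq> {} \<or> D \<inter> outside P \<noteq> {}" using un by blast
    then have "inside P \<subseteq> D \<or> outside P \<subseteq> D"
      using components_maximal[OF D(1) con(1)] components_maximal[OF D(1) con(2)] un by blast
    moreover have "P \<subseteq> closure (inside P)" "P \<subseteq> closure (outside P)" using fr unfolding frontier_def by blast+
    ultimately show ?thesis using closure_mono by blast
  qed
  define S where "S = {r \<in> closed_segment s t. g r \<in> closure V}"
  have "closedin (top_of_set (closed_segment s t)) S"
    unfolding S_def using continuous_closedin_preimage[OF cg, of "closure V"]
    by (simp add: vimage_def Int_def)
  moreover have "openin (top_of_set (closed_segment s t)) S"
    unfolding openin_euclidean_subtopology_iff
  proof (intro conjI ballI)
    show "S \<subseteq> closed_segment s t" by (auto simp: S_def)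
    fix r assume r: "r \<in> S"
    then have "r \<in> closed_segment s t" "g r \<in> closure V" by (auto simp: S_def)
    then obtain d where d: "d > 0" "\<forall>p\<in>ball (g r) d. \<forall>q\<in>ball (g r) d.
        connected_component (- P) p q \<longrightarrow> connected_component (- \<Union>\<P>) p q"
      using one_face_per_side[OF P(1) segP, of r] avoid by blast
    obtain q where q: "q \<in> V" "q \<in> ball (g r) d"
      using \<open>g r \<in> closure V\<close> d(1) by (auto simp: closure_approachable dist_commute)
    obtain e where e: "e > 0" "\<And>r'. r' \<in> closed_segment s t \<Longrightarrow> dist r' r < e \<Longrightarrow> dist (g r') (g r) < d"
      using cg \<open>r \<in> closed_segment s t\<close> d(1) unfolding continuous_on_iff by metis
    have "r' \<in> S" if r': "r' \<in> closed_segment s t" "dist r' r < e" for r'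
    proof -
      have "g r' \<in> closure V"
        unfolding closure_approachable
      proof (intro allI impI)
        fix a :: real assume "a > 0"
        define b where "b = min a (d - dist (g r') (g r))"
        have "b > 0" using \<open>a > 0\<close> e(2)[OF r'] by (simp add: b_def)
        moreover have "g r' \<in> closure D" using clD segP[OF r'(1)] by auto
        ultimately obtain p where p: "p \<in> D" "dist p (g r') < b" by (meson closure_approachable)
        have "dist p (g r) < d" using p(2) dist_triangle[of p "g r" "g r'"] by (simp add: b_def)
        then have pb: "p \<in> ball (g r) d" by (simp add: dist_commute)
        have "connected_component (- P) q p"
          using D p(1) q(1) in_components_connected[OF D(1)] in_components_subset[OF D(1)]
          unfolding connected_component_def by blast
        then have "connected_component (- \<Union>\<P>) q p" using d(2) q(2) pb by blast
        then have "p \<in> V" by (rule component_closed[OF V q(1)])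
        then show "\<exists>y\<in>V. dist y (g r') < a" using p(2) by (auto simp: b_def)
      qed
      then show ?thesis using r' by (simp add: S_def)
    qed
    then show "\<exists>e>0. \<forall>r'\<in>closed_segment s t. dist r' r < e \<longrightarrow> r' \<in> S" using e(1) by blast
  qed
  moreover have "connected (closed_segment s t)" by simp
  moreover have "s \<in> S" using touch by (simp add: S_def)
  ultimately have "S = closed_segment s t" unfolding connected_clopen by blast
  then show ?thesis unfolding S_def using ends_in_segment(2)[of t s] by blast
qed

text \<open>Otherwise the frontier of \<open>V\<close> lies in the finite set \<open>Z\<close>. The
  complement of \<open>Z\<close> is connected, so \<open>V\<close> fills it, and all curves are
  contained in \<open>Z\<close>, which is absurd.\<close>

lemma face_touches_curve:
  assumes "\<P> \<noteq> {}" "V \<in> components (- \<Union>\<P>)"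
  shows "\<exists>P\<in>\<P>. \<exists>x\<in>P. x \<notin> Z \<and> x \<in> closure V"
proof (rule ccontr)
  assume no: "\<not> ?thesis"
  have opV: "open V" using closed_union assms(2) by (metis open_Compl open_components)
  have neV: "V \<noteq> {}" using assms(2) in_components_nonempty by auto
  have "frontier V \<subseteq> \<Union>\<P>" using frontier_of_components_closed_complement[OF closed_union assms(2)] .
  then have frZ: "frontier V \<subseteq> Z" using no unfolding frontier_def by blast
  have con: "connected (- Z)"
    using finZ by (intro path_connected_imp_connected path_connected_complement_countable)
      (auto simp: countable_finite)
  have "openin (top_of_set (- Z)) (- Z \<inter> V)" using opV by (simp add: openin_open_Int)
  moreover have "- Z \<inter> V = - Z \<inter> closure V"
    using frZ opV closure_subset[of V] by (auto simp: frontier_def interior_open)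
  then have "closedin (top_of_set (- Z)) (- Z \<inter> V)" by (simp add: closedin_closed_Int)
  ultimately have "- Z \<inter> V = {} \<or> - Z \<inter> V = - Z" using con unfolding connected_clopen by blast
  moreover have "- Z \<inter> V \<noteq> {}"
  proof
    assume "- Z \<inter> V = {}"
    then have "finite V" using finZ finite_subset[of V Z] by auto
    then show False using opV neV finite_imp_not_open by blast
  qed
  ultimately have "\<Union>\<P> \<subseteq> Z" using in_components_subset[OF assms(2)] by blast
  obtain P where P: "P \<in> \<P>" using assms by blast
  then obtain g where g: "simple_path g" "path_image g = P" using loop by blast
  have "finite {t \<in> {0..1}. g t \<in> Z}" using finite_loop_preimage[OF g(1) finZ] .
  moreover have "{t \<in> {0..1}. g t \<in> Z} = {0..1}" using g(2) P \<open>\<Union>\<P> \<subseteq> Z\<close> by (auto simp: path_image_def)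
  ultimately show False by (simp add: infinite_Icc)
qed

text \<open>A face is determined by a curve that it touches, the side of that curve on which it
  lies, and the edge that it touches. The edge is recorded by the crossing parameters that precede
  the touching point, so there are only finitely many keys.\<close>

lemma finite_faces_plane: "finite (components (- \<Union>\<P>))"
proof (cases "\<P> = {}")
  case True
  have "components (UNIV :: complex set) = {UNIV}" by (simp add: components_eq_sing_iff)
  then show ?thesis using True by simp
next
  case False
  obtain g where g: "\<And>P. P \<in> \<P> \<Longrightarrow> simple_path (g P) \<and> pathfinish (g P) = pathstart (g P) \<and> path_image (g P) = P"
    using loop by metis
  define F where "F P = {t \<in> {0..1}. g P t \<in> Z}" for P
  have finF: "finite (F P)" if "P \<in> \<P>" for P
    unfolding F_def using g[OF that] finZ by (intro finite_loop_preimage) auto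
  have "\<exists>P t. P \<in> \<P> \<and> t \<in> {0..1} \<and> g P t \<notin> Z \<and> g P t \<in> closure V" if V: "V \<in> components (- \<Union>\<P>)" for V
  proof -
    obtain P x where Px: "P \<in> \<P>" "x \<in> P" "x \<notin> Z" "x \<in> closure V"
      using face_touches_curve[OF False V] by blast
    then have "x \<in> path_image (g P)" using g by simp
    then obtain t where "t \<in> {0..1}" "g P t = x" unfolding path_image_def by auto
    then show ?thesis using Px by blast
  qed
  then have "\<forall>V. \<exists>P t. V \<in> components (- \<Union>\<P>) \<longrightarrow>
      P \<in> \<P> \<and> t \<in> {0..1} \<and> g P t \<notin> Z \<and> g P t \<in> closure V" by blast
  then obtain cv tm where ct: "\<And>V. V \<in> components (- \<Union>\<P>) \<Longrightarrow>
      cv V \<in> \<P> \<and> tm V \<in> {0..1} \<and> g (cv V) (tm V) \<notin> Z \<and> g (cv V) (tm V) \<in> closure V"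
    unfolding choice_iff by blast
  define key where "key V = (cv V, V \<subseteq> inside (cv V), {f \<in> F (cv V). f < tm V})" for V
  have "inj_on key (components (- \<Union>\<P>))"
  proof (rule inj_onI)
    fix V W assume V: "V \<in> components (- \<Union>\<P>)" and W: "W \<in> components (- \<Union>\<P>)" and k: "key V = key W"
    define P where "P = cv V"
    have P: "P = cv W" "P \<in> \<P>" using k ct[OF V] by (auto simp: key_def P_def)
    note gP = g[OF P(2)]
    note J = Jordan_inside_outside[of "g P"]
    have ne: "inside P \<noteq> {}" "outside P \<noteq> {}" and un: "inside P \<union> outside P = - P"
      and con: "connected (inside P)" "connected (outside P)"
      and op: "open (inside P)" "open (outside P)" and dis: "inside P \<inter> outside P = {}"
      using J gP by auto
    have comp: "components (- P) = {inside P, outside P}"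
      unfolding un[symmetric] using con ne dis op
      by (intro components_Un_separated) (auto simp: open_Int_closure_eq_empty Int_commute)
    have side: "X \<subseteq> inside P \<or> X \<subseteq> outside P" if X: "X \<in> components (- \<Union>\<P>)" for X
    proof -
      have "X \<noteq> {}" "X \<subseteq> - P" using in_components_nonempty[OF X] in_components_subset[OF X] P by auto
      then have "X \<inter> inside P \<noteq> {} \<or> X \<inter> outside P \<noteq> {}" using un by blast
      then show ?thesis using face_side[OF P(2) X] comp by blast
    qed
    have "V \<subseteq> inside P \<longleftrightarrow> W \<subseteq> inside P" using k P by (auto simp: key_def P_def)
    then obtain D where D: "D \<in> components (- P)" "V \<subseteq> D" "W \<subseteq> D"
      using side[OF V] side[OF W] comp by blast
    let ?s = "tm V" and ?t = "tm W"
    have st: "0 \<le> ?s" "?s \<le> 1" "0 \<le> ?t" "?t \<le> 1" using ct[OF V] ct[OF W] by auto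
    have eq: "{f \<in> F P. f < ?s} = {f \<in> F P. f < ?t}" using k P by (auto simp: key_def P_def)
    have avoid: "g P ` closed_segment ?s ?t \<inter> Z = {}"
    proof (rule ccontr)
      assume "\<not> ?thesis"
      then obtain r where r: "r \<in> closed_segment ?s ?t" "g P r \<in> Z" by blast
      have "closed_segment ?s ?t \<subseteq> {0..1}" using st by (intro closed_segment_subset) auto
      then have rF: "r \<in> F P" using r unfolding F_def by blast
      have "r \<noteq> ?s" "r \<noteq> ?t" using r ct[OF V] ct[OF W] P P_def by auto
      then have "(r < ?s) \<noteq> (r < ?t)" using r(1) by (auto simp: closed_segment_eq_real_ivl split: if_splits)
      then show False using eq rF by blast
    qed
    have x: "g P ?t \<in> closure V"
      using touching_spreads[OF P(2) _ _ _ V D(1,2) st avoid] gP ct[OF V] P_def by auto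
    have y: "g P ?t \<in> closure W" "g P ?t \<notin> Z" "g P ?t \<in> P"
      using ct[OF W] P gP st by (auto simp: path_image_def)
    obtain d where d: "d > 0" "\<forall>p\<in>ball (g P ?t) d. \<forall>q\<in>ball (g P ?t) d.
        connected_component (- P) p q \<longrightarrow> connected_component (- \<Union>\<P>) p q"
      using one_face_per_side[OF P(2) y(3,2)] by blast
    obtain p where p: "p \<in> V" "p \<in> ball (g P ?t) d"
      using x d(1) by (auto simp: closure_approachable dist_commute)
    obtain q where q: "q \<in> W" "q \<in> ball (g P ?t) d"
      using y d(1) by (auto simp: closure_approachable dist_commute)
    have "connected_component (- P) p q"
      using D p(1) q(1) in_components_connected[OF D(1)] in_components_subset[OF D(1)]
      unfolding connected_component_def by blast
    then have "connected_component (- \<Union>\<P>) p q" using d(2) p(2) q(2) by blast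
    then have "q \<in> V" by (rule component_closed[OF V p(1)])
    then show "V = W" using q(1) components_eq[OF V W] by blast
  qed
  moreover have "key ` components (- \<Union>\<P>) \<subseteq> (SIGMA P:\<P>. UNIV \<times> Pow (F P))"
    using ct by (auto simp: key_def)
  moreover have "finite (SIGMA P:\<P>. (UNIV :: bool set) \<times> Pow (F P))"
    using finP finF by (intro finite_SigmaI) auto
  ultimately show ?thesis by (metis finite_imageD finite_subset)
qed

end

text \<open>Project from a point \<open>p\<close> off all curves. The faces without \<open>p\<close>
  are mapped injectively to faces in the plane, and only one face contains \<open>p\<close>.\<close>

lemma finite_faces_S2:
  assumes "finite \<A>" "\<And>P. P \<in> \<A> \<Longrightarrow> pseudocircle P"
    "\<And>P Q. P \<in> \<A> \<Longrightarrow> Q \<in> \<A> \<Longrightarrow> P \<noteq> Q \<Longrightarrow> finite (P \<inter> Q)"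
  shows "finite (components (S2 - \<Union>\<A>))"
proof (cases "S2 - \<Union>\<A> = {}")
  case False
  then obtain p where p: "p \<in> S2" "p \<notin> \<Union>\<A>" by blast
  obtain h k where hk: "homeomorphism (S2 - {p}) (UNIV :: complex set) h k"
    using stereographic[OF p(1)] by metis
  have sub: "\<Union>\<A> \<subseteq> S2 - {p}" using assms(2) p by (auto simp: pseudocircle_def)
  have kh: "k (h x) = x" if "x \<in> S2 - {p}" for x using hk that by (rule homeomorphism_apply1)
  have hk': "h (k z) = z" for z using hk by (simp add: homeomorphism_apply2)
  have kim: "k z \<in> S2 - {p}" for z using hk unfolding homeomorphism_def by blast
  have ck: "continuous_on UNIV k" and ch: "continuous_on (S2 - {p}) h"
    using hk by (auto simp: homeomorphism_def)
  have inj: "inj_on h (S2 - {p})" using kh by (rule inj_on_inverseI)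
  define Z where "Z = h ` (\<Union>(P, Q)\<in>{(P, Q). P \<in> \<A> \<and> Q \<in> \<A> \<and> P \<noteq> Q}. P \<inter> Q)"
  have "finite {(P, Q). P \<in> \<A> \<and> Q \<in> \<A> \<and> P \<noteq> Q}"
    by (rule finite_subset[of _ "\<A> \<times> \<A>"]) (use assms(1) in auto)
  then have "finite Z" unfolding Z_def using assms(3) by (intro finite_imageI finite_UN_I) auto
  let ?P = "(`) h ` \<A>"
  have fin: "finite (components (- \<Union>?P))"
  proof (rule finite_faces_plane[of ?P Z])
    show "finite ?P" using assms by simp
    show "finite Z" by fact
    fix P' assume "P' \<in> ?P"
    then obtain P where P: "P \<in> \<A>" "P' = h ` P" by auto
    obtain g where g: "simple_path g" "pathfinish g = pathstart g" "path_image g = P"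
      using pseudocircle_imp_loop[OF assms(2)[OF P(1)]] by metis
    have "P \<subseteq> S2 - {p}" using P sub by auto
    then have "simple_path (h \<circ> g)"
      using g ch inj by (intro simple_path_continuous_image) (auto intro: continuous_on_subset inj_on_subset)
    moreover have "pathfinish (h \<circ> g) = pathstart (h \<circ> g)" using g by (simp add: pathfinish_compose pathstart_compose)
    moreover have "path_image (h \<circ> g) = P'" using g P by (simp add: path_image_compose)
    ultimately show "\<exists>g. simple_path g \<and> pathfinish g = pathstart g \<and> path_image g = P'" by blast
    fix Q' assume "Q' \<in> ?P" "P' \<noteq> Q'"
    then obtain Q where Q: "Q \<in> \<A>" "Q' = h ` Q" "P \<noteq> Q" using P by auto
    have "h ` P \<inter> h ` Q = h ` (P \<inter> Q)"
      using inj_on_image_Int[OF inj, of P Q] sub P Q by auto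
    then show "P' \<inter> Q' \<subseteq> Z" unfolding Z_def using P Q by auto
  qed
  define f where "f V = connected_component_set (- \<Union>?P) (h (SOME v. v \<in> V))" for V
  let ?V = "{V \<in> components (S2 - \<Union>\<A>). p \<notin> V}"
  have some: "(SOME v. v \<in> V) \<in> V" if "V \<in> components (S2 - \<Union>\<A>)" for V
    using in_components_nonempty[OF that] by (simp add: some_in_eq)
  have img: "h v \<in> - \<Union>?P" if "v \<in> S2 - {p}" "v \<notin> \<Union>\<A>" for v
  proof
    assume "h v \<in> \<Union>?P"
    then obtain w where "w \<in> \<Union>\<A>" "h v = h w" by auto
    then have "v = w" using inj that sub by (metis inj_onD subsetD)
    then show False using that \<open>w \<in> \<Union>\<A>\<close> by simp
  qed
  have "inj_on f ?V"
  proof (rule inj_onI)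
    fix V W assume V: "V \<in> ?V" and W: "W \<in> ?V" and eq: "f V = f W"
    define v where "v = (SOME v. v \<in> V)"
    define w where "w = (SOME v. v \<in> W)"
    have v: "v \<in> V" "w \<in> W" using some V W by (auto simp: v_def w_def)
    have vs: "v \<in> S2 - {p}" "v \<notin> \<Union>\<A>" "w \<in> S2 - {p}" "w \<notin> \<Union>\<A>"
      using v V W in_components_subset by blast+
    have "h w \<in> f W" unfolding f_def w_def[symmetric] using img[OF vs(3,4)] by (simp add: connected_component_refl)
    then have "h w \<in> f V" using eq by simp
    then have "connected_component (- \<Union>?P) (h v) (h w)" unfolding f_def v_def by simp
    then obtain T where T: "connected T" "T \<subseteq> - \<Union>?P" "h v \<in> T" "h w \<in> T"
      unfolding connected_component_def by blast
    have "connected (k ` T)" using T ck by (intro connected_continuous_image) (auto intro: continuous_on_subset)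
    moreover have "k ` T \<subseteq> S2 - \<Union>\<A>"
    proof
      fix x assume "x \<in> k ` T"
      then obtain z where z: "z \<in> T" "x = k z" by auto
      have "x \<in> S2" using kim z by auto
      moreover have "x \<notin> \<Union>\<A>"
      proof
        assume "x \<in> \<Union>\<A>"
        then have "h x \<in> \<Union>?P" by auto
        then show False using T(2) z hk' by auto
      qed
      ultimately show "x \<in> S2 - \<Union>\<A>" by auto
    qed
    moreover have "v \<in> k ` T" "w \<in> k ` T" using T(3,4) kh[OF vs(1)] kh[OF vs(3)] by (metis image_eqI)+
    ultimately have "connected_component (S2 - \<Union>\<A>) v w" unfolding connected_component_def by blast
    then have "w \<in> V" using component_closed[of V _ v w] V v by blast
    then show "V = W" using components_eq[of V _ W] V W v by blast
  qed
  moreover have "f ` ?V \<subseteq> components (- \<Union>?P)"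
  proof
    fix X assume "X \<in> f ` ?V"
    then obtain V where V: "V \<in> components (S2 - \<Union>\<A>)" "p \<notin> V" "X = f V" by auto
    have "(SOME v. v \<in> V) \<in> S2 - {p}" "(SOME v. v \<in> V) \<notin> \<Union>\<A>"
      using some[OF V(1)] V(2) in_components_subset[OF V(1)] by auto
    from img[OF this] show "X \<in> components (- \<Union>?P)" unfolding V(3) f_def by (rule componentsI)
  qed
  ultimately have "finite ?V" using fin by (meson finite_imageD finite_subset)
  moreover have "components (S2 - \<Union>\<A>) \<subseteq> ?V \<union> {connected_component_set (S2 - \<Union>\<A>) p}"
  proof
    fix V assume V: "V \<in> components (S2 - \<Union>\<A>)"
    show "V \<in> ?V \<union> {connected_component_set (S2 - \<Union>\<A>) p}"
    proof (cases "p \<in> V")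
      case True
      obtain x where "V = connected_component_set (S2 - \<Union>\<A>) x" using V by (auto simp: components_def)
      then have "V = connected_component_set (S2 - \<Union>\<A>) p" using True connected_component_eq by metis
      then show ?thesis by auto
    qed (use V in auto)
  qed
  ultimately show ?thesis
    using finite_subset[of _ "?V \<union> {connected_component_set (S2 - \<Union>\<A>) p}"] by blast
next
  case True
  show ?thesis unfolding True by simp
qed

text \<open>If both pieces of \<open>Q\<close> lay on the same side of \<open>P\<close>, then
  \<open>Q\<close> would miss the other side. This is how \<open>crossing\<close> is put to
  use.\<close>

lemma opposite_sides:
  assumes P: "pseudocircle P" and meets: "\<And>K. K \<in> components (S2 - P) \<Longrightarrow> Q \<inter> K \<noteq> {}"
    and Q: "Q - P = A \<union> B" "Q \<subseteq> S2" "connected A" "connected B" "a \<in> A" "b \<in> B"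
  shows "\<not> connected_component (S2 - P) a b"
proof
  assume ab: "connected_component (S2 - P) a b"
  obtain I J where IJ: "components (S2 - P) = {I, J}" "I \<noteq> J"
    using Jordan_curve_S2[OF P] by metis
  define X where "X = connected_component_set (S2 - P) a"
  have ABs: "A \<subseteq> S2 - P" "B \<subseteq> S2 - P" using Q(1,2) by auto
  have X: "X \<in> components (S2 - P)" unfolding X_def using ABs Q(5) by (intro componentsI) auto
  have "a \<in> X" "b \<in> X" using ab ABs Q(5) by (auto simp: X_def connected_component_refl)
  then have "A \<subseteq> X" "B \<subseteq> X" using components_maximal[OF X] Q(3-6) ABs by blast+
  obtain Y where Y: "Y \<in> components (S2 - P)" "Y \<noteq> X" using IJ by blast
  have "Q \<inter> Y \<subseteq> X" using in_components_subset[OF Y(1)] Q(1) \<open>A \<subseteq> X\<close> \<open>B \<subseteq> X\<close> by blast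
  then have "X \<inter> Y \<noteq> {}" using meets[OF Y(1)] by blast
  then show False using components_eq[OF X Y(1)] Y(2) by blast
qed

lemma loop_inj:
  assumes "simple_path c" "pathfinish c = pathstart c"
  shows "inj_on c {0..<1}"
proof (rule inj_onI)
  fix s t assume st: "s \<in> {0..<1::real}" "t \<in> {0..<1}" "c s = c t"
  then have "s \<in> {0..1}" "t \<in> {0..1}" by auto
  then have "s = t \<or> s = 0 \<and> t = 1 \<or> s = 1 \<and> t = 0"
    using assms(1) st(3) unfolding simple_path_def loop_free_def by blast
  then show "s = t" using st by auto
qed

lemma loop_image:
  assumes "pathfinish c = pathstart c"
  shows "path_image c = c ` {0..<1}"
proof -
  have "{0..1} = {0..<1} \<union> {1::real}" by auto
  moreover have "c 1 = c 0" using assms by (simp add: pathfinish_def pathstart_def)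
  ultimately show ?thesis unfolding path_image_def by (auto simp: image_iff intro!: bexI[of _ 0])
qed

lemma path_piece_connected:
  assumes "path c" "connected S" "S \<subseteq> {0..1}" shows "connected (c ` S)"
  using assms by (intro connected_continuous_image) (auto simp: path_def intro: continuous_on_subset)

text \<open>The two intervals are joined at the base point \<open>c 0 = c 1\<close>; for
  \<open>\<alpha> = 0\<close> the first one is empty.\<close>

lemma loop_outer_connected:
  assumes "simple_path c" "pathfinish c = pathstart c" "0 \<le> \<alpha>" "\<alpha> < \<beta>" "\<beta> < 1"
  shows "connected (c ` ({0..<\<alpha>} \<union> {\<beta><..<1}))"
proof (cases "\<alpha> = 0")
  case True
  then show ?thesis using assms by (simp, intro path_piece_connected) (auto simp: simple_path_def)
next
  case False
  have c01: "c 1 = c 0" using assms by (simp add: pathfinish_def pathstart_def)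
  have "c ` ({0..<\<alpha>} \<union> {\<beta><..<1}) = c ` {0..<\<alpha>} \<union> c ` {\<beta><..1}"
  proof -
    have "{\<beta><..1} = {\<beta><..<1} \<union> {1}" using assms by auto
    moreover have "c 1 \<in> c ` {0..<\<alpha>}" using c01 False assms by (auto intro!: image_eqI[of _ _ 0])
    ultimately show ?thesis by (auto simp: image_Un)
  qed
  moreover have "connected (c ` {0..<\<alpha>} \<union> c ` {\<beta><..1})"
  proof (rule connected_Un)
    show "connected (c ` {0..<\<alpha>})" "connected (c ` {\<beta><..1})"
      using assms by (intro path_piece_connected; auto simp: simple_path_def)+
    have "c 0 \<in> c ` {0..<\<alpha>}" "c 0 \<in> c ` {\<beta><..1}" using c01 False assms by (auto intro!: image_eqI[of _ _ 0] image_eqI[of _ _ 1])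
    then show "c ` {0..<\<alpha>} \<inter> c ` {\<beta><..1} \<noteq> {}" by auto
  qed
  ultimately show ?thesis by simp
qed

section \<open>Chords of one side of a closed curve\<close>

text \<open>\<open>K\<close> and \<open>K'\<close> are the two sides of the closed curve \<open>c\<close>. A pseudocircle \<open>P\<close> is cut by \<open>c\<close>,
  at the parameters \<open>\<alpha> P < \<beta> P\<close>, into a chord \<open>g P\<close> of \<open>K\<close> and a chord \<open>g' P\<close> of \<open>K'\<close>.\<close>

locale disk_chords =
  fixes \<A> :: "(real^3) set set" and K K' :: "(real^3) set" and c :: "real \<Rightarrow> real^3"
    and \<alpha> \<beta> :: "(real^3) set \<Rightarrow> real" and g g' :: "(real^3) set \<Rightarrow> real \<Rightarrow> real^3"
  assumes finA: "finite \<A>"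
    and pseudo: "P \<in> \<A> \<Longrightarrow> pseudocircle P"
    and loop: "simple_path c" "pathfinish c = pathstart c" "path_image c \<subseteq> S2"
    and comps: "K \<in> components (S2 - path_image c)" "K' \<in> components (S2 - path_image c)" "K \<noteq> K'"
    and arcs: "P \<in> \<A> \<Longrightarrow> arc (g P)" "P \<in> \<A> \<Longrightarrow> arc (g' P)"
    and params: "P \<in> \<A> \<Longrightarrow> 0 \<le> \<alpha> P" "P \<in> \<A> \<Longrightarrow> \<alpha> P < \<beta> P" "P \<in> \<A> \<Longrightarrow> \<beta> P < 1"
    and ends: "P \<in> \<A> \<Longrightarrow> g P 0 = c (\<alpha> P)" "P \<in> \<A> \<Longrightarrow> g P 1 = c (\<beta> P)"
      "P \<in> \<A> \<Longrightarrow> g' P 0 = c (\<alpha> P)" "P \<in> \<A> \<Longrightarrow> g' P 1 = c (\<beta> P)"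
    and cut: "P \<in> \<A> \<Longrightarrow> P \<inter> path_image c = {c (\<alpha> P), c (\<beta> P)}"
    and whole: "P \<in> \<A> \<Longrightarrow> P = g P ` {0..1} \<union> g' P ` {0..1}"
    and inK: "P \<in> \<A> \<Longrightarrow> g P ` {0<..<1} \<subseteq> K" and inK': "P \<in> \<A> \<Longrightarrow> g' P ` {0<..<1} \<subseteq> K'"
    and cross_c: "P \<in> \<A> \<Longrightarrow> crossing P (path_image c)"
    and cross: "P \<in> \<A> \<Longrightarrow> Q \<in> \<A> \<Longrightarrow> P \<noteq> Q \<Longrightarrow> crossing P Q"
    and two: "P \<in> \<A> \<Longrightarrow> Q \<in> \<A> \<Longrightarrow> P \<noteq> Q \<Longrightarrow> \<exists>x\<in>K. \<exists>y\<in>K'. P \<inter> Q = {x, y}"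
    and simple: "P \<in> \<A> \<Longrightarrow> Q \<in> \<A> \<Longrightarrow> R \<in> \<A> \<Longrightarrow> P \<noteq> Q \<Longrightarrow> Q \<noteq> R \<Longrightarrow> P \<noteq> R \<Longrightarrow> P \<inter> Q \<inter> R = {}"
    and simple_c: "P \<in> \<A> \<Longrightarrow> Q \<in> \<A> \<Longrightarrow> P \<noteq> Q \<Longrightarrow> P \<inter> Q \<inter> path_image c = {}"
begin

lemma KK': "K \<inter> K' = {}"
  using components_eq[OF comps(1,2)] comps(3) by blast

lemma K_c: "K \<inter> path_image c = {}" "K' \<inter> path_image c = {}"
  using in_components_subset[OF comps(1)] in_components_subset[OF comps(2)] by blast+

lemma PS2: "P \<in> \<A> \<Longrightarrow> P \<subseteq> S2"
  using pseudo by (simp add: pseudocircle_def)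

lemma c_in: "0 \<le> t \<Longrightarrow> t \<le> 1 \<Longrightarrow> c t \<in> path_image c"
  by (simp add: path_image_def)

lemma end_in_c: "P \<in> \<A> \<Longrightarrow> c (\<alpha> P) \<in> path_image c" "P \<in> \<A> \<Longrightarrow> c (\<beta> P) \<in> path_image c"
  using c_in[of "\<alpha> P"] c_in[of "\<beta> P"] params[of P] by auto

lemma end_notin_K:
  assumes "P \<in> \<A>" shows "c (\<alpha> P) \<notin> K" "c (\<alpha> P) \<notin> K'" "c (\<beta> P) \<notin> K" "c (\<beta> P) \<notin> K'"
  using end_in_c[OF assms] K_c by auto

lemma c_eq_iff: "0 \<le> s \<Longrightarrow> s < 1 \<Longrightarrow> 0 \<le> t \<Longrightarrow> t < 1 \<Longrightarrow> c s = c t \<longleftrightarrow> s = t"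
  using loop_inj[OF loop(1,2)] by (auto simp: inj_on_def)

lemma g_in:
  assumes "P \<in> \<A>" "0 \<le> t" "t \<le> 1" shows "g P t \<in> P" "g' P t \<in> P"
proof -
  have "g P t \<in> g P ` {0..1} \<union> g' P ` {0..1}" "g' P t \<in> g P ` {0..1} \<union> g' P ` {0..1}"
    using assms by auto
  then show "g P t \<in> P" "g' P t \<in> P" using whole[OF assms(1)] by blast+
qed

lemma g_in_K: "P \<in> \<A> \<Longrightarrow> 0 < t \<Longrightarrow> t < 1 \<Longrightarrow> g P t \<in> K"
  and g'_in_K': "P \<in> \<A> \<Longrightarrow> 0 < t \<Longrightarrow> t < 1 \<Longrightarrow> g' P t \<in> K'"
  using inK[of P] inK'[of P] imageI[of t "{0<..<1}" "g P"] imageI[of t "{0<..<1}" "g' P"] by auto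

lemma g_eq_iff: "P \<in> \<A> \<Longrightarrow> 0 \<le> s \<Longrightarrow> s \<le> 1 \<Longrightarrow> 0 \<le> t \<Longrightarrow> t \<le> 1 \<Longrightarrow> g P s = g P t \<longleftrightarrow> s = t"
  "P \<in> \<A> \<Longrightarrow> 0 \<le> s \<Longrightarrow> s \<le> 1 \<Longrightarrow> 0 \<le> t \<Longrightarrow> t \<le> 1 \<Longrightarrow> g' P s = g' P t \<longleftrightarrow> s = t"
  using arcs[of P] inj_on_eq_iff[of "g P" "{0..1}" s t] inj_on_eq_iff[of "g' P" "{0..1}" s t]
  by (auto simp: arc_def)

lemma param_in_K:
  assumes P: "P \<in> \<A>" and x: "x \<in> P" "x \<in> K"
  shows "\<exists>t. 0 < t \<and> t < 1 \<and> g P t = x"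
proof -
  have nc: "x \<notin> path_image c" using x K_c by auto
  then have ne: "x \<noteq> c (\<alpha> P)" "x \<noteq> c (\<beta> P)" using c_in params[OF P] by auto
  have "x \<in> g P ` {0..1} \<union> g' P ` {0..1}" using whole[OF P] x(1) by blast
  then consider t where "0 \<le> t" "t \<le> 1" "x = g P t" | t where "0 \<le> t" "t \<le> 1" "x = g' P t"
    by auto
  then show ?thesis
  proof cases
    case 1
    then have "t \<noteq> 0" "t \<noteq> 1" using ne ends[OF P] by auto
    then show ?thesis using 1 by (intro exI[of _ t]) auto
  next
    case 2
    then have "t \<noteq> 0" "t \<noteq> 1" using ne ends[OF P] by auto
    then have "x \<in> K'" using 2 g'_in_K'[OF P, of t] by auto
    then show ?thesis using x KK' by auto
  qed
qed

lemma param_in_K':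
  assumes P: "P \<in> \<A>" and x: "x \<in> P" "x \<in> K'"
  shows "\<exists>t. 0 < t \<and> t < 1 \<and> g' P t = x"
proof -
  have nc: "x \<notin> path_image c" using x K_c by auto
  then have ne: "x \<noteq> c (\<alpha> P)" "x \<noteq> c (\<beta> P)" using c_in params[OF P] by auto
  have "x \<in> g P ` {0..1} \<union> g' P ` {0..1}" using whole[OF P] x(1) by blast
  then consider t where "0 \<le> t" "t \<le> 1" "x = g P t" | t where "0 \<le> t" "t \<le> 1" "x = g' P t"
    by auto
  then show ?thesis
  proof cases
    case 2
    then have "t \<noteq> 0" "t \<noteq> 1" using ne ends[OF P] by auto
    then show ?thesis using 2 by (intro exI[of _ t]) auto
  next
    case 1
    then have "t \<noteq> 0" "t \<noteq> 1" using ne ends[OF P] by auto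
    then have "x \<in> K" using 1 g_in_K[OF P, of t] by auto
    then show ?thesis using x KK' by auto
  qed
qed

section \<open>Crossing points in \<open>K\<close> and their order along the chords\<close>

definition v :: "(real^3) set \<Rightarrow> (real^3) set \<Rightarrow> real^3" where
  "v P Q = (THE x. x \<in> P \<and> x \<in> Q \<and> x \<in> K)"

definition \<tau> :: "(real^3) set \<Rightarrow> (real^3) set \<Rightarrow> real" where
  "\<tau> P Q = (THE t. 0 < t \<and> t < 1 \<and> g P t = v P Q)"

lemma v_sym: "v P Q = v Q P"
  unfolding v_def by (rule arg_cong[of _ _ The], rule ext, blast)

lemma v_iff:
  assumes "P \<in> \<A>" "Q \<in> \<A>" "P \<noteq> Q"
  shows "x \<in> P \<and> x \<in> Q \<and> x \<in> K \<longleftrightarrow> x = v P Q"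
proof -
  obtain a b where ab: "a \<in> K" "b \<in> K'" "P \<inter> Q = {a, b}" using two[OF assms] by blast
  have "x \<in> P \<and> x \<in> Q \<and> x \<in> K \<longleftrightarrow> x = a" for x
    using ab KK' by blast
  then show ?thesis unfolding v_def by simp
qed

lemma v_in: "P \<in> \<A> \<Longrightarrow> Q \<in> \<A> \<Longrightarrow> P \<noteq> Q \<Longrightarrow> v P Q \<in> P \<and> v P Q \<in> Q \<and> v P Q \<in> K"
  using v_iff by blast

lemma tau:
  assumes "P \<in> \<A>" "Q \<in> \<A>" "P \<noteq> Q"
  shows "0 < \<tau> P Q" "\<tau> P Q < 1" "g P (\<tau> P Q) = v P Q"
proof -
  obtain t where t: "0 < t \<and> t < 1 \<and> g P t = v P Q" using param_in_K[of P "v P Q"] v_in[OF assms] assms by blast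
  then have "s = t" if "0 < s \<and> s < 1 \<and> g P s = v P Q" for s
    using g_eq_iff(1)[OF assms(1), of s t] that by auto
  then have "0 < \<tau> P Q \<and> \<tau> P Q < 1 \<and> g P (\<tau> P Q) = v P Q"
    unfolding \<tau>_def by (rule theI[where P = "\<lambda>t. 0 < t \<and> t < 1 \<and> g P t = v P Q", OF t])
  then show "0 < \<tau> P Q" "\<tau> P Q < 1" "g P (\<tau> P Q) = v P Q" by auto
qed

lemma v_eq_iff:
  assumes "P \<in> \<A>" "Q \<in> \<A>" "R \<in> \<A>" "P \<noteq> Q" "P \<noteq> R"
  shows "v P Q = v P R \<longleftrightarrow> Q = R"
proof
  assume "v P Q = v P R"
  then have "v P Q \<in> P \<inter> Q \<inter> R" using v_in[OF assms(1,2,4)] v_in[OF assms(1,3,5)] by simp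
  then show "Q = R" using simple[OF assms(1,2,3,4) _ assms(5)] by (metis empty_iff)
qed simp

lemma tau_eq_iff:
  assumes "P \<in> \<A>" "Q \<in> \<A>" "R \<in> \<A>" "P \<noteq> Q" "P \<noteq> R"
  shows "\<tau> P Q = \<tau> P R \<longleftrightarrow> Q = R"
proof
  assume "\<tau> P Q = \<tau> P R"
  then have "v P Q = v P R" using tau(3)[OF assms(1,2,4)] tau(3)[OF assms(1,3,5)] by simp
  then show "Q = R" using v_eq_iff[OF assms] by simp
qed simp

lemma path_g: "P \<in> \<A> \<Longrightarrow> path (g P)" "P \<in> \<A> \<Longrightarrow> path (g' P)"
  using arcs by (auto simp: arc_def)

lemma g_in_Q:
  assumes "P \<in> \<A>" "Q \<in> \<A>" "P \<noteq> Q" "0 \<le> t" "t \<le> 1"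
  shows "g P t \<in> Q \<longleftrightarrow> t = \<tau> P Q"
proof
  assume gq: "g P t \<in> Q"
  have gp: "g P t \<in> P" using g_in(1)[OF assms(1,4,5)] .
  then have nc: "g P t \<notin> path_image c" using gq simple_c[OF assms(1-3)] by blast
  have "t \<noteq> 0" "t \<noteq> 1" using nc ends[OF assms(1)] params[OF assms(1)] c_in by auto
  then have "g P t \<in> K" using g_in_K[OF assms(1), of t] assms(4,5) by simp
  then have "g P t = v P Q" using v_iff[OF assms(1-3)] gp gq by blast
  then show "t = \<tau> P Q" using tau[OF assms(1-3)] g_eq_iff(1)[OF assms(1), of t "\<tau> P Q"] assms(4,5) by simp
qed (use tau[OF assms(1-3)] v_in[OF assms(1-3)] in auto)

text \<open>The two crossings with \<open>P\<close> lie on different sides of \<open>c\<close>,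
  hence on different chords of \<open>Q\<close>. So they cut \<open>Q\<close> into two arcs,
  \<open>A\<close> through the common start of its chords and \<open>B\<close> through their common
  end, and \<open>opposite_sides\<close> applies.\<close>

lemma ends_separated:
  assumes PQ: "P \<in> \<A>" "Q \<in> \<A>" "P \<noteq> Q"
  shows "\<not> connected_component (S2 - P) (c (\<alpha> Q)) (c (\<beta> Q))"
proof -
  obtain y where y: "y \<in> K'" "P \<inter> Q = {v P Q, y}"
  proof -
    obtain a b where ab: "a \<in> K" "b \<in> K'" "P \<inter> Q = {a, b}" using two[OF PQ] by blast
    then have "a = v P Q" using v_iff[OF PQ, of a] by blast
    then show ?thesis using that ab by blast
  qed
  then obtain t where t: "0 < t" "t < 1" "g' Q t = y" using param_in_K'[of Q y] PQ by blast
  define s where "s = \<tau> Q P"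
  have s: "0 < s" "s < 1" "g Q s = v P Q" using tau[of Q P] PQ v_sym[of P Q] by (auto simp: s_def)
  define A where "A = g Q ` {0..<s} \<union> g' Q ` {0..<t}"
  define B where "B = g Q ` {s<..1} \<union> g' Q ` {t<..1}"
  have cA: "connected A" unfolding A_def
  proof (rule connected_Un)
    have "c (\<alpha> Q) \<in> g Q ` {0..<s}" "c (\<alpha> Q) \<in> g' Q ` {0..<t}"
      using ends[OF PQ(2)] s t by (auto intro!: image_eqI[of _ _ 0])
    then show "g Q ` {0..<s} \<inter> g' Q ` {0..<t} \<noteq> {}" by blast
  qed (use path_g[OF PQ(2)] s t in \<open>auto intro!: path_piece_connected\<close>)
  have cB: "connected B" unfolding B_def
  proof (rule connected_Un)
    have "c (\<beta> Q) \<in> g Q ` {s<..1}" "c (\<beta> Q) \<in> g' Q ` {t<..1}"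
      using ends[OF PQ(2)] s t by (auto intro!: image_eqI[of _ _ 1])
    then show "g Q ` {s<..1} \<inter> g' Q ` {t<..1} \<noteq> {}" by blast
  qed (use path_g[OF PQ(2)] s t in \<open>auto intro!: path_piece_connected\<close>)
  have iv: "{0..1} = {0..<r} \<union> {r} \<union> {r<..1}" if "0 < r" "r < 1" for r :: real using that by auto
  have "g Q ` {0..1} = g Q ` {0..<s} \<union> {v P Q} \<union> g Q ` {s<..1}"
    unfolding iv[OF s(1,2)] image_Un by (simp add: s(3))
  moreover have "g' Q ` {0..1} = g' Q ` {0..<t} \<union> {y} \<union> g' Q ` {t<..1}"
    unfolding iv[OF t(1,2)] image_Un by (simp add: t(3))
  ultimately have "g Q ` {0..1} \<union> g' Q ` {0..1} = A \<union> B \<union> {v P Q, y}" unfolding A_def B_def by auto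
  then have "Q = A \<union> B \<union> {v P Q, y}" by (rule trans[OF whole[OF PQ(2)]])
  moreover have "v P Q \<noteq> y" using v_in[OF PQ] y KK' by auto
  moreover have AB: "z \<noteq> v P Q \<and> z \<noteq> y" if z: "z \<in> A \<union> B" for z
  proof -
    consider r where "r \<in> {0..<s} \<union> {s<..1}" "z = g Q r" | r where "r \<in> {0..<t} \<union> {t<..1}" "z = g' Q r"
      using z unfolding A_def B_def by blast
    then show ?thesis
    proof cases
      case 1
      then have r: "0 \<le> r" "r \<le> 1" "r \<noteq> s" using s by auto
      have "z \<noteq> y"
      proof
        assume "z = y"
        then have "r \<noteq> 0" "r \<noteq> 1" using 1 y ends[OF PQ(2)] end_notin_K[OF PQ(2)] by auto
        then have "y \<in> K" using g_in_K[OF PQ(2), of r] 1 r \<open>z = y\<close> by simp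
        then show False using y KK' by auto
      qed
      then show ?thesis using g_eq_iff(1)[OF PQ(2), of r s] r s 1 by simp
    next
      case 2
      then have r: "0 \<le> r" "r \<le> 1" "r \<noteq> t" using t by auto
      have vK: "v P Q \<in> K" using v_in[OF PQ] by simp
      have "z \<noteq> v P Q"
      proof
        assume "z = v P Q"
        then have "r \<noteq> 0" "r \<noteq> 1" using 2 vK ends[OF PQ(2)] end_notin_K[OF PQ(2)] by auto
        then have "v P Q \<in> K'" using g'_in_K'[OF PQ(2), of r] 2 r \<open>z = v P Q\<close> by simp
        then show False using vK KK' by auto
      qed
      then show ?thesis using g_eq_iff(2)[OF PQ(2), of r t] r t 2 by simp
    qed
  qed
  ultimately have QP: "Q - P = A \<union> B" using y by blast
  have "g Q 0 \<in> A" "g Q 1 \<in> B" unfolding A_def B_def using s by auto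
  then have "c (\<alpha> Q) \<in> A" "c (\<beta> Q) \<in> B" using ends[OF PQ(2)] by simp_all
  then show ?thesis
    using opposite_sides[OF pseudo[OF PQ(1)] _ QP PS2[OF PQ(2)] cA cB] cross[OF PQ]
    unfolding crossing_def by blast
qed

definition inner :: "(real^3) set \<Rightarrow> real \<Rightarrow> bool" where
  "inner P t \<longleftrightarrow> \<alpha> P < t \<and> t < \<beta> P"

text \<open>Here \<open>c\<close> is the curve that is cut: \<open>P\<close> divides it into two
  arcs on opposite sides of \<open>P\<close>, so the parameter of a point of \<open>c\<close>
  reveals its side.\<close>

lemma c_sides:
  assumes P: "P \<in> \<A>" and st: "0 \<le> s" "s < 1" "0 \<le> t" "t < 1" "c s \<notin> P" "c t \<notin> P"
  shows "connected_component (S2 - P) (c s) (c t) \<longleftrightarrow> (inner P s \<longleftrightarrow> inner P t)"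
proof -
  note p = params[OF P]
  define A where "A = c ` {\<alpha> P<..<\<beta> P}"
  define B where "B = c ` ({0..<\<alpha> P} \<union> {\<beta> P<..<1})"
  have cA: "connected A" unfolding A_def using loop p by (intro path_piece_connected) (auto simp: simple_path_def)
  have cB: "connected B" unfolding B_def using loop p by (intro loop_outer_connected) auto
  have iff: "c r \<in> A \<longleftrightarrow> inner P r" "c r \<in> B \<longleftrightarrow> \<not> inner P r" if r: "0 \<le> r" "r < 1" "c r \<notin> P" for r
  proof -
    have ne: "r \<noteq> \<alpha> P" "r \<noteq> \<beta> P" using r(3) cut[OF P] by auto
    show "c r \<in> A \<longleftrightarrow> inner P r" unfolding A_def inner_def using r p c_eq_iff[of r] by (auto simp: image_iff)
    have "c r \<in> B \<longleftrightarrow> (\<exists>x\<in>{0..<\<alpha> P} \<union> {\<beta> P<..<1}. c r = c x)" unfolding B_def by (simp add: image_iff)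
    also have "\<dots> \<longleftrightarrow> (\<exists>x\<in>{0..<\<alpha> P} \<union> {\<beta> P<..<1}. r = x)"
      using r p by (intro bex_cong refl c_eq_iff) auto
    finally have "c r \<in> B \<longleftrightarrow> r < \<alpha> P \<or> \<beta> P < r" using r by auto
    then show "c r \<in> B \<longleftrightarrow> \<not> inner P r" unfolding inner_def using ne by auto
  qed
  have "path_image c - P = A \<union> B"
  proof (intro equalityI subsetI)
    fix x assume x: "x \<in> path_image c - P"
    then obtain r where "0 \<le> r" "r < 1" "x = c r" unfolding loop_image[OF loop(2)] by auto
    then show "x \<in> A \<union> B" using iff[of r] x by auto
  next
    fix x assume "x \<in> A \<union> B"
    then obtain r where r0: "r \<in> {\<alpha> P<..<\<beta> P} \<union> {0..<\<alpha> P} \<union> {\<beta> P<..<1}" "x = c r"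
      unfolding A_def B_def by blast
    then have r: "0 \<le> r" "r < 1" "x = c r" "r \<noteq> \<alpha> P" "r \<noteq> \<beta> P" using p by auto
    then have "x \<noteq> c (\<alpha> P)" "x \<noteq> c (\<beta> P)" using c_eq_iff[of r] p by auto
    moreover have "x \<in> path_image c" using c_in[of r] r by simp
    ultimately show "x \<in> path_image c - P" using cut[OF P] by blast
  qed
  note QP = this
  have opp: "\<not> connected_component (S2 - P) a b" if "a \<in> A" "b \<in> B" for a b
    using opposite_sides[OF pseudo[OF P] _ QP loop(3) cA cB that] cross_c[OF P]
    unfolding crossing_def by blast
  have sub: "A \<subseteq> S2 - P" "B \<subseteq> S2 - P" using QP loop(3) by blast+
  have same: "connected_component (S2 - P) a b" if "a \<in> A \<and> b \<in> A \<or> a \<in> B \<and> b \<in> B" for a b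
    using that sub cA cB unfolding connected_component_def by blast
  show ?thesis
    using iff[of s] iff[of t] st opp[of "c s" "c t"] opp[of "c t" "c s"] same[of "c s" "c t"]
      connected_component_sym_eq[of "S2 - P" "c s" "c t"] by blast
qed

lemma end_notin:
  assumes "P \<in> \<A>" "Q \<in> \<A>" "P \<noteq> Q"
  shows "c (\<alpha> Q) \<notin> P" "c (\<beta> Q) \<notin> P"
  using simple_c[OF assms] cut[OF assms(2)] by blast+

lemma interleaved:
  assumes PQ: "P \<in> \<A>" "Q \<in> \<A>" "P \<noteq> Q"
  shows "inner P (\<alpha> Q) \<longleftrightarrow> \<not> inner P (\<beta> Q)"
  using ends_separated[OF PQ] c_sides[OF PQ(1), of "\<alpha> Q" "\<beta> Q"] params[OF PQ(2)] end_notin[OF PQ] by auto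

lemma alpha_neq:
  assumes PQ: "P \<in> \<A>" "Q \<in> \<A>" "P \<noteq> Q" shows "\<alpha> P \<noteq> \<alpha> Q"
proof
  assume eq: "\<alpha> P = \<alpha> Q"
  have "c (\<alpha> P) \<in> P" using cut[OF PQ(1)] by blast
  then show False using end_notin(1)[OF PQ] eq by simp
qed

text \<open>By \<open>interleaved\<close> exactly one end of \<open>Q\<close> lies between the ends
  of \<open>P\<close>, and \<open>\<alpha> Q < \<beta> Q\<close>. So the order of the starts alone
  decides which one it is.\<close>

lemma inner_alpha:
  assumes PQ: "P \<in> \<A>" "Q \<in> \<A>" "P \<noteq> Q" shows "inner P (\<alpha> Q) \<longleftrightarrow> \<alpha> P < \<alpha> Q"
  using interleaved[OF PQ] params[OF PQ(2)] alpha_neq[OF PQ] unfolding inner_def by auto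

lemma side_along:
  assumes PQ: "P \<in> \<A>" "Q \<in> \<A>" "P \<noteq> Q" and t: "0 \<le> t" "t \<le> 1"
  shows "t < \<tau> Q P \<Longrightarrow> connected_component (S2 - P) (g Q t) (c (\<alpha> Q))"
    "\<tau> Q P < t \<Longrightarrow> connected_component (S2 - P) (g Q t) (c (\<beta> Q))"
proof -
  have QP: "Q \<noteq> P" using PQ by auto
  note ta = tau[OF PQ(2,1) QP]
  have out: "g Q r \<in> S2 - P" if "0 \<le> r" "r \<le> 1" "r \<noteq> \<tau> Q P" for r
    using g_in_Q[OF PQ(2,1) QP that(1,2)] that g_in(1)[OF PQ(2)] PS2[OF PQ(2)] by blast
  show "connected_component (S2 - P) (g Q t) (c (\<alpha> Q))" if "t < \<tau> Q P"
    unfolding connected_component_def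
  proof (intro exI[of _ "g Q ` {0..t}"] conjI)
    show "connected (g Q ` {0..t})" using path_g[OF PQ(2)] t by (intro path_piece_connected) auto
    show "g Q ` {0..t} \<subseteq> S2 - P" using out that t by force
    show "g Q t \<in> g Q ` {0..t}" using t by auto
    show "c (\<alpha> Q) \<in> g Q ` {0..t}" using t ends[OF PQ(2)] by (auto intro!: image_eqI[of _ _ 0])
  qed
  show "connected_component (S2 - P) (g Q t) (c (\<beta> Q))" if "\<tau> Q P < t"
    unfolding connected_component_def
  proof (intro exI[of _ "g Q ` {t..1}"] conjI)
    show "connected (g Q ` {t..1})" using path_g[OF PQ(2)] t by (intro path_piece_connected) auto
    show "g Q ` {t..1} \<subseteq> S2 - P" using out that t by force
    show "g Q t \<in> g Q ` {t..1}" using t by auto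
    show "c (\<beta> Q) \<in> g Q ` {t..1}" using t ends[OF PQ(2)] by (auto intro!: image_eqI[of _ _ 1])
  qed
qed

text \<open>Within its chord, \<open>Q\<close> changes the side of \<open>P\<close> only at
  \<open>\<tau> Q P\<close>. The order of two crossings along \<open>Q\<close> thus becomes a
  question about the side of \<open>P\<close> that contains \<open>v Q R\<close>.\<close>

lemma side_crossing:
  assumes A: "P \<in> \<A>" "Q \<in> \<A>" "R \<in> \<A>" and ne: "P \<noteq> Q" "P \<noteq> R" "Q \<noteq> R"
  shows "\<tau> Q R < \<tau> Q P \<longleftrightarrow> connected_component (S2 - P) (v Q R) (c (\<alpha> Q))"
proof -
  note t = tau[OF A(2,3) ne(3)]
  have "\<tau> Q R \<noteq> \<tau> Q P" using tau_eq_iff[OF A(2,3,1) ne(3) ne(1)[symmetric]] ne(2) by blast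
  moreover have False if "connected_component (S2 - P) (v Q R) (c (\<alpha> Q))" "connected_component (S2 - P) (v Q R) (c (\<beta> Q))"
    using that ends_separated[OF A(1,2) ne(1)] by (meson connected_component_trans connected_component_sym)
  ultimately show ?thesis using side_along[OF A(1,2) ne(1), of "\<tau> Q R"] t
    by (metis less_imp_le linorder_neqE_linordered_idom order_less_asym)
qed

text \<open>Both comparisons ask for the side of \<open>P\<close> that contains the one point
  \<open>v Q R = v R Q\<close>, and the starts of \<open>Q\<close> and \<open>R\<close> lie on the
  same side.\<close>

lemma same_order:
  assumes A: "P \<in> \<A>" "Q \<in> \<A>" "R \<in> \<A>" and ne: "P \<noteq> Q" "P \<noteq> R" "Q \<noteq> R"
    and side: "\<alpha> P < \<alpha> Q \<longleftrightarrow> \<alpha> P < \<alpha> R"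
  shows "\<tau> Q R < \<tau> Q P \<longleftrightarrow> \<tau> R Q < \<tau> R P"
proof -
  have "connected_component (S2 - P) (c (\<alpha> Q)) (c (\<alpha> R))"
    using c_sides[OF A(1), of "\<alpha> Q" "\<alpha> R"] params[OF A(2)] params[OF A(3)] side
      inner_alpha[OF A(1,2) ne(1)] inner_alpha[OF A(1,3) ne(2)]
      end_notin[OF A(1,2) ne(1)] end_notin[OF A(1,3) ne(2)] by simp
  then have "connected_component (S2 - P) (v Q R) (c (\<alpha> Q)) \<longleftrightarrow> connected_component (S2 - P) (v R Q) (c (\<alpha> R))"
    unfolding v_sym[of R Q] by (meson connected_component_trans connected_component_sym)
  then show ?thesis
    using side_crossing[OF A ne] side_crossing[OF A(1,3,2) ne(2,1) ne(3)[symmetric]] by simp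
qed

end

section \<open>From empty triples to triangular faces\<close>

context disk_chords
begin

definition seg :: "(real^3) set \<Rightarrow> (real^3) set \<Rightarrow> (real^3) set \<Rightarrow> (real^3) set" where
  "seg P Q R = g P ` closed_segment (\<tau> P Q) (\<tau> P R)"

definition adj :: "(real^3) set \<Rightarrow> (real^3) set \<Rightarrow> (real^3) set \<Rightarrow> bool" where
  "adj P Q R \<longleftrightarrow> (\<forall>S\<in>\<A>. S \<noteq> P \<longrightarrow>
     \<not> (\<tau> P Q < \<tau> P S \<and> \<tau> P S < \<tau> P R) \<and> \<not> (\<tau> P R < \<tau> P S \<and> \<tau> P S < \<tau> P Q))"

lemma seg_commute: "seg P Q R = seg P R Q"
  by (simp add: seg_def closed_segment_commute)

lemma seg_param:
  assumes "P \<in> \<A>" "Q \<in> \<A>" "R \<in> \<A>" "P \<noteq> Q" "P \<noteq> R" "t \<in> closed_segment (\<tau> P Q) (\<tau> P R)"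
  shows "0 < t" "t < 1"
proof -
  have "closed_segment (\<tau> P Q) (\<tau> P R) \<subseteq> {0<..<1}"
    using tau[OF assms(1,2,4)] tau[OF assms(1,3,5)] by (intro closed_segment_subset) auto
  then show "0 < t" "t < 1" using assms(6) by auto
qed

lemma seg_in:
  assumes "P \<in> \<A>" "Q \<in> \<A>" "R \<in> \<A>" "P \<noteq> Q" "P \<noteq> R"
  shows "seg P Q R \<subseteq> P" "seg P Q R \<subseteq> K"
proof -
  have "g P t \<in> P \<and> g P t \<in> K" if "t \<in> closed_segment (\<tau> P Q) (\<tau> P R)" for t
    using seg_param[OF assms that] g_in(1)[OF assms(1), of t] g_in_K[OF assms(1), of t] by auto
  then show "seg P Q R \<subseteq> P" "seg P Q R \<subseteq> K" unfolding seg_def by auto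
qed

lemma v_in_seg:
  assumes "P \<in> \<A>" "Q \<in> \<A>" "R \<in> \<A>" "P \<noteq> Q" "P \<noteq> R"
  shows "v P Q \<in> seg P Q R" "v P R \<in> seg P Q R"
  unfolding seg_def tau(3)[OF assms(1,2,4), symmetric] tau(3)[OF assms(1,3,5), symmetric] by auto

lemma seg_hit:
  assumes A: "P \<in> \<A>" "Q \<in> \<A>" "R \<in> \<A>" "P \<noteq> Q" "P \<noteq> R" "adj P Q R"
    and S: "S \<in> \<A>" "S \<noteq> P" "x \<in> S" "x \<in> seg P Q R"
  shows "x = v P S" "S = Q \<or> S = R"
proof -
  have PS: "P \<noteq> S" using S by simp
  obtain t where t: "t \<in> closed_segment (\<tau> P Q) (\<tau> P R)" "x = g P t" using S(4) by (auto simp: seg_def)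
  have t01: "0 < t" "t < 1" using seg_param[OF A(1-5) t(1)] by auto
  have "t = \<tau> P S" using g_in_Q[OF A(1) S(1) PS, of t] S(3) t t01 by simp
  then show "x = v P S" using tau(3)[OF A(1) S(1) PS] t by simp
  have "t = \<tau> P Q \<or> t = \<tau> P R"
  proof (rule ccontr)
    assume "\<not> ?thesis"
    then have "\<tau> P Q < t \<and> t < \<tau> P R \<or> \<tau> P R < t \<and> t < \<tau> P Q"
      using t(1) by (cases "\<tau> P Q \<le> \<tau> P R") (auto simp: closed_segment_eq_real_ivl)
    then show False using A(6) S(1,2) \<open>t = \<tau> P S\<close> unfolding adj_def by blast
  qed
  then show "S = Q \<or> S = R"
    using tau_eq_iff[OF A(1) S(1) A(2) PS A(4)] tau_eq_iff[OF A(1) S(1) A(3) PS A(5)] \<open>t = \<tau> P S\<close> by auto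
qed

text \<open>The two remaining ends of the chord in \<open>K\<close> are joined through the chord in
  \<open>K'\<close>.\<close>

lemma rest_connected:
  assumes P: "P \<in> \<A>" and m: "0 < m" "m \<le> M" "M < 1"
  shows "connected (P - g P ` {m..M})"
proof -
  have "P - g P ` {m..M} = (g P ` {0..<m} \<union> g' P ` {0..1}) \<union> g P ` {M<..1}"
  proof (intro equalityI subsetI)
    fix x assume x: "x \<in> P - g P ` {m..M}"
    then have "x \<in> g P ` {0..1} \<union> g' P ` {0..1}" using whole[OF P] by blast
    moreover have "{0..1} = {0..<m} \<union> {m..M} \<union> {M<..1}" using m by auto
    ultimately show "x \<in> (g P ` {0..<m} \<union> g' P ` {0..1}) \<union> g P ` {M<..1}" using x by (metis DiffD2 UnE UnI1 UnI2 image_Un)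
  next
    fix x assume "x \<in> (g P ` {0..<m} \<union> g' P ` {0..1}) \<union> g P ` {M<..1}"
    then consider r where "r \<in> {0..<m} \<union> {M<..1}" "x = g P r" | r where "r \<in> {0..1}" "x = g' P r" by blast
    then show "x \<in> P - g P ` {m..M}"
    proof cases
      case 1
      then have r: "0 \<le> r" "r \<le> 1" "r \<notin> {m..M}" using m by auto
      have "x \<noteq> g P t" if "t \<in> {m..M}" for t
        using g_eq_iff(1)[OF P, of r t] r that m 1 by auto
      then show ?thesis using g_in(1)[OF P r(1,2)] 1 by blast
    next
      case 2
      have "x \<notin> K"
      proof
        assume xK: "x \<in> K"
        then have "r \<noteq> 0" "r \<noteq> 1" using 2 ends[OF P] end_notin_K[OF P] by auto
        then have "x \<in> K'" using g'_in_K'[OF P, of r] 2 by simp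
        then show False using xK KK' by auto
      qed
      moreover have "g P ` {m..M} \<subseteq> K" using g_in_K[OF P] m by auto
      moreover have "x \<in> P" using g_in(2)[OF P, of r] 2 by simp
      ultimately show ?thesis by blast
    qed
  qed
  moreover have "connected ((g P ` {0..<m} \<union> g' P ` {0..1}) \<union> g P ` {M<..1})"
  proof (intro connected_Un)
    have "g P 0 = g' P 0" "g P 1 = g' P 1" using ends[OF P] by auto
    moreover have "g P 0 \<in> g P ` {0..<m}" "g P 1 \<in> g P ` {M<..1}" "g' P 0 \<in> g' P ` {0..1}" "g' P 1 \<in> g' P ` {0..1}"
      using m by auto
    ultimately show "g P ` {0..<m} \<inter> g' P ` {0..1} \<noteq> {}" "(g P ` {0..<m} \<union> g' P ` {0..1}) \<inter> g P ` {M<..1} \<noteq> {}"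
      by (metis disjoint_iff, metis UnI2 disjoint_iff)
    show "connected (g P ` {0..<m})" "connected (g P ` {M<..1})" "connected (g' P ` {0..1})"
      using path_g[OF P] m by (intro path_piece_connected; auto)+
  qed
  ultimately show ?thesis by simp
qed

lemma seg_rest_connected:
  assumes "P \<in> \<A>" "Q \<in> \<A>" "R \<in> \<A>" "P \<noteq> Q" "P \<noteq> R"
  shows "connected (P - seg P Q R)"
proof -
  have "closed_segment (\<tau> P Q) (\<tau> P R) = {min (\<tau> P Q) (\<tau> P R)..max (\<tau> P Q) (\<tau> P R)}"
    by (simp add: closed_segment_eq_real_ivl min_def max_def)
  then show ?thesis unfolding seg_def
    using rest_connected[OF assms(1), of "min (\<tau> P Q) (\<tau> P R)" "max (\<tau> P Q) (\<tau> P R)"]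
      tau[OF assms(1,2,4)] tau[OF assms(1,3,5)] by auto
qed

lemma seg_arc:
  assumes "P \<in> \<A>" "Q \<in> \<A>" "R \<in> \<A>" "P \<noteq> Q" "P \<noteq> R" "Q \<noteq> R"
  obtains a where "arc a" "pathstart a = v P Q" "pathfinish a = v P R" "path_image a = seg P Q R"
proof
  let ?a = "subpath (\<tau> P Q) (\<tau> P R) (g P)"
  note t = tau[OF assms(1,2,4)] tau[OF assms(1,3,5)]
  have "\<tau> P Q \<noteq> \<tau> P R" using tau_eq_iff[OF assms(1-5)] assms(6) by simp
  then show "arc ?a" using arcs(1)[OF assms(1)] t by (intro arc_subpath_arc) auto
  show "pathstart ?a = v P Q" "pathfinish ?a = v P R" using t by simp_all
  show "path_image ?a = seg P Q R" by (simp add: path_image_subpath_gen seg_def)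
qed

text \<open>The three segments form a closed curve inside \<open>K\<close>. Its side that does not contain \<open>c\<close> is a
  triangle, since everything else in the arrangement is connected to \<open>c\<close> off the closed curve.\<close>

lemma triangle_face:
  assumes A: "P \<in> \<A>" "Q \<in> \<A>" "R \<in> \<A>" and ne: "P \<noteq> Q" "P \<noteq> R" "Q \<noteq> R"
    and ad: "adj P Q R" "adj Q P R" "adj R P Q"
  shows "\<exists>F\<in>triangles \<A>. closure F \<inter> crossings \<A> = {v P Q, v P R, v Q R}"
proof -
  note PQ = A(1,2) ne(1) and PR = A(1,3) ne(2) and QR = A(2,3) ne(3)
  note nes = ne(1)[symmetric] ne(2)[symmetric] ne(3)[symmetric]
  note sP = A(1,2,3) ne(1,2) and sR = A(3,1,2) nes(2,3) and sQ = A(2,1,3) nes(1) ne(3)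
  obtain a1 where a1: "arc a1" "pathstart a1 = v P Q" "pathfinish a1 = v P R" "path_image a1 = seg P Q R"
    using seg_arc[OF sP ne(3)] by metis
  obtain a2 where a2: "arc a2" "pathstart a2 = v R P" "pathfinish a2 = v R Q" "path_image a2 = seg R P Q"
    using seg_arc[OF sR ne(1)] by metis
  obtain a3 where a3: "arc a3" "pathstart a3 = v Q R" "pathfinish a3 = v Q P" "path_image a3 = seg Q R P"
    using seg_arc[OF A(2,3,1) ne(3) nes(1) nes(2)] by metis
  have a3': "path_image a3 = seg Q P R" using a3(4) seg_commute by simp
  note inP = seg_in[OF sP] and inQ = seg_in[OF sQ] and inR = seg_in[OF sR]
  have i12: "path_image a1 \<inter> path_image a2 \<subseteq> {v R P}"
    unfolding a1(4) a2(4) v_sym[of R P] using inP inR v_iff[OF PR] by blast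
  have i13: "path_image a1 \<inter> path_image a3 \<subseteq> {v P Q}"
    unfolding a1(4) a3' using inP inQ v_iff[OF PQ] by blast
  have i23: "path_image a2 \<inter> path_image a3 \<subseteq> {v Q R}"
    unfolding a2(4) a3' using inR inQ v_iff[OF QR] by blast
  have j12: "arc (a1 +++ a2)"
    using a1 a2 i12 v_sym[of R P] by (intro arc_join) auto
  have im12: "path_image (a1 +++ a2) = seg P Q R \<union> seg R P Q"
    using a1 a2 v_sym[of R P] by (simp add: path_image_join)
  define L where "L = (a1 +++ a2) +++ a3"
  have L: "simple_path L" unfolding L_def
  proof (rule simple_path_join_loop[OF j12 a3(1)])
    show "pathfinish (a1 +++ a2) = pathstart a3" "pathfinish a3 = pathstart (a1 +++ a2)"
      using a1 a2 a3 v_sym[of R Q] v_sym[of P Q] by simp_all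
    show "path_image (a1 +++ a2) \<inter> path_image a3 \<subseteq> {pathstart (a1 +++ a2), pathstart a3}"
      using i13 i23 a1 a2 a3 im12 by auto
  qed
  have Lc: "pathfinish L = pathstart L" unfolding L_def using a1 a3 v_sym[of P Q] by simp
  define J where "J = path_image L"
  have J: "J = seg P Q R \<union> seg R P Q \<union> seg Q P R"
    unfolding J_def L_def using a2 a3' im12 a3 v_sym[of R Q] by (simp add: path_image_join)
  have JK: "J \<subseteq> K" unfolding J using inP inQ inR by blast
  have KS: "K \<subseteq> S2" using in_components_subset[OF comps(1)] by blast
  have ps: "pseudocircle J" unfolding J_def using L Lc JK KS by (intro loop_imp_pseudocircle) (auto simp: J_def)
  obtain I0 O0 where IO: "components (S2 - J) = {I0, O0}" "I0 \<noteq> O0" "closure I0 = I0 \<union> J" "closure O0 = O0 \<union> J"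
    using Jordan_curve_S2[OF ps] by metis
  have cJ: "path_image c \<subseteq> S2 - J" using loop(3) JK K_c by blast
  have conc: "connected (path_image c)" using loop(1) by (simp add: connected_simple_path_image)
  have nec: "path_image c \<noteq> {}" by simp
  have "path_image c \<subseteq> \<Union>(components (S2 - J))" using cJ Union_components[of "S2 - J"] by simp
  then have "path_image c \<inter> I0 \<noteq> {} \<or> path_image c \<inter> O0 \<noteq> {}" using nec IO(1) by blast
  then obtain Ou I where OI: "components (S2 - J) = {I, Ou}" "I \<noteq> Ou" "closure I = I \<union> J" "path_image c \<inter> Ou \<noteq> {}"
  proof (elim disjE)
    assume c: "path_image c \<inter> I0 \<noteq> {}"
    have "components (S2 - J) = {O0, I0}" unfolding IO(1) by (rule insert_commute)
    from that[OF this IO(2)[symmetric] IO(4) c] show thesis .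
  next
    assume "path_image c \<inter> O0 \<noteq> {}"
    from that[OF IO(1-3) this] show thesis .
  qed
  have Ouc: "Ou \<in> components (S2 - J)" and Ic: "I \<in> components (S2 - J)" using OI by auto
  have dis: "I \<inter> Ou = {}" using components_eq[OF Ic Ouc] OI(2) by blast
  have cO: "path_image c \<subseteq> Ou" using components_maximal[OF Ouc conc cJ] OI(4) by blast
  have toO: "X \<subseteq> Ou" if X: "connected X" "X \<subseteq> S2 - J" "X \<inter> path_image c \<noteq> {}" for X
    using components_maximal[OF Ouc X(1,2)] X(3) cO by blast
  have rest: "X - Y \<subseteq> Ou" if X: "X \<in> \<A>" "connected (X - Y)" "X \<inter> J \<subseteq> Y" "Y \<subseteq> J" for X Y
  proof (rule toO)
    show "X - Y \<subseteq> S2 - J" using X(3) PS2[OF X(1)] by blast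
    have "c (\<alpha> X) \<in> X" "c (\<alpha> X) \<in> path_image c" using cut[OF X(1)] by blast+
    moreover have "c (\<alpha> X) \<notin> J" using JK end_notin_K[OF X(1)] by blast
    ultimately show "(X - Y) \<inter> path_image c \<noteq> {}" using X(4) by blast
  qed fact
  have hitP: "x = v P S \<and> (S = Q \<or> S = R)" if "S \<in> \<A>" "S \<noteq> P" "x \<in> S" "x \<in> seg P Q R" for S x
    using seg_hit[OF sP ad(1) that] by simp
  have hitQ: "x = v Q S \<and> (S = P \<or> S = R)" if "S \<in> \<A>" "S \<noteq> Q" "x \<in> S" "x \<in> seg Q P R" for S x
    using seg_hit[OF sQ ad(2) that] by simp
  have hitR: "x = v R S \<and> (S = P \<or> S = Q)" if "S \<in> \<A>" "S \<noteq> R" "x \<in> S" "x \<in> seg R P Q" for S x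
    using seg_hit[OF sR ad(3) that] by simp
  note vsP = v_in_seg[OF sP] and vsQ = v_in_seg[OF sQ] and vsR = v_in_seg[OF sR]
  have PJ: "P \<inter> J \<subseteq> seg P Q R" unfolding J
    using hitQ[OF A(1) ne(1)] hitR[OF A(1) ne(2)] vsP v_sym[of P Q] v_sym[of P R] by auto
  have QJ: "Q \<inter> J \<subseteq> seg Q P R" unfolding J
    using hitP[OF A(2) nes(1)] hitR[OF A(2) ne(3)] vsQ v_sym[of P Q] v_sym[of Q R] by auto
  have RJ: "R \<inter> J \<subseteq> seg R P Q" unfolding J
    using hitP[OF A(3) nes(2)] hitQ[OF A(3) nes(3)] vsR v_sym[of P R] v_sym[of Q R] by auto
  have offI: "I \<inter> X = {}" if X: "X \<in> \<A>" for X
  proof -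
    have IJ: "I \<inter> J = {}" using in_components_subset[OF Ic] by blast
    consider "X = P" | "X = Q" | "X = R" | "X \<noteq> P" "X \<noteq> Q" "X \<noteq> R" by blast
    then show ?thesis
    proof cases
      case 1
      have "X - seg P Q R \<subseteq> Ou" using rest[OF X, of "seg P Q R"] seg_rest_connected[OF sP] PJ J 1 by (simp add: le_supI1 le_supI2)
      then show ?thesis using IJ dis J by blast
    next
      case 2
      have "X - seg Q P R \<subseteq> Ou" using rest[OF X, of "seg Q P R"] seg_rest_connected[OF sQ] QJ J 2 by (simp add: le_supI1 le_supI2)
      then show ?thesis using IJ dis J by blast
    next
      case 3
      have "X - seg R P Q \<subseteq> Ou" using rest[OF X, of "seg R P Q"] seg_rest_connected[OF sR] RJ J 3 by (simp add: le_supI1 le_supI2)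
      then show ?thesis using IJ dis J by blast
    next
      case 4
      have "X \<inter> J \<subseteq> {}" unfolding J
        using hitP[OF X 4(1)] hitQ[OF X 4(2)] hitR[OF X 4(3)] 4 by blast
      then have "X - {} \<subseteq> Ou"
        using rest[OF X, of "{}"] pseudocircle_connected[OF pseudo[OF X]] by simp
      then show ?thesis using dis by blast
    qed
  qed
  have JA: "J \<subseteq> \<Union>\<A>" unfolding J
    by (intro Un_least order_trans[OF inP(1)] order_trans[OF inQ(1)] order_trans[OF inR(1)] Union_upper A)
  have IA: "I \<inter> \<Union>\<A> = {}" unfolding Int_Union using offI by simp
  then have "I \<subseteq> S2 - \<Union>\<A>" using in_components_subset[OF Ic] by blast
  moreover have "S2 - \<Union>\<A> \<subseteq> S2 - J" using JA by blast
  ultimately have comp: "I \<in> components (S2 - \<Union>\<A>)" by (rule components_intermediate_subset[OF Ic])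
  have vin: "v X Y \<in> crossings \<A>" if "X \<in> \<A>" "Y \<in> \<A>" "X \<noteq> Y" for X Y
    using v_in[OF that] that unfolding crossings_def by blast
  have crA: "crossings \<A> \<subseteq> \<Union>\<A>" unfolding crossings_def by blast
  have hit: "x \<in> {v P Q, v P R, v Q R}" if x: "x \<in> J" "x \<in> crossings \<A>" for x
  proof -
    obtain S T where ST: "S \<in> \<A>" "T \<in> \<A>" "S \<noteq> T" "x \<in> S" "x \<in> T" using x(2) unfolding crossings_def by blast
    have other: "\<exists>S\<in>\<A>. S \<noteq> X \<and> x \<in> S" for X using ST by metis
    consider "x \<in> seg P Q R" | "x \<in> seg R P Q" | "x \<in> seg Q P R" using x(1) J by blast
    then show ?thesis
    proof cases
      case 1
      obtain S where "S \<in> \<A>" "S \<noteq> P" "x \<in> S" using other by blast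
      from hitP[OF this 1] show ?thesis by auto
    next
      case 2
      obtain S where "S \<in> \<A>" "S \<noteq> R" "x \<in> S" using other by blast
      from hitR[OF this 2] show ?thesis using v_sym[of R] by auto
    next
      case 3
      obtain S where "S \<in> \<A>" "S \<noteq> Q" "x \<in> S" using other by blast
      from hitQ[OF this 3] show ?thesis using v_sym[of Q P] by auto
    qed
  qed
  have cl: "closure I \<inter> crossings \<A> = {v P Q, v P R, v Q R}"
  proof
    have "closure I \<inter> crossings \<A> \<subseteq> J" using OI(3) IA crA by blast
    then show "closure I \<inter> crossings \<A> \<subseteq> {v P Q, v P R, v Q R}" using hit by blast
    have "v P Q \<in> J" "v P R \<in> J" "v Q R \<in> J" using vsP vsQ J by auto
    then show "{v P Q, v P R, v Q R} \<subseteq> closure I \<inter> crossings \<A>"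
      using OI(3) vin[OF PQ] vin[OF PR] vin[OF QR] by auto
  qed
  have "v P Q \<noteq> v P R" using v_eq_iff[OF sP] ne(3) by simp
  moreover have "v P Q \<noteq> v Q R" using v_eq_iff[OF sQ] ne(2) v_sym[of P Q] by simp
  moreover have "v P R \<noteq> v Q R" using v_eq_iff[OF sR] ne(1) v_sym[of P R] v_sym[of Q R] by simp
  ultimately have "card {v P Q, v P R, v Q R} = 3" by simp
  then have "I \<in> triangles \<A>" unfolding triangles_def using comp cl by simp
  then show ?thesis using cl by blast
qed

text \<open>By simplicity no third curve passes through a crossing. The vertices of a triangle
  therefore give back its three curves, and different empty triples give different
  triangles.\<close>

lemma triangle_vertices_determine:
  assumes A: "P \<in> \<A>" "Q \<in> \<A>" "R \<in> \<A>" and ne: "P \<noteq> Q" "P \<noteq> R" "Q \<noteq> R"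
  shows "{S \<in> \<A>. S \<inter> {v P Q, v P R, v Q R} \<noteq> {}} = {P, Q, R}"
proof -
  have two: "S = X \<or> S = Y" if "S \<in> \<A>" "X \<in> \<A>" "Y \<in> \<A>" "X \<noteq> Y" "v X Y \<in> S" for S X Y
  proof (rule ccontr)
    assume "\<not> ?thesis"
    then have "X \<inter> Y \<inter> S = {}" using that by (intro simple) auto
    then show False using v_in[OF that(2-4)] that(5) by blast
  qed
  have "S \<in> {P, Q, R}" if "S \<in> \<A>" "S \<inter> {v P Q, v P R, v Q R} \<noteq> {}" for S
    using that two[OF that(1) A(1,2) ne(1)] two[OF that(1) A(1,3) ne(2)] two[OF that(1) A(2,3) ne(3)] by blast
  moreover have "v P Q \<in> P" "v P Q \<in> Q" "v P R \<in> R"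
    using v_in[OF A(1,2) ne(1)] v_in[OF A(1,3) ne(2)] by auto
  ultimately show ?thesis using A by blast
qed

lemma enumeration:
  obtains e where "bij_betw e {..<card \<A>} \<A>" "\<And>i j. i < j \<Longrightarrow> j < card \<A> \<Longrightarrow> \<alpha> (e i) < \<alpha> (e j)"
proof -
  have inj: "inj_on \<alpha> \<A>" using alpha_neq by (auto intro!: inj_onI)
  define xs where "xs = sorted_list_of_set (\<alpha> ` \<A>)"
  have len: "length xs = card \<A>" unfolding xs_def using card_image[OF inj] by simp
  have set: "set xs = \<alpha> ` \<A>" unfolding xs_def using finA by simp
  have "distinct xs" by (simp add: xs_def)
  then have b1: "bij_betw (\<lambda>i. xs ! i) {..<card \<A>} (\<alpha> ` \<A>)"
    by (rule bij_betw_nth) (simp_all only: len set)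
  have b2: "bij_betw (inv_into \<A> \<alpha>) (\<alpha> ` \<A>) \<A>"
    using inj by (intro bij_betw_inv_into) (simp add: bij_betw_def)
  have al: "\<alpha> (inv_into \<A> \<alpha> (xs ! i)) = xs ! i" if "i < card \<A>" for i
    by (rule f_inv_into_f) (use that nth_mem[of i xs] in \<open>simp only: len set\<close>)
  show ?thesis
  proof
    show "bij_betw (inv_into \<A> \<alpha> \<circ> (\<lambda>i. xs ! i)) {..<card \<A>} \<A>" using b1 b2 by (rule bij_betw_trans)
    fix i j assume "i < j" "j < card \<A>"
    moreover have "sorted_wrt (<) xs" by (simp add: xs_def)
    ultimately have "xs ! i < xs ! j" using sorted_wrt_nth_less[of "(<)" xs i j] by (simp only: len)
    then show "\<alpha> ((inv_into \<A> \<alpha> \<circ> (\<lambda>i. xs ! i)) i) < \<alpha> ((inv_into \<A> \<alpha> \<circ> (\<lambda>i. xs ! i)) j)"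
      using al[of i] al[of j] \<open>i < j\<close> \<open>j < card \<A>\<close> by simp
  qed
qed

text \<open>Without this \<open>card\<close> could be 0, and injecting the empty triples into the
  triangles would bound nothing.\<close>

lemma finite_triangles: "finite (triangles \<A>)"
proof -
  have "finite (components (S2 - \<Union>\<A>))"
  proof (rule finite_faces_S2[OF finA pseudo])
    fix P Q assume "P \<in> \<A>" "Q \<in> \<A>" "P \<noteq> Q"
    then obtain x y where "P \<inter> Q = {x, y}" using two by blast
    then show "finite (P \<inter> Q)" by simp
  qed
  then show ?thesis unfolding triangles_def by simp
qed

theorem card_triangles_in_disk:
  "card \<A> - 2 \<le> card {F \<in> triangles \<A>. closure F \<inter> crossings \<A> \<subseteq> K}"
proof -
  define n where "n = card \<A>"
  obtain e where e: "bij_betw e {..<n} \<A>" and mono: "\<And>i j. i < j \<Longrightarrow> j < n \<Longrightarrow> \<alpha> (e i) < \<alpha> (e j)"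
    using enumeration unfolding n_def by metis
  have eA: "e i \<in> \<A>" if "i < n" for i using bij_betwE[OF e] that by blast
  have einj: "e i = e j \<longleftrightarrow> i = j" if "i < n" "j < n" for i j
    using e that unfolding bij_betw_def inj_on_def by blast
  define \<sigma> where "\<sigma> i j = \<tau> (e i) (e j)" for i j
  interpret chords n \<sigma>
  proof
    show "\<sigma> i j \<noteq> \<sigma> i k" if "i < n" "j < n" "k < n" "i \<noteq> j" "i \<noteq> k" "j \<noteq> k" for i j k
      unfolding \<sigma>_def using tau_eq_iff[of "e i" "e j" "e k"] eA einj that by simp
    note neq = this
    fix i j k assume ijk: "i < j" "j < k" "k < n"
    then have l: "i < n" "j < n" "k < n" by auto
    have A: "e i \<in> \<A>" "e j \<in> \<A>" "e k \<in> \<A>" using eA l by auto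
    have ne: "e i \<noteq> e j" "e i \<noteq> e k" "e j \<noteq> e k" using einj l ijk by auto
    have al: "\<alpha> (e i) < \<alpha> (e j)" "\<alpha> (e i) < \<alpha> (e k)" "\<alpha> (e j) < \<alpha> (e k)" using mono ijk by auto
    \<comment> \<open>Chord \<open>k\<close> starts after both others, so they start on one side of
      it. The next equivalence uses chord \<open>i\<close>, which starts before both. The middle
      chord has the others on different sides.\<close>
    have "\<sigma> i j < \<sigma> i k \<longleftrightarrow> \<sigma> j i < \<sigma> j k" unfolding \<sigma>_def
      using al ne by (intro same_order[OF A(3,1,2)]) auto
    moreover have "\<sigma> j k < \<sigma> j i \<longleftrightarrow> \<sigma> k j < \<sigma> k i" unfolding \<sigma>_def
      using al ne by (intro same_order[OF A(1,2,3)]) auto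
    moreover have "\<sigma> j i \<noteq> \<sigma> j k" "\<sigma> k i \<noteq> \<sigma> k j" using neq[of j i k] neq[of k i j] l ijk by auto
    ultimately show "(\<sigma> i j < \<sigma> i k \<longleftrightarrow> \<sigma> j i < \<sigma> j k) \<and> (\<sigma> j i < \<sigma> j k \<longleftrightarrow> \<sigma> k i < \<sigma> k j)"
      by linarith
  qed
  have adjI: "adj (e i) (e j) (e k)" if "adjacent i j k" "i < n" for i j k
    unfolding adj_def
  proof (intro ballI impI)
    fix S assume S: "S \<in> \<A>" "S \<noteq> e i"
    then obtain m where m: "m < n" "S = e m" using e unfolding bij_betw_def by blast
    then have "m \<noteq> i" using S by auto
    then show "\<not> (\<tau> (e i) (e j) < \<tau> (e i) S \<and> \<tau> (e i) S < \<tau> (e i) (e k)) \<and>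
        \<not> (\<tau> (e i) (e k) < \<tau> (e i) S \<and> \<tau> (e i) S < \<tau> (e i) (e j))"
      using that(1) m unfolding adjacent_def \<sigma>_def by blast
  qed
  let ?T = "{F \<in> triangles \<A>. closure F \<inter> crossings \<A> \<subseteq> K}"
  have "\<forall>S\<in>empty_triples. \<exists>F. F \<in> ?T \<and> e ` S = {P \<in> \<A>. P \<inter> (closure F \<inter> crossings \<A>) \<noteq> {}}"
  proof
    fix S assume S: "S \<in> empty_triples"
    obtain i j k where ijk: "S = {i, j, k}" "i < n" "j < n" "k < n" "i \<noteq> j" "i \<noteq> k" "j \<noteq> k"
      "adjacent i j k" "adjacent j i k" "adjacent k i j" using S unfolding empty_triples_def by blast
    have A: "e i \<in> \<A>" "e j \<in> \<A>" "e k \<in> \<A>" using eA ijk by auto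
    have ne: "e i \<noteq> e j" "e i \<noteq> e k" "e j \<noteq> e k" using einj ijk by auto
    obtain F where F: "F \<in> triangles \<A>" "closure F \<inter> crossings \<A> = {v (e i) (e j), v (e i) (e k), v (e j) (e k)}"
      using triangle_face[OF A ne adjI[OF ijk(8,2)] adjI[OF ijk(9,3)] adjI[OF ijk(10,4)]] by blast
    have "closure F \<inter> crossings \<A> \<subseteq> K"
      unfolding F(2) using v_in[OF A(1,2) ne(1)] v_in[OF A(1,3) ne(2)] v_in[OF A(2,3) ne(3)] by simp
    moreover have "e ` S = {P \<in> \<A>. P \<inter> (closure F \<inter> crossings \<A>) \<noteq> {}}"
      unfolding F(2) triangle_vertices_determine[OF A ne] ijk(1) by simp
    ultimately show "\<exists>F. F \<in> ?T \<and> e ` S = {P \<in> \<A>. P \<inter> (closure F \<inter> crossings \<A>) \<noteq> {}}"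
      using F(1) by (intro exI[of _ F]) simp
  qed
  from bchoice[OF this] obtain f where "\<forall>S\<in>empty_triples.
      f S \<in> ?T \<and> e ` S = {P \<in> \<A>. P \<inter> (closure (f S) \<inter> crossings \<A>) \<noteq> {}}" ..
  note f = this[rule_format]
  have "inj_on f empty_triples"
  proof (rule inj_onI)
    fix S S' assume S: "S \<in> empty_triples" "S' \<in> empty_triples" "f S = f S'"
    have "e ` S = e ` S'" using f[OF S(1)] f[OF S(2)] S(3) by simp
    moreover have "S \<subseteq> {..<n}" "S' \<subseteq> {..<n}" using S(1,2) unfolding empty_triples_def by auto
    moreover have "inj_on e {..<n}" using e by (simp add: bij_betw_def)
    ultimately show "S = S'" using inj_on_image_eq_iff[of e "{..<n}" S S'] by simp
  qed
  moreover have "f ` empty_triples \<subseteq> ?T"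
  proof
    fix F assume "F \<in> f ` empty_triples"
    then show "F \<in> ?T" using f by auto
  qed
  moreover have "finite ?T" using finite_triangles by simp
  ultimately have "card empty_triples \<le> card ?T" by (rule card_inj_on_le)
  then show ?thesis using card_empty_triples unfolding n_def by linarith
qed

end

text \<open>The two points of \<open>c\<close> split \<open>P\<close> into two arcs whose interiors
  avoid \<open>c\<close>, so each interior lies on one side. As \<open>P\<close> meets both sides,
  there is one on each.\<close>

lemma chord_decomposition:
  assumes P: "pseudocircle P" and c: "simple_path c" "pathfinish c = pathstart c"
    and two: "card (P \<inter> path_image c) = 2"
    and K: "K \<in> components (S2 - path_image c)" "K' \<in> components (S2 - path_image c)" "K \<noteq> K'"
      "P \<inter> K \<noteq> {}" "P \<inter> K' \<noteq> {}"
  shows "\<exists>\<alpha> \<beta> g g'. arc g \<and> arc g' \<and> 0 \<le> \<alpha> \<and> \<alpha> < \<beta> \<and> \<beta> < 1 \<and>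
    g 0 = c \<alpha> \<and> g 1 = c \<beta> \<and> g' 0 = c \<alpha> \<and> g' 1 = c \<beta> \<and> P \<inter> path_image c = {c \<alpha>, c \<beta>} \<and>
    P = g ` {0..1} \<union> g' ` {0..1} \<and> g ` {0<..<1} \<subseteq> K \<and> g' ` {0<..<1} \<subseteq> K'"
proof -
  obtain x y where xy: "P \<inter> path_image c = {x, y}" "x \<noteq> y" using two by (meson card_2_iff)
  have "x \<in> c ` {0..<1}" "y \<in> c ` {0..<1}" using xy(1) loop_image[OF c(2)] by blast+
  then obtain s t where st: "s \<in> {0..<1}" "t \<in> {0..<1}" "x = c s" "y = c t" by blast
  then have "s \<noteq> t" using xy(2) by blast
  define \<alpha> where "\<alpha> = min s t"
  define \<beta> where "\<beta> = max s t"
  have ab: "0 \<le> \<alpha>" "\<alpha> < \<beta>" "\<beta> < 1" using st \<open>s \<noteq> t\<close> by (auto simp: \<alpha>_def \<beta>_def)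
  have cut: "P \<inter> path_image c = {c \<alpha>, c \<beta>}" unfolding xy(1) st \<alpha>_def \<beta>_def by (cases "s \<le> t") auto
  have ne: "c \<alpha> \<noteq> c \<beta>" using inj_on_eq_iff[OF loop_inj[OF c], of \<alpha> \<beta>] ab by auto
  obtain q where q: "simple_path q" "pathfinish q = pathstart q" "path_image q = P"
    using pseudocircle_imp_loop[OF P] by metis
  have inP: "c \<alpha> \<in> path_image q" "c \<beta> \<in> path_image q" using cut q(3) by blast+
  obtain u d where ud: "arc u" "arc d" "pathstart u = c \<alpha>" "pathfinish u = c \<beta>"
    "pathstart d = c \<beta>" "pathfinish d = c \<alpha>" "path_image u \<inter> path_image d = {c \<alpha>, c \<beta>}"
    "path_image u \<union> path_image d = path_image q"
    by (rule exists_double_arc[OF q(1,2) inP ne])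
  define w where "w = reversepath d"
  have w: "arc w" "pathstart w = c \<alpha>" "pathfinish w = c \<beta>" "path_image w = path_image d"
    using ud by (auto simp: w_def arc_reversepath)
  have open_arc: "path_image a - {c \<alpha>, c \<beta>} = a ` {0<..<1}" "connected (a ` {0<..<1})"
    if "arc a" "pathstart a = c \<alpha>" "pathfinish a = c \<beta>" for a
  proof -
    have s: "simple_path a" using that(1) by (rule arc_imp_simple_path)
    show *: "path_image a - {c \<alpha>, c \<beta>} = a ` {0<..<1}" using simple_path_endless[OF s] that by simp
    show "connected (a ` {0<..<1})" using connected_simple_path_endless[OF s] * that by simp
  qed
  note U = open_arc[OF ud(1,3,4)] and W = open_arc[OF w(1-3)]
  have PS: "P \<subseteq> S2" using P by (simp add: pseudocircle_def)
  have PU: "P = path_image u \<union> path_image w" using ud(8) q(3) w(4) by simp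
  have rest: "P - path_image c = u ` {0<..<1} \<union> w ` {0<..<1}"
    using PU cut U(1) W(1) by blast
  have sub: "u ` {0<..<1} \<subseteq> S2 - path_image c" "w ` {0<..<1} \<subseteq> S2 - path_image c"
    using rest PS by blast+
  have Kc: "K \<inter> path_image c = {}" "K' \<inter> path_image c = {}"
    using in_components_subset[OF K(1)] in_components_subset[OF K(2)] by blast+
  have dis: "K \<inter> K' = {}" using components_eq[OF K(1,2)] K(3) by blast
  have max: "A \<subseteq> X" if "X \<in> components (S2 - path_image c)" "connected A" "A \<subseteq> S2 - path_image c" "A \<inter> X \<noteq> {}" for A X
    using components_maximal[OF that(1-3)] that(4) by blast
  have hitK: "u ` {0<..<1} \<inter> K \<noteq> {} \<or> w ` {0<..<1} \<inter> K \<noteq> {}" using K(4) Kc(1) rest by blast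
  have hitK': "u ` {0<..<1} \<inter> K' \<noteq> {} \<or> w ` {0<..<1} \<inter> K' \<noteq> {}" using K(5) Kc(2) rest by blast
  have ends: "u 0 = c \<alpha>" "u 1 = c \<beta>" "w 0 = c \<alpha>" "w 1 = c \<beta>"
    using ud w by (auto simp: pathstart_def pathfinish_def)
  have sides: "(u ` {0<..<1} \<subseteq> K \<and> w ` {0<..<1} \<subseteq> K') \<or> (w ` {0<..<1} \<subseteq> K \<and> u ` {0<..<1} \<subseteq> K')"
  proof (cases "u ` {0<..<1} \<inter> K = {}")
    case False
    then have uK: "u ` {0<..<1} \<subseteq> K" using max[OF K(1) U(2) sub(1)] by blast
    then have "w ` {0<..<1} \<inter> K' \<noteq> {}" using hitK' dis by blast
    then show ?thesis using uK max[OF K(2) W(2) sub(2)] by blast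
  next
    case True
    then have wK: "w ` {0<..<1} \<subseteq> K" using hitK max[OF K(1) W(2) sub(2)] by blast
    then have "u ` {0<..<1} \<inter> K' \<noteq> {}" using hitK' dis by blast
    then show ?thesis using wK max[OF K(2) U(2) sub(1)] by blast
  qed
  then show ?thesis
  proof
    assume s: "u ` {0<..<1} \<subseteq> K \<and> w ` {0<..<1} \<subseteq> K'"
    show ?thesis
      by (rule exI[of _ \<alpha>], rule exI[of _ \<beta>], rule exI[of _ u], rule exI[of _ w])
        (intro conjI ud(1) w(1) ab ends cut s[THEN conjunct1] s[THEN conjunct2] PU[unfolded path_image_def])
  next
    assume s: "w ` {0<..<1} \<subseteq> K \<and> u ` {0<..<1} \<subseteq> K'"
    have PU': "P = path_image w \<union> path_image u" using PU by (simp add: Un_commute)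
    show ?thesis
      by (rule exI[of _ \<alpha>], rule exI[of _ \<beta>], rule exI[of _ w], rule exI[of _ u])
        (intro conjI ud(1) w(1) ab ends cut s[THEN conjunct1] s[THEN conjunct2] PU'[unfolded path_image_def])
  qed
qed

section \<open>Both sides of the separating curve together\<close>

theorem theorem3:
  fixes \<A> :: "(real^3) set set" and C :: "(real^3) set"
  assumes "simple_arrangement \<A>"
    and "pairwise_intersecting \<A>"
    and "pseudocircle C" and "C \<notin> \<A>"
    and "simple_arrangement (insert C \<A>)"
    and "\<forall>P\<in>\<A>. \<forall>Q\<in>\<A>. P \<noteq> Q \<longrightarrow>
           (\<forall>x\<in>P \<inter> Q. \<forall>y\<in>P \<inter> Q. x \<noteq> y \<longrightarrow>
              (\<exists>K1\<in>components (S2 - C). \<exists>K2\<in>components (S2 - C).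
                  K1 \<noteq> K2 \<and> x \<in> K1 \<and> y \<in> K2))"
  shows "int (card (triangles \<A>)) \<ge> 2 * int (card \<A>) - 4"
proof (cases "card \<A> \<le> 2")
  \<comment> \<open>For at most two curves the bound is not positive. Otherwise each curve meets
    another one, so it has a point on either side of \<open>C\<close> and must meet
    \<open>C\<close>.\<close>
  case False
  obtain K K' where KK: "components (S2 - C) = {K, K'}" "K \<noteq> K'"
    using Jordan_curve_S2[OF assms(3)] by metis
  have Kc: "K \<in> components (S2 - C)" "K' \<in> components (S2 - C)" using KK by auto
  have dis: "K \<inter> K' = {}" using components_eq[OF Kc] KK(2) by blast
  obtain c where c: "simple_path c" "pathfinish c = pathstart c" "path_image c = C"
    using pseudocircle_imp_loop[OF assms(3)] by metis
  have CS: "C \<subseteq> S2" using assms(3) by (simp add: pseudocircle_def)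
  have finA: "finite \<A>" and pseudo: "\<And>P. P \<in> \<A> \<Longrightarrow> pseudocircle P"
    using assms(1) by (auto simp: simple_arrangement_def arrangement_def)
  have meet: "card (P \<inter> Q) = 2 \<and> crossing P Q" if "P \<in> \<A>" "Q \<in> \<A>" "P \<noteq> Q" for P Q
    using assms(1,2) that unfolding simple_arrangement_def arrangement_def pairwise_intersecting_def by meson
  have meetC: "card (P \<inter> C) = 2 \<and> crossing P C" if "P \<in> \<A>" "P \<inter> C \<noteq> {}" for P
  proof -
    have "P \<noteq> C" using that assms(4) by blast
    then show ?thesis
      using assms(5) that unfolding simple_arrangement_def arrangement_def by (meson insertI1 insertI2)
  qed
  have two: "\<exists>x\<in>K. \<exists>y\<in>K'. P \<inter> Q = {x, y}" if PQ: "P \<in> \<A>" "Q \<in> \<A>" "P \<noteq> Q" for P Q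
  proof -
    obtain x y where xy: "P \<inter> Q = {x, y}" "x \<noteq> y" using meet[OF PQ] by (meson card_2_iff)
    then have "x \<in> P \<inter> Q" "y \<in> P \<inter> Q" by auto
    then obtain K1 K2 where "K1 \<in> {K, K'}" "K2 \<in> {K, K'}" "K1 \<noteq> K2" "x \<in> K1" "y \<in> K2"
      using assms(6) PQ xy(2) unfolding KK(1) by meson
    then have "x \<in> K \<and> y \<in> K' \<or> y \<in> K \<and> x \<in> K'" by auto
    then show ?thesis using xy(1) by (metis insert_commute)
  qed
  have other: "\<exists>Q\<in>\<A>. Q \<noteq> P" for P
  proof (rule ccontr)
    assume "\<not> ?thesis"
    then have "\<A> \<subseteq> {P}" by blast
    then have "card \<A> \<le> 1" using card_mono[of "{P}" \<A>] by simp
    then show False using False by simp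
  qed
  have hits: "P \<inter> K \<noteq> {}" "P \<inter> K' \<noteq> {}" if P: "P \<in> \<A>" for P
  proof -
    obtain Q where Q: "Q \<in> \<A>" "Q \<noteq> P" using other by blast
    obtain x y where "x \<in> K" "y \<in> K'" "P \<inter> Q = {x, y}" using two[OF P Q(1) Q(2)[symmetric]] by blast
    then show "P \<inter> K \<noteq> {}" "P \<inter> K' \<noteq> {}" by blast+
  qed
  have hitC: "P \<inter> C \<noteq> {}" if P: "P \<in> \<A>" for P
  proof
    assume "P \<inter> C = {}"
    then have "P \<subseteq> S2 - C" using pseudo[OF P] unfolding pseudocircle_def by blast
    moreover have "connected P" by (rule pseudocircle_connected[OF pseudo[OF P]])
    ultimately have "P \<subseteq> K" using components_maximal[OF Kc(1)] hits(1)[OF P] by blast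
    then show False using hits(2)[OF P] dis by blast
  qed
  let ?D = "\<lambda>P \<alpha> \<beta> g g'. arc g \<and> arc g' \<and> 0 \<le> \<alpha> \<and> \<alpha> < \<beta> \<and> \<beta> < 1 \<and>
    g 0 = c \<alpha> \<and> g 1 = c \<beta> \<and> g' 0 = c \<alpha> \<and> g' 1 = c \<beta> \<and> P \<inter> path_image c = {c \<alpha>, c \<beta>} \<and>
    P = g ` {0..1} \<union> g' ` {0..1} \<and> g ` {0<..<1} \<subseteq> K \<and> g' ` {0<..<1} \<subseteq> K'"
  have "\<forall>P\<in>\<A>. \<exists>\<alpha> \<beta> g g'. ?D P \<alpha> \<beta> g g'"
    using chord_decomposition[OF pseudo c(1,2)] meetC hitC hits Kc KK(2) unfolding c(3) by simp
  then have "\<exists>\<alpha> \<beta> g g'. \<forall>P\<in>\<A>. ?D P (\<alpha> P) (\<beta> P) (g P) (g' P)" unfolding bchoice_iff .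
  then obtain \<alpha> \<beta> g g' where "\<forall>P\<in>\<A>. ?D P (\<alpha> P) (\<beta> P) (g P) (g' P)" by (elim exE) (rule that)
  note ch = this[rule_format]
  have simple: "P \<inter> Q \<inter> R = {}" if "P \<in> \<A>" "Q \<in> \<A>" "R \<in> \<A>" "P \<noteq> Q" "Q \<noteq> R" "P \<noteq> R" for P Q R
    using assms(1) that unfolding simple_arrangement_def by meson
  have simple_c: "P \<inter> Q \<inter> path_image c = {}" if "P \<in> \<A>" "Q \<in> \<A>" "P \<noteq> Q" for P Q
  proof -
    have "P \<noteq> C" "Q \<noteq> C" using that assms(4) by blast+
    then show ?thesis
      unfolding c(3) using assms(5) that unfolding simple_arrangement_def by (meson insertI1 insertI2)
  qed
  have two': "\<exists>x\<in>K'. \<exists>y\<in>K. P \<inter> Q = {x, y}" if "P \<in> \<A>" "Q \<in> \<A>" "P \<noteq> Q" for P Q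
    using two[OF that] by (metis insert_commute)
  have chs: "arc (g P)" "arc (g' P)" "0 \<le> \<alpha> P" "\<alpha> P < \<beta> P" "\<beta> P < 1" "g P 0 = c (\<alpha> P)" "g P 1 = c (\<beta> P)"
    "g' P 0 = c (\<alpha> P)" "g' P 1 = c (\<beta> P)" "P \<inter> path_image c = {c (\<alpha> P), c (\<beta> P)}"
    "P = g P ` {0..1} \<union> g' P ` {0..1}" "g P ` {0<..<1} \<subseteq> K" "g' P ` {0<..<1} \<subseteq> K'" if "P \<in> \<A>" for P
    using ch[OF that] by - (elim conjE, assumption)+
  have whole': "P = g' P ` {0..1} \<union> g P ` {0..1}" if "P \<in> \<A>" for P
    using chs(11)[OF that] by (rule trans[OF _ Un_commute])
  have cS: "path_image c \<subseteq> S2" using CS c(3) by simp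
  have comps: "K \<in> components (S2 - path_image c)" "K' \<in> components (S2 - path_image c)"
    using Kc c(3) by simp_all
  have crc: "crossing P (path_image c)" if "P \<in> \<A>" for P using meetC[OF that hitC[OF that]] c(3) by simp
  have cr: "crossing P Q" if "P \<in> \<A>" "Q \<in> \<A>" "P \<noteq> Q" for P Q using meet[OF that] by simp
  have D1: "disk_chords \<A> K K' c \<alpha> \<beta> g g'"
    by (rule disk_chords.intro; (rule finA c cS comps KK(2) |
        rule pseudo chs cr crc two simple simple_c; assumption))
  \<comment> \<open>The same configuration with the two sides, and the two chords of every curve,
    exchanged.\<close>
  have D2: "disk_chords \<A> K' K c \<alpha> \<beta> g' g"
    by (rule disk_chords.intro; (rule finA c cS comps KK(2)[symmetric] |
        rule pseudo chs(1-10,12,13) whole' cr crc two' simple simple_c; assumption))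
  let ?T = "\<lambda>X. {F \<in> triangles \<A>. closure F \<inter> crossings \<A> \<subseteq> X}"
  have c1: "card \<A> - 2 \<le> card (?T K)" and c2: "card \<A> - 2 \<le> card (?T K')"
    using disk_chords.card_triangles_in_disk[OF D1] disk_chords.card_triangles_in_disk[OF D2] .
  have fin: "finite (triangles \<A>)" using disk_chords.finite_triangles[OF D1] .
  \<comment> \<open>A triangle in both families would have all its vertices in two disjoint sets,
    hence none at all, instead of three.\<close>
  have "?T K \<inter> ?T K' = {}"
  proof (rule ccontr)
    assume "\<not> ?thesis"
    then obtain F where F: "F \<in> triangles \<A>" "closure F \<inter> crossings \<A> \<subseteq> K" "closure F \<inter> crossings \<A> \<subseteq> K'" by blast
    then have "closure F \<inter> crossings \<A> = {}" using dis by blast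
    then show False using F(1) by (simp add: triangles_def)
  qed
  then have "card (?T K \<union> ?T K') = card (?T K) + card (?T K')"
    using fin by (intro card_Un_disjoint) auto
  moreover have "card (?T K \<union> ?T K') \<le> card (triangles \<A>)" using fin by (intro card_mono) auto
  ultimately show ?thesis using c1 c2 False by linarith
qed linarith

end
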